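(* In the setting described in the context, suppose $(T_{\lambda,\sigma})$ has an anomaly of second order, let $p=\mathbf E(p_{1,\sigma}^2)$ and $q=2\,\mathbf E(p_{K,\sigma})+\mathbf E(p_{1,\sigma}\,\partial_\theta p_{1,\sigma})$, and suppose that $q(\hat\theta)\neq0$ whenever $p(\hat\theta)=0$. Let $\rho$ be the unique non-negative, normalized, continuous groundstate of the Fokker–Planck operator $\mathcal L^*=\partial_\theta(\partial_\theta p-q)$. Let $\tilde K>K$ be the index of the first $k>K$ with $\mathbf E(P_{\eta_k,\sigma})\neq0$ and $\tilde\eta=\min\{\eta_{\tilde K},\eta_1+\eta_2\}$. Then for every $f\in C^2(S^1_\pi)$, $$I_N(f)=\int_0^\pi d\theta\,f(\theta)\rho(\theta)+\mathcal O\big(\lambda^{\tilde\eta-\eta_K},(\lambda^{\eta_K}N)^{-1}\big),$$ where the error is bounded by a constant (independent of $N$) times $\lambda^{\tilde\eta-\eta_K}+(\lambda^{\eta_K}N)^{-1}$ for small $\lambda>0$. If $p$ has no zero, the same holds for every $f\in C^1(S^1_\pi)$.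
   Context: Let $(\Sigma,\mathbf p)$ be a probability space and $(T_{\lambda,\sigma})$ a family in $SL(2,\mathbb R)$ (compactly supported for small $\lambda$, with $\lambda$-dependence a power series with nonnegative exponents) such that for a fixed $M\in SL(2,\mathbb R)$: $MT_{\lambda,\sigma}M^{-1}=\pm\exp\big(\sum_{k\ge1}\lambda^{\eta_k}P_{\eta_k,\sigma}\big)$, $P_{\eta_k,\sigma}\in sl(2,\mathbb R)$, $0<\eta_1<\eta_2<\cdots$, with an index $K$ such that $\eta_K=2\eta_1$, $\eta_{K+1}\le\eta_1+\eta_2$, and $\mathbf p(P_{\eta_k,\sigma}=0)<1$ for $k<K$. Second order anomaly: $\mathbf E(P_{\eta_k,\sigma})=0$ for $k=1,\ldots,K-1$. For $P_{\eta_k,\sigma}=\begin{pmatrix}a&b\\c&-a\end{pmatrix}$ put $p_{k,\sigma}(\theta)=c\cos^2\theta-b\sin^2\theta-a\sin(2\theta)$ on $S^1_\pi=\mathbb R/\pi\mathbb Z$. A groundstate of $\mathcal L^*$ is a $\pi$-periodic solution $\rho$ of $p\rho'+(p'-q)\rho=C$ for some constant $C$, with $\int_0^\pi\rho=1$ (under the hypothesis on zeros it exists and is unique, non-negative, continuous). For $T\in SL(2,\mathbb R)$, $\mathcal S_T$ on $S^1_\pi$ is defined by $e_{\mathcal S_T(\theta)}=\pm Te_\theta/\|Te_\theta\|$, $e_\theta=(\cos\theta,\sin\theta)^T$; $\mathcal S_{\lambda,\sigma}=\mathcal S_{MT_{\lambda,\sigma}M^{-1}}$; with $(\sigma_n)$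 i.i.d. of law $\mathbf p$ and $\theta_0\in S^1_\pi$, $\theta_{n+1}=\mathcal S_{\lambda,\sigma_{n+1}}(\theta_n)$, and $I_N(f)=\frac1N\mathbf E\sum_{n=0}^{N-1}f(\theta_n)$. *)

theory Defs
  imports "HOL-Analysis.Analysis" "HOL-Probability.Probability"
begin

type_synonym mat2 = "real^2^2"

fun matpow :: "mat2 \<Rightarrow> nat \<Rightarrow> mat2" where
  "matpow X 0 = mat 1"
| "matpow X (Suc n) = X ** matpow X n"

definition mexp :: "mat2 \<Rightarrow> mat2" where
  "mexp X = (\<Sum>n. (1 / fact n) *\<^sub>R matpow X n)"

definition SL2 :: "mat2 set" where
  "SL2 = {A. det A = 1}"

definition sl2 :: "mat2 set" where
  "sl2 = {A. A $ 1 $ 1 + A $ 2 $ 2 = 0}"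

definition pk :: "mat2 \<Rightarrow> real \<Rightarrow> real" where
  "pk P \<theta> = P $ 2 $ 1 * (cos \<theta>)^2 - P $ 1 $ 2 * (sin \<theta>)^2 - P $ 1 $ 1 * sin (2 * \<theta>)"

definition evec :: "real \<Rightarrow> real^2" where
  "evec \<theta> = vector [cos \<theta>, sin \<theta>]"

text \<open>Action of T on the projective line S^1_pi (angles in [0,pi) as representatives).\<close>
definition ST :: "mat2 \<Rightarrow> real \<Rightarrow> real" where
  "ST T \<theta> = (THE \<phi>. 0 \<le> \<phi> \<and> \<phi> < pi \<and>
      (evec \<phi> = (1 / norm (T *v evec \<theta>)) *\<^sub>R (T *v evec \<theta>) \<or>
       evec \<phi> = - ((1 / norm (T *v evec \<theta>)) *\<^sub>R (T *v evec \<theta>))))"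

definition pi_periodic :: "(real \<Rightarrow> real) \<Rightarrow> bool" where
  "pi_periodic g \<longleftrightarrow> (\<forall>x. g (x + pi) = g x)"

definition C1_circ :: "(real \<Rightarrow> real) \<Rightarrow> bool" where
  "C1_circ f \<longleftrightarrow> pi_periodic f \<and>
     (\<exists>f'. (\<forall>x. (f has_real_derivative f' x) (at x)) \<and> continuous_on UNIV f')"

definition C2_circ :: "(real \<Rightarrow> real) \<Rightarrow> bool" where
  "C2_circ f \<longleftrightarrow> pi_periodic f \<and>
     (\<exists>f' f''. (\<forall>x. (f has_real_derivative f' x) (at x)) \<and>
               (\<forall>x. (f' has_real_derivative f'' x) (at x)) \<and> continuous_on UNIV f'')"

text \<open>Groundstate of L* = d/dtheta (d/dtheta p - q): pi-periodic rho with
  p rho' + (p' - q) rho = C, i.e. (p rho)' = q rho + C, and integral 1 over [0,pi].\<close>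
definition groundstate :: "(real \<Rightarrow> real) \<Rightarrow> (real \<Rightarrow> real) \<Rightarrow> (real \<Rightarrow> real) \<Rightarrow> bool" where
  "groundstate p q \<rho> \<longleftrightarrow> pi_periodic \<rho> \<and>
     (\<exists>C. \<forall>\<theta>. ((\<lambda>t. p t * \<rho> t) has_real_derivative (q \<theta> * \<rho> \<theta> + C)) (at \<theta>)) \<and>
     \<rho> integrable_on {0..pi} \<and> integral {0..pi} \<rho> = 1"

text \<open>Random dynamics: theta_0 given, theta_{n+1} = S_{sigma_{n+1}}(theta_n); omega !! n = sigma_{n+1}.\<close>
fun theta_seq :: "('s \<Rightarrow> real \<Rightarrow> real) \<Rightarrow> real \<Rightarrow> 's stream \<Rightarrow> nat \<Rightarrow> real" where
  "theta_seq S \<theta>0 \<omega> 0 = \<theta>0"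
| "theta_seq S \<theta>0 \<omega> (Suc n) = S (\<omega> !! n) (theta_seq S \<theta>0 \<omega> n)"

definition I_N :: "'s measure \<Rightarrow> ('s \<Rightarrow> real \<Rightarrow> real) \<Rightarrow> real \<Rightarrow> nat \<Rightarrow> (real \<Rightarrow> real) \<Rightarrow> real" where
  "I_N M S \<theta>0 N f = (1 / real N) *
     (\<integral>\<omega>. (\<Sum>n<N. f (theta_seq S \<theta>0 \<omega> n)) \<partial>stream_space M)"

end

theory Submission
  imports Defs "HOL-Complex_Analysis.Great_Picard"
begin

text \<open>
  Write \<open>L F = p F'' + q F'\<close>. A third order Taylor expansion along the projective flow of the
  exponential gives \<open>E F(\<theta>\<^sub>1) - F(\<theta>\<^sub>0) = (lam powr \<eta> K / 2) L F(\<theta>\<^sub>0)\<close> up to an error of order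
  \<open>lam powr eta_t\<close>; summing over \<open>n < N\<close> bounds \<open>I_N (L F)\<close>. It remains to solve
  \<open>L F = f - c\<close> up to an arbitrarily small error by periodic \<open>F\<close> with three bounded derivatives, and
  pairing with the groundstate identifies \<open>c\<close> with \<open>\<integral> f \<rho>\<close> in the limit.

  If \<open>p\<close> has no zero, the first order equation for \<open>G = F'\<close> is regular. Otherwise \<open>p\<close> is replaced
  by \<open>p + \<epsilon>\<close>, and the bounds must be uniform in \<open>\<epsilon>\<close>. Differentiating the equation replaces \<open>q\<close> by
  \<open>q + p'\<close>, \<open>q + 2 p'\<close>, none of which vanishes at a zero of \<open>p\<close>, so evaluation at a global
  extremum bounds \<open>G'\<close> and \<open>G''\<close> by \<open>G\<close>. Were \<open>G\<close> not bounded uniformly, a normalised subsequence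
  would converge to a nonzero periodic \<open>\<gamma>\<close> with mean zero and \<open>p \<gamma>' + q \<gamma> = 0\<close>. Such a \<open>\<gamma>\<close> has constant
  sign on each arc without zeros of \<open>p\<close> and vanishes on one side of each zero; as \<open>p\<close> has at most two
  zeros per period, this is impossible.
\<close>

subsection \<open>Periodic functions and the corrector equation\<close>

text \<open>The obstacle is the zeros of \<open>p\<close>: there L is of first order only and the
  equation for F'' cannot be divided by \<open>p\<close>. Regularising helps only if the bounds
  survive epsilon -> 0, because lam and N are held fixed in that limit. Since \<open>p\<close> is
  nonnegative, each zero is a minimum, so p' vanishes there and q, q + p', q + 2 p' all take the
  value q there: this is how the hypothesis on zeros controls all derivatives at once.

  Smoothness of \<open>f\<close> is spent as follows. Bounding F''' by a maximum principle uses the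
  twice differentiated equation, hence f''; without zeros, F''' is an explicit quotient in which
  only f' occurs.

  In the compactness argument, gamma has mean zero because G is the derivative of a periodic
  function. On an arc it is a multiple of exp(- int q/p). On the side of a zero to which q points,
  |gamma| cannot grow when moving away from the zero, while gamma is 0 at the zero. At most two
  zeros occur because p(theta) = 0 makes e_theta an eigenvector of almost every P_1, and a nonzero
  traceless 2x2 matrix has at most two eigendirections.\<close>

lemma pi_periodic_add_int:
  assumes "pi_periodic g"
  shows "g (x + of_int n * pi) = g x"
proof (induction n rule: int_induct[where k = 0])
  case base
  show ?case by simp
next
  case (step1 i)
  have "g (x + of_int (i + 1) * pi) = g ((x + of_int i * pi) + pi)"
    by (simp add: algebra_simps)
  with step1 assms show ?case by (simp add: pi_periodic_def)
next
  case (step2 i)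
  have "g (x + of_int i * pi) = g ((x + of_int (i - 1) * pi) + pi)"
    by (simp add: algebra_simps)
  with step2 assms show ?case by (simp add: pi_periodic_def)
qed

lemma pi_representative:
  obtains y and n :: int where "a \<le> y" "y < a + pi" "x = y + of_int n * pi"
proof
  define n where "n = \<lfloor>(x - a) / pi\<rfloor>"
  have "of_int n \<le> (x - a) / pi" "(x - a) / pi < of_int n + 1"
    by (simp_all add: n_def)
  hence "of_int n * pi \<le> x - a" "x - a < (of_int n + 1) * pi"
    by (simp_all add: field_simps)
  thus "a \<le> x - of_int n * pi" "x - of_int n * pi < a + pi"
    by (simp_all add: algebra_simps)
  show "x = (x - of_int n * pi) + of_int n * pi" by simp
qed

lemma pi_periodic_range:
  assumes "pi_periodic g"
  obtains y where "a \<le> y" "y < a + pi" "g x = g y"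
  by (metis assms pi_periodic_add_int pi_representative)

lemma pi_periodic_deriv:
  assumes "pi_periodic f" "\<And>x. (f has_real_derivative f' x) (at x)"
  shows "pi_periodic f'"
  unfolding pi_periodic_def
proof
  fix x
  have "((\<lambda>x. f (x + pi)) has_real_derivative f' (x + pi)) (at x)"
    using assms(2)[of "x + pi"] by (simp add: DERIV_shift)
  moreover have "(\<lambda>x. f (x + pi)) = f" using assms(1) by (auto simp: pi_periodic_def)
  ultimately show "f' (x + pi) = f' x" using assms(2) DERIV_unique by metis
qed

lemma pi_periodic_attains_max:
  fixes g :: "real \<Rightarrow> real"
  assumes "pi_periodic g" "continuous_on UNIV g"
  obtains x where "a \<le> x" "x < a + pi" "\<And>y. g y \<le> g x"
proof -
  have "continuous_on {a..a+pi} g" using assms continuous_on_subset by blast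
  then obtain x where x: "x \<in> {a..a+pi}" "\<And>y. y \<in> {a..a+pi} \<Longrightarrow> g y \<le> g x"
    using continuous_attains_sup[of "{a..a+pi}" g] by (auto simp: less_imp_le)
  obtain x' where x': "a \<le> x'" "x' < a + pi" "g x = g x'"
    using pi_periodic_range[OF assms(1)] by blast
  show ?thesis
  proof
    show "a \<le> x'" "x' < a + pi" by fact+
    fix y
    show "g y \<le> g x'"
      using pi_periodic_range[OF assms(1), of a y] x x' by (metis atLeastAtMost_iff less_imp_le)
  qed
qed

lemma pi_periodic_bounded:
  fixes g :: "real \<Rightarrow> real"
  assumes "pi_periodic g" "continuous_on UNIV g"
  obtains B where "\<And>x. \<bar>g x\<bar> \<le> B"
proof -
  have "pi_periodic (\<lambda>x. \<bar>g x\<bar>)" "continuous_on UNIV (\<lambda>x. \<bar>g x\<bar>)"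
    using assms by (auto simp: pi_periodic_def intro: continuous_intros)
  then show ?thesis using pi_periodic_attains_max that by metis
qed

lemma has_real_derivative_imp_continuous_on:
  fixes f :: "real \<Rightarrow> real"
  assumes "\<And>x. (f has_real_derivative f' x) (at x)"
  shows "continuous_on S f"
  by (rule continuous_at_imp_continuous_on) (blast intro: DERIV_isCont assms)

lemma continuous_imp_antiderivative:
  fixes g :: "real \<Rightarrow> real"
  assumes "continuous_on UNIV g"
  obtains G where "\<And>x. (G has_real_derivative g x) (at x)"
proof -
  define G where "G x = (if 0 \<le> x then integral {0..x} g else - integral {x..0} g)" for x
  have int: "g integrable_on {a..b}" for a b
    by (rule integrable_continuous_real) (rule continuous_on_subset[OF assms], simp)
  have "(G has_real_derivative g x) (at x)" for x
  proof -
    define a b where "a = min 0 x - 1" and "b = max 0 x + 1"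
    \<comment> \<open>\<open>a\<close> and \<open>b\<close> enclose both 0 and \<open>x\<close>, so
      inside this window \<open>G\<close> and the integral from \<open>a\<close> differ by a
      constant, whatever the sign of \<open>y\<close>.\<close>
    have eq: "G y = integral {a..y} g - integral {a..0} g" if "y \<in> {a<..<b}" for y
    proof (cases "0 \<le> y")
      case True
      have "integral {a..0} g + integral {0..y} g = integral {a..y} g"
        by (rule Henstock_Kurzweil_Integration.integral_combine) (use True int in \<open>auto simp: a_def\<close>)
      with True show ?thesis by (simp add: G_def)
    next
      case False
      have "integral {a..y} g + integral {y..0} g = integral {a..0} g"
        by (rule Henstock_Kurzweil_Integration.integral_combine) (use False int that in \<open>auto simp: a_def\<close>)
      with False show ?thesis by (simp add: G_def)
    qed
    have x: "x \<in> {a<..<b}" by (auto simp: a_def b_def)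
    have "((\<lambda>y. integral {a..y} g) has_real_derivative g x) (at x within {a..b})"
      by (rule integral_has_real_derivative)
        (use x assms continuous_on_subset in \<open>auto intro: less_imp_le\<close>)
    hence "((\<lambda>y. integral {a..y} g) has_real_derivative g x) (at x within {a<..<b})"
      by (rule DERIV_subset) auto
    hence "((\<lambda>y. integral {a..y} g) has_real_derivative g x) (at x)"
      using x at_within_open[of x "{a<..<b}"] by (metis open_greaterThanLessThan)
    hence "((\<lambda>y. integral {a..y} g - integral {a..0} g) has_real_derivative g x) (at x)"
      by (auto intro!: derivative_eq_intros)
    thus ?thesis
      by (rule has_field_derivative_transform_within_open[where S = "{a<..<b}"]) (use eq x in auto)
  qed
  thus ?thesis using that by blast
qed

section \<open>Solvability of the corrector equation for a positive leading coefficient\<close>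

lemma periodic_antiderivative:
  assumes "\<And>x. (F has_real_derivative G x) (at x)" "pi_periodic G" "F pi = F 0"
  shows "pi_periodic F"
  unfolding pi_periodic_def
proof
  fix x
  have "((\<lambda>x. F (x + pi) - F x) has_real_derivative 0) (at y)" for y
  proof -
    have "((\<lambda>x. F (x + pi)) has_real_derivative G (y + pi)) (at y)"
      using assms(1)[of "y + pi"] by (simp add: DERIV_shift)
    hence "((\<lambda>x. F (x + pi) - F x) has_real_derivative G (y + pi) - G y) (at y)"
      using assms(1) by (auto intro!: derivative_eq_intros)
    thus ?thesis using assms(2) by (simp add: pi_periodic_def)
  qed
  hence "F (x + pi) - F x = F (0 + pi) - F 0"
    using DERIV_isconst_all[of "\<lambda>x. F (x + pi) - F x" x 0] by blast
  thus "F (x + pi) = F x" using assms(3) by simp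
qed

text \<open>For \<open>G = F'\<close> the equation is linear of first order; with the integrating
  factor \<open>u = exp (- Q)\<close>, \<open>Q' = q / P\<close>, its solutions are
  \<open>u * (A + b - c * a)\<close>. The two free numbers \<open>A\<close> and \<open>c\<close> are
  spent on two closing conditions: equal values of \<open>G\<close> at 0 and \<open>pi\<close>, and
  zero mean of \<open>G\<close>, which makes \<open>F\<close> periodic. The conclusion
  \<open>c \<in> range f\<close> bounds \<open>c\<close> by the supremum of \<open>|f|\<close>
  whatever \<open>P\<close> is, and therefore uniformly under regularisation.\<close>

lemma exists_periodic_corrector:
  fixes P q f :: "real \<Rightarrow> real"
  assumes per: "pi_periodic P" "pi_periodic q" "pi_periodic f"
    and cont: "continuous_on UNIV P" "continuous_on UNIV q" "continuous_on UNIV f"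
    and pos: "\<And>x. P x > 0"
  obtains F G H c where "pi_periodic F" "\<And>x. (F has_real_derivative G x) (at x)"
    "\<And>x. (G has_real_derivative H x) (at x)" "\<And>x. P x * H x + q x * G x = f x - c"
    "c \<in> range f"
proof -
  have nz: "P x \<noteq> 0" for x using pos[of x] by simp
  have "continuous_on UNIV (\<lambda>x. q x / P x)"
    using cont nz by (auto intro!: continuous_intros)
  then obtain Q where Q: "\<And>x. (Q has_real_derivative q x / P x) (at x)"
    using continuous_imp_antiderivative by blast
  define u where "u x = exp (- Q x)" for x
  have upos: "u x > 0" for x by (simp add: u_def)
  have unz: "u x \<noteq> 0" for x using upos[of x] by simp
  have du: "(u has_real_derivative - (q x / P x) * u x) (at x)" for x
    unfolding u_def by (rule derivative_eq_intros Q refl | simp)+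
  have ucont: "continuous_on UNIV u"
    by (rule has_real_derivative_imp_continuous_on[OF du])
  have "continuous_on UNIV (\<lambda>x. 1 / (P x * u x))"
    using cont nz unz ucont by (auto intro!: continuous_intros)
  then obtain a0 where a0: "\<And>x. (a0 has_real_derivative 1 / (P x * u x)) (at x)"
    using continuous_imp_antiderivative by blast
  have "continuous_on UNIV (\<lambda>x. f x / (P x * u x))"
    using cont nz unz ucont by (auto intro!: continuous_intros)
  then obtain b0 where b0: "\<And>x. (b0 has_real_derivative f x / (P x * u x)) (at x)"
    using continuous_imp_antiderivative by blast
  define a b where "a x = a0 x - a0 0" and "b x = b0 x - b0 0" for x
  have da: "(a has_real_derivative 1 / (P x * u x)) (at x)" for x
    unfolding a_def by (auto intro!: derivative_eq_intros a0)
  have db: "(b has_real_derivative f x / (P x * u x)) (at x)" for x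
    unfolding b_def by (auto intro!: derivative_eq_intros b0)
  have a_mono: "a x < a y" if "x < y" for x y
    by (rule DERIV_pos_imp_increasing[OF that])
      (use da pos upos in \<open>metis mult_pos_pos zero_less_divide_1_iff\<close>)
  have [simp]: "a 0 = 0" "b 0 = 0" by (simp_all add: a_def b_def)
  have api: "a pi > 0" using a_mono[of 0 pi] by simp
  \<comment> \<open>Both numbers come from the endpoint conditions: \<open>U\<close> solves the
    equation with right-hand side \<open>- k\<close>, \<open>V\<close> with right-hand side
    \<open>f - l\<close>, and each takes equal values at 0 and \<open>pi\<close>. Hence so does
    \<open>A * U + V\<close> for every \<open>A\<close>, with constant
    \<open>c = A * k + l\<close>.\<close>
  define k l where "k = (1 - u 0 / u pi) / a pi" and "l = b pi / a pi"
  define U V where "U x = u x * (1 - k * a x)" and "V x = u x * (b x - l * a x)" for x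
  have Ucont: "continuous_on UNIV U" "continuous_on UNIV V"
    unfolding U_def V_def
    by (intro continuous_intros ucont has_real_derivative_imp_continuous_on[OF da]
      has_real_derivative_imp_continuous_on[OF db])+
  obtain FU where FU: "\<And>x. (FU has_real_derivative U x) (at x)"
    using Ucont continuous_imp_antiderivative by blast
  obtain FV where FV: "\<And>x. (FV has_real_derivative V x) (at x)"
    using Ucont continuous_imp_antiderivative by blast
  \<comment> \<open>The factor \<open>1 - k * a x\<close> interpolates between 1 at 0 and
    \<open>u 0 / u pi\<close> at \<open>pi\<close>, both positive. So \<open>U\<close> has positive
    integral, and the zero mean condition can be solved for \<open>A\<close>.\<close>
  have Upos: "U x > 0" if "0 \<le> x" "x \<le> pi" for x
  proof -
    define t where "t = a x / a pi"
    have t: "0 \<le> t" "t \<le> 1"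
      using that a_mono[of 0 x] a_mono[of x pi] api
      by (cases "x = 0"; cases "x = pi"; force simp: t_def)+
    have "1 - k * a x = (1 - t) + t * (u 0 / u pi)"
      using api by (simp add: k_def t_def field_simps)
    moreover have "(1 - t) + t * (u 0 / u pi) > 0"
    proof (cases "t = 1")
      case True thus ?thesis using upos by simp
    next
      case False thus ?thesis using t upos[of 0] upos[of pi] by (simp add: add_pos_nonneg)
    qed
    ultimately show ?thesis using upos by (simp add: U_def)
  qed
  have FUpos: "FU 0 < FU pi"
    by (rule DERIV_pos_imp_increasing) (use FU Upos in auto)
  define A where "A = - (FV pi - FV 0) / (FU pi - FU 0)"
  define c where "c = A * k + l"
  define F G where "F x = A * FU x + FV x" and "G x = A * U x + V x" for x
  define H where "H x = (f x - c - q x * G x) / P x" for x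
  have dF: "(F has_real_derivative G x) (at x)" for x
    unfolding F_def G_def by (auto intro!: derivative_eq_intros FU FV)
  have Geq: "G x = u x * (A + b x - c * a x)" for x
    by (simp add: G_def U_def V_def c_def algebra_simps)
  have dG: "(G has_real_derivative H x) (at x)" for x
  proof -
    have "((\<lambda>x. u x * (A + b x - c * a x)) has_real_derivative
        - (q x / P x) * u x * (A + b x - c * a x) + u x * (f x / (P x * u x) - c * (1 / (P x * u x)))) (at x)"
      by (rule derivative_eq_intros du da db refl | simp)+
    moreover have "- (q x / P x) * u x * (A + b x - c * a x) + u x * (f x / (P x * u x) - c * (1 / (P x * u x))) = H x"
      unfolding H_def Geq using nz[of x] unz[of x] by (simp add: field_simps)
    ultimately show ?thesis unfolding Geq[abs_def] by simp
  qed
  have GH: "P x * H x + q x * G x = f x - c" for x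
    using nz[of x] by (simp add: H_def)
  have U0: "U 0 = u 0" "U pi = u 0" "V 0 = 0" "V pi = 0"
    using api unz[of pi] by (simp_all add: U_def V_def k_def l_def)
  have Gpi: "G pi = G 0" by (simp add: G_def U0)
  have Fpi: "F pi = F 0" using FUpos by (simp add: F_def A_def field_simps)
  \<comment> \<open>\<open>G (x + pi) - G x\<close> solves the homogeneous equation, so its quotient
    by \<open>u\<close> is constant; periodicity at the single point 0 thus spreads to all
    points.\<close>
  have dD: "((\<lambda>x. (G (x + pi) - G x) / u x) has_real_derivative 0) (at x)" for x
  proof -
    have "((\<lambda>x. G (x + pi)) has_real_derivative H (x + pi)) (at x)"
      using dG[of "x + pi"] by (simp add: DERIV_shift)
    hence "((\<lambda>x. (G (x + pi) - G x) / u x) has_real_derivative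
       ((H (x + pi) - H x) * u x - (G (x + pi) - G x) * (- (q x / P x) * u x)) / (u x * u x)) (at x)"
      by (intro DERIV_divide DERIV_diff dG du unz)
    moreover have "H (x + pi) - H x = - (q x / P x) * (G (x + pi) - G x)"
    proof -
      have "P (x + pi) = P x" "q (x + pi) = q x" "f (x + pi) = f x"
        using per by (auto simp: pi_periodic_def)
      thus ?thesis using nz[of x] by (simp add: H_def field_simps)
    qed
    ultimately show ?thesis by simp
  qed
  have Gper: "pi_periodic G"
    unfolding pi_periodic_def
  proof
    fix x
    have "(G (x + pi) - G x) / u x = (G (0 + pi) - G 0) / u 0"
      using DERIV_isconst_all[of "\<lambda>x. (G (x + pi) - G x) / u x" x 0] dD by blast
    thus "G (x + pi) = G x" using Gpi unz[of x] by simp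
  qed
  have Fper: "pi_periodic F" using periodic_antiderivative dF Gper Fpi by blast
  \<comment> \<open>Rolle twice: periodicity of \<open>F\<close> gives a zero \<open>z\<close> of
    \<open>G\<close>, hence zeros of \<open>G / u\<close> at \<open>z\<close> and
    \<open>z + pi\<close>, and between these a zero of its derivative
    \<open>(f - c) / (P * u)\<close>.\<close>
  obtain z where z: "G z = 0"
    using MVT2[of 0 pi F G] dF Fpi by force
  have dW: "((\<lambda>x. A + b x - c * a x) has_real_derivative (f x - c) / (P x * u x)) (at x)" for x
    by (rule derivative_eq_intros da db refl | simp add: diff_divide_distrib)+
  have W: "A + b z - c * a z = 0" "A + b (z + pi) - c * a (z + pi) = 0"
  proof -
    have "G (z + pi) = 0" using z Gper by (simp add: pi_periodic_def)
    thus "A + b z - c * a z = 0" "A + b (z + pi) - c * a (z + pi) = 0"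
      using z unz[of z] unz[of "z + pi"] unfolding Geq by simp_all
  qed
  obtain \<xi> where "(f \<xi> - c) / (P \<xi> * u \<xi>) = 0"
    using MVT2[of z "z + pi" "\<lambda>x. A + b x - c * a x"] dW W by force
  hence "c \<in> range f" using nz[of \<xi>] unz[of \<xi>] by auto
  with Fper dF dG GH show ?thesis using that by blast
qed

subsection \<open>Uniform estimates for the regularised corrector\<close>

lemma derivative_bound_imp_lipschitz:
  fixes g :: "real \<Rightarrow> real"
  assumes "\<And>x. (g has_real_derivative g' x) (at x)" "\<And>x. \<bar>g' x\<bar> \<le> C"
  shows "\<bar>g x - g y\<bar> \<le> C * \<bar>x - y\<bar>"
  using field_differentiable_bound[of UNIV g g' C x y] assms by simp

text \<open>At a maximum of the square of \<open>H\<close> the product \<open>H * H1\<close> is 0,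
  so either \<open>H\<close> is 0 or the leading term drops out and \<open>r * H = h\<close>. Where
  \<open>|r|\<close> is at least \<open>\<delta>\<close> this bounds \<open>H\<close> by
  \<open>S / \<delta>\<close>; elsewhere \<open>p\<close> is at least \<open>\<delta>\<close> and
  \<open>M\<close> applies. \<open>P\<close> is kept apart from \<open>p\<close> because it will be
  \<open>p + \<epsilon>\<close>: the size of the leading coefficient does not enter the resulting
  bound.\<close>

lemma periodic_max_principle:
  fixes H :: "real \<Rightarrow> real"
  assumes "pi_periodic H" and dH: "\<And>x. (H has_real_derivative H1 x) (at x)"
    and eq: "\<And>x. P x * H1 x + r x * H x = h x"
    and \<delta>: "\<delta> > 0" "\<And>x. p x \<ge> \<delta> \<or> \<bar>r x\<bar> \<ge> \<delta>"
    and h: "\<And>x. \<bar>h x\<bar> \<le> S" and M: "\<And>x. p x \<ge> \<delta> \<Longrightarrow> \<bar>H x\<bar> \<le> M"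
  shows "\<bar>H y\<bar> \<le> max M (S / \<delta>)"
proof -
  have "pi_periodic (\<lambda>x. (H x)\<^sup>2)" using assms(1) by (simp add: pi_periodic_def)
  moreover have "continuous_on UNIV (\<lambda>x. (H x)\<^sup>2)"
    by (intro continuous_intros has_real_derivative_imp_continuous_on[OF dH])
  ultimately obtain x where x: "\<And>y. (H y)\<^sup>2 \<le> (H x)\<^sup>2"
    using pi_periodic_attains_max by blast
  have "((\<lambda>x. (H x)\<^sup>2) has_real_derivative 2 * H x * H1 x) (at x)"
    by (auto intro!: derivative_eq_intros dH)
  hence crit: "2 * H x * H1 x = 0"
    by (rule DERIV_local_max[where d = 1]) (use x in auto)
  have le: "\<bar>H y\<bar> \<le> \<bar>H x\<bar>" using x[of y] by (simp add: abs_le_square_iff)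
  show ?thesis
  proof (cases "p x \<ge> \<delta>")
    case True
    thus ?thesis using M[of x] le by simp
  next
    case False
    hence r: "\<bar>r x\<bar> \<ge> \<delta>" using \<delta> by blast
    show ?thesis
    proof (cases "H x = 0")
      case True
      have "0 \<le> S / \<delta>" using h[of x] \<delta>(1) by simp
      thus ?thesis using True le by simp
    next
      case False
      hence "r x * H x = h x" using eq[of x] crit by simp
      hence "\<bar>r x\<bar> * \<bar>H x\<bar> \<le> S" using h[of x] by (metis abs_mult)
      moreover have "\<delta> * \<bar>H x\<bar> \<le> \<bar>r x\<bar> * \<bar>H x\<bar>" using r by (intro mult_right_mono) auto
      ultimately have "\<bar>H x\<bar> \<le> S / \<delta>" using \<delta>(1) by (simp add: field_simps)
      thus ?thesis using le by simp
    qed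
  qed
qed

text \<open>The integral of a non-integrable function is 0 by convention, which keeps the inequality
  true in that case as well.\<close>

lemma integral_nonneg_real:
  fixes f :: "real \<Rightarrow> real"
  assumes "\<And>x. x \<in> A \<Longrightarrow> 0 \<le> f x"
  shows "0 \<le> integral A f"
  using assms by (cases "f integrable_on A")
    (auto intro: Henstock_Kurzweil_Integration.integral_nonneg simp: not_integrable_integral)

lemma abs_le_divide_of_mult:
  fixes a b \<delta> S :: real
  assumes "\<delta> \<le> a" "0 < \<delta>" "\<bar>a * b\<bar> \<le> S"
  shows "\<bar>b\<bar> \<le> S / \<delta>"
proof -
  have "\<delta> * \<bar>b\<bar> \<le> \<bar>a\<bar> * \<bar>b\<bar>" using assms by (intro mult_right_mono) auto
  thus ?thesis using assms by (simp add: abs_mult field_simps)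
qed

text \<open>Suffixes 1 and 2 denote derivatives and \<open>S\<close> is a common bound.
  \<open>\<delta>\<close> quantifies an alternative: where \<open>p\<close> is small, the zeroth
  order coefficients of the equation for \<open>G\<close> and of its first two derivatives are all
  bounded away from 0.\<close>

locale degenerate_elliptic =
  fixes p p1 p2 q q1 q2 f f1 f2 :: "real \<Rightarrow> real" and S \<delta> :: real
  assumes per: "pi_periodic p" "pi_periodic q" "pi_periodic f"
    and dp: "\<And>x. (p has_real_derivative p1 x) (at x)" "\<And>x. (p1 has_real_derivative p2 x) (at x)"
    and dq: "\<And>x. (q has_real_derivative q1 x) (at x)" "\<And>x. (q1 has_real_derivative q2 x) (at x)"
    and df: "\<And>x. (f has_real_derivative f1 x) (at x)" "\<And>x. (f1 has_real_derivative f2 x) (at x)"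
    and bp: "\<And>x. \<bar>p1 x\<bar> \<le> S" "\<And>x. \<bar>p2 x\<bar> \<le> S"
    and bq: "\<And>x. \<bar>q x\<bar> \<le> S" "\<And>x. \<bar>q1 x\<bar> \<le> S" "\<And>x. \<bar>q2 x\<bar> \<le> S"
    and bf: "\<And>x. \<bar>f x\<bar> \<le> S" "\<And>x. \<bar>f1 x\<bar> \<le> S" "\<And>x. \<bar>f2 x\<bar> \<le> S"
    and p_nonneg: "\<And>x. p x \<ge> 0"
    and \<delta>: "\<delta> > 0"
      "\<And>x. p x \<ge> \<delta> \<or> \<bar>q x\<bar> \<ge> \<delta> \<and> \<bar>p1 x + q x\<bar> \<ge> \<delta> \<and> \<bar>2 * p1 x + q x\<bar> \<ge> \<delta>"
begin

lemma S_nonneg: "S \<ge> 0"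
  using bf(1)[of 0] by simp

text \<open>Differentiating once and twice gives linear equations for \<open>H\<close> and
  \<open>J\<close> with the same leading coefficient \<open>p + \<epsilon>\<close> and lower
  coefficients \<open>p1 + q\<close> and \<open>2 * p1 + q\<close>, and the maximum principle
  applies to each. Where \<open>p\<close> is at least \<open>\<delta>\<close>, the preceding
  equation is simply divided by \<open>p + \<epsilon>\<close>. The constants count terms:
  \<open>2 * S\<close> for \<open>f - c\<close>, \<open>S * m\<close> for the term in
  \<open>G\<close>, \<open>3 * (S * C)\<close> for the terms in \<open>H\<close>. None of them
  involves \<open>\<epsilon>\<close>.\<close>

lemma corrector_derivative_bounds:
  fixes G H :: "real \<Rightarrow> real"
  assumes \<epsilon>: "\<epsilon> > 0" and c: "\<bar>c\<bar> \<le> S" and Gper: "pi_periodic G"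
    and dG: "\<And>x. (G has_real_derivative H x) (at x)"
    and eq: "\<And>x. (p x + \<epsilon>) * H x + q x * G x = f x - c"
    and m: "\<And>x. \<bar>G x\<bar> \<le> m"
  defines "C \<equiv> (2 * S + S * m) / \<delta>"
  shows "\<bar>H x\<bar> \<le> C"
    and "\<exists>J. \<forall>x. (H has_real_derivative J x) (at x) \<and> \<bar>J x\<bar> \<le> (S + S * m + 3 * (S * C)) / \<delta>"
proof -
  have nz: "p x + \<epsilon> \<noteq> 0" for x using p_nonneg[of x] \<epsilon> by linarith
  have prod: "\<bar>a * b\<bar> \<le> S * B" if "\<bar>a\<bar> \<le> S" "\<bar>b\<bar> \<le> B" for a b B
    unfolding abs_mult using that S_nonneg by (intro mult_mono) auto
  have Heq: "H x = (f x - c - q x * G x) / (p x + \<epsilon>)" for x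
    using eq[of x] nz[of x] by (simp add: field_simps)
  \<comment> \<open>\<open>H\<close> is a quotient of differentiable functions, so it is
    differentiable for free, and \<open>J\<close> is read off the differentiated equation.\<close>
  define J where "J x = (f1 x - q1 x * G x - (p1 x + q x) * H x) / (p x + \<epsilon>)" for x
  have dH: "(H has_real_derivative J x) (at x)" for x
  proof -
    have "((\<lambda>x. (f x - c - q x * G x) / (p x + \<epsilon>)) has_real_derivative
       ((f1 x - (q1 x * G x + q x * H x)) * (p x + \<epsilon>) - (f x - c - q x * G x) * p1 x)
         / ((p x + \<epsilon>) * (p x + \<epsilon>))) (at x)"
      by (rule derivative_eq_intros dp dq df dG refl nz | simp)+
    also have "((f1 x - (q1 x * G x + q x * H x)) * (p x + \<epsilon>) - (f x - c - q x * G x) * p1 x)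
         / ((p x + \<epsilon>) * (p x + \<epsilon>)) = J x"
      unfolding J_def eq[of x, symmetric] using nz[of x] by (simp add: divide_simps) algebra
    finally show ?thesis unfolding Heq[abs_def] by simp
  qed
  have eqJ: "(p x + \<epsilon>) * J x + (p1 x + q x) * H x = f1 x - q1 x * G x" for x
    using nz[of x] by (simp add: J_def)
  have Jper: "pi_periodic H" using pi_periodic_deriv[OF Gper dG] .
  have Hbound: "\<bar>H x\<bar> \<le> C" for x
  proof -
    have "\<bar>H x\<bar> \<le> max C ((S + S * m) / \<delta>)"
    proof (rule periodic_max_principle[where p = p and H = H and y = x and r = "\<lambda>x. p1 x + q x" and P = "\<lambda>x. p x + \<epsilon>"])
      show "\<bar>f1 x - q1 x * G x\<bar> \<le> S + S * m" for x
        using bf(2)[of x] prod[OF bq(2)[of x] m[of x]] by linarith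
      show "\<bar>H x\<bar> \<le> C" if "\<delta> \<le> p x" for x
        unfolding C_def
      proof (rule abs_le_divide_of_mult)
        show "\<delta> \<le> p x + \<epsilon>" using that \<epsilon> by simp
        show "\<bar>(p x + \<epsilon>) * H x\<bar> \<le> 2 * S + S * m"
          using eq[of x] bf(1)[of x] c prod[OF bq(1)[of x] m[of x]] by linarith
      qed (rule \<delta>)
    qed (use \<delta> Jper dH eqJ in \<open>blast+\<close>)
    also have "(S + S * m) / \<delta> \<le> C"
      unfolding C_def using S_nonneg \<delta>(1) by (intro divide_right_mono) auto
    finally show ?thesis by simp
  qed
  thus "\<bar>H x\<bar> \<le> C" .
  \<comment> \<open>\<open>J1\<close> is introduced so that the maximum principle can be applied to
    \<open>J\<close>; no bound on \<open>J1\<close> is sought. Here the second derivatives of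
    \<open>f\<close>, \<open>p\<close> and \<open>q\<close> enter.\<close>
  define J1 where "J1 x = (f2 x - (q2 x * G x + q1 x * H x) - ((p2 x + q1 x) * H x + (p1 x + q x) * J x)
      - p1 x * J x) / (p x + \<epsilon>)" for x
  have dJ: "(J has_real_derivative J1 x) (at x)" for x
  proof -
    have "((\<lambda>x. (f1 x - q1 x * G x - (p1 x + q x) * H x) / (p x + \<epsilon>)) has_real_derivative
       ((f2 x - (q2 x * G x + q1 x * H x) - ((p2 x + q1 x) * H x + (p1 x + q x) * J x)) * (p x + \<epsilon>)
          - (f1 x - q1 x * G x - (p1 x + q x) * H x) * p1 x)
         / ((p x + \<epsilon>) * (p x + \<epsilon>))) (at x)"
      by (rule derivative_eq_intros dp dq df dG dH refl nz | simp)+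
    also have "((f2 x - (q2 x * G x + q1 x * H x) - ((p2 x + q1 x) * H x + (p1 x + q x) * J x)) * (p x + \<epsilon>)
          - (f1 x - q1 x * G x - (p1 x + q x) * H x) * p1 x)
         / ((p x + \<epsilon>) * (p x + \<epsilon>)) = J1 x"
    proof -
      have e: "f1 x - q1 x * G x - (p1 x + q x) * H x = (p x + \<epsilon>) * J x" using eqJ[of x] by simp
      show ?thesis unfolding e J1_def using nz[of x]
        by (simp add: divide_simps) (simp add: algebra_simps)
    qed
    finally show ?thesis unfolding J_def[abs_def] by simp
  qed
  have eqJ1: "(p x + \<epsilon>) * J1 x + (2 * p1 x + q x) * J x = f2 x - q2 x * G x - 2 * (q1 x * H x) - p2 x * H x" for x
  proof -
    have "(p x + \<epsilon>) * J1 x = f2 x - (q2 x * G x + q1 x * H x) - ((p2 x + q1 x) * H x + (p1 x + q x) * J x)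
      - p1 x * J x" using nz[of x] by (simp add: J1_def)
    thus ?thesis by (simp only:) (simp add: algebra_simps)
  qed
  have "\<bar>J x\<bar> \<le> max ((S + S * m + 3 * (S * C)) / \<delta>) ((S + S * m + 3 * (S * C)) / \<delta>)" for x
  proof (rule periodic_max_principle[where p = p and H = J and y = x and r = "\<lambda>x. 2 * p1 x + q x" and P = "\<lambda>x. p x + \<epsilon>"])
    show "pi_periodic J" using pi_periodic_deriv[OF Jper dH] .
    show "\<bar>f2 x - q2 x * G x - 2 * (q1 x * H x) - p2 x * H x\<bar> \<le> S + S * m + 3 * (S * C)" for x
      using bf(3)[of x] prod[OF bq(3)[of x] m[of x]] prod[OF bq(2)[of x] Hbound[of x]]
        prod[OF bp(2)[of x] Hbound[of x]] by linarith
    show "\<bar>J x\<bar> \<le> (S + S * m + 3 * (S * C)) / \<delta>" if "\<delta> \<le> p x" for x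
    proof (rule abs_le_divide_of_mult)
      show "\<delta> \<le> p x + \<epsilon>" using that \<epsilon> by simp
      have "(p x + \<epsilon>) * J x = f1 x - q1 x * G x - p1 x * H x - q x * H x"
        using eqJ[of x] by (simp add: algebra_simps)
      thus "\<bar>(p x + \<epsilon>) * J x\<bar> \<le> S + S * m + 3 * (S * C)"
        using bf(2)[of x] prod[OF bq(2)[of x] m[of x]] prod[OF bq(1)[of x] Hbound[of x]]
          prod[OF bp(1)[of x] Hbound[of x]] S_nonneg abs_ge_zero[of "H x"] Hbound[of x]
          mult_nonneg_nonneg[of S C] by linarith
    qed (rule \<delta>)
  qed (use \<delta> dJ eqJ1 in \<open>blast+\<close>)
  thus "\<exists>J. \<forall>x. (H has_real_derivative J x) (at x) \<and> \<bar>J x\<bar> \<le> (S + S * m + 3 * (S * C)) / \<delta>"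
    using dH by (intro exI[of _ J]) simp
qed


text \<open>Compactness takes the place of an explicit constant. After division by the supremum of
  \<open>|G|\<close>, both the source \<open>f - c\<close> and the regularising term disappear in
  the limit, while supremum 1 and mean zero survive. The point \<open>z2\<close> stands for a second
  zero of \<open>p\<close> or, if there is none, for an arbitrary dividing point, so both cases are
  treated at once.\<close>

lemma corrector_bounded:
  assumes z: "z1 < z2" "z2 < z1 + pi" "p z1 = 0" "q z1 \<noteq> 0"
    and arcs: "\<And>x. z1 < x \<Longrightarrow> x < z2 \<Longrightarrow> p x > 0" "\<And>x. z2 < x \<Longrightarrow> x < z1 + pi \<Longrightarrow> p x > 0"
  shows "\<exists>B \<epsilon>0. \<epsilon>0 > 0 \<and> (\<forall>\<epsilon> F G H c. 0 < \<epsilon> \<longrightarrow> \<epsilon> < \<epsilon>0 \<longrightarrow> \<bar>c\<bar> \<le> S \<longrightarrow> pi_periodic F \<longrightarrow>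
      (\<forall>x. (F has_real_derivative G x) (at x)) \<longrightarrow> (\<forall>x. (G has_real_derivative H x) (at x)) \<longrightarrow>
      (\<forall>x. (p x + \<epsilon>) * H x + q x * G x = f x - c) \<longrightarrow> (\<forall>x. \<bar>G x\<bar> \<le> B))"
proof (rule ccontr)
  assume contra: "\<not> ?thesis"
  \<comment> \<open>The maximum point \<open>y\<close> of \<open>|G|\<close> is recorded within one
    period starting at \<open>z1\<close>, the interval on which the limit is taken; otherwise the
    normalisation would be invisible in the limit.\<close>
  define R where "R n \<epsilon> F G H c y \<longleftrightarrow> 0 < \<epsilon> \<and> \<epsilon> < 1 / real (Suc n) \<and> \<bar>c\<bar> \<le> S \<and> pi_periodic F \<and>
      (\<forall>x. (F has_real_derivative G x) (at x)) \<and> (\<forall>x. (G has_real_derivative H x) (at x)) \<and>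
      (\<forall>x. (p x + \<epsilon>) * H x + q x * G x = f x - c) \<and> z1 \<le> y \<and> y < z1 + pi \<and>
      (\<forall>x. \<bar>G x\<bar> \<le> \<bar>G y\<bar>) \<and> \<bar>G y\<bar> > real (Suc n)" for n \<epsilon> F G H c y
  have "\<exists>\<epsilon> F G H c y. R n \<epsilon> F G H c y" for n
  proof -
    have "1 / real (Suc n) > 0" by simp
    then obtain \<epsilon> F G H c x where *: "0 < \<epsilon>" "\<epsilon> < 1 / real (Suc n)" "\<bar>c\<bar> \<le> S" "pi_periodic F"
      "\<forall>x. (F has_real_derivative G x) (at x)" "\<forall>x. (G has_real_derivative H x) (at x)"
      "\<forall>x. (p x + \<epsilon>) * H x + q x * G x = f x - c" "\<not> \<bar>G x\<bar> \<le> real (Suc n)"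
      using contra by blast
    have "pi_periodic G" using pi_periodic_deriv * by blast
    hence "pi_periodic (\<lambda>x. \<bar>G x\<bar>)" by (simp add: pi_periodic_def)
    moreover have "continuous_on UNIV (\<lambda>x. \<bar>G x\<bar>)"
      using * by (intro continuous_intros has_real_derivative_imp_continuous_on[of G H]) auto
    ultimately obtain y where "z1 \<le> y" "y < z1 + pi" "\<And>x. \<bar>G x\<bar> \<le> \<bar>G y\<bar>"
      using pi_periodic_attains_max[of "\<lambda>x. \<bar>G x\<bar>" z1] by blast
    moreover from this(3)[of x] *(8) have "\<bar>G y\<bar> > real (Suc n)" by linarith
    ultimately show ?thesis using * unfolding R_def by blast
  qed
  then obtain \<epsilon> F G H c y where R: "\<And>n. R n (\<epsilon> n) (F n) (G n) (H n) (c n) (y n)"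
    by metis
  have \<epsilon>: "0 < \<epsilon> n" "\<epsilon> n < 1 / real (Suc n)" and c: "\<bar>c n\<bar> \<le> S" and Fper: "pi_periodic (F n)"
    and dF: "(F n has_real_derivative G n x) (at x)" and dG: "(G n has_real_derivative H n x) (at x)"
    and eq: "(p x + \<epsilon> n) * H n x + q x * G n x = f x - c n" and y: "z1 \<le> y n" "y n < z1 + pi"
    and Gmax: "\<bar>G n x\<bar> \<le> \<bar>G n (y n)\<bar>" and Gbig: "\<bar>G n (y n)\<bar> > real (Suc n)" for n x
    using R[of n] unfolding R_def by blast+
  define m where "m n = \<bar>G n (y n)\<bar>" for n
  have m: "m n > real (Suc n)" for n using Gbig by (simp add: m_def)
  have m1: "m n > 1" for n using m[of n] by simp
  have mpos: "m n > 0" for n using m1[of n] by simp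
  define g h where "g n x = G n x / m n" and "h n x = H n x / m n" for n x
  \<comment> \<open>As \<open>m n > 1\<close>, the bound \<open>(2 * S + S * m) / \<delta>\<close>
    on \<open>H\<close> is at most \<open>3 * S * m / \<delta>\<close>; after division by
    \<open>m\<close> this is one Lipschitz constant for all \<open>g n\<close>.\<close>
  define C where "C = 3 * S / \<delta>"
  have C0: "C \<ge> 0" using S_nonneg \<delta> by (simp add: C_def)
  have Gper: "pi_periodic (G n)" for n using pi_periodic_deriv Fper dF by blast
  have gbound: "\<bar>g n x\<bar> \<le> 1" for n x
    using Gmax[of n x] mpos[of n] by (simp add: g_def m_def abs_divide)
  have gy: "\<bar>g n (y n)\<bar> = 1" for n
    using mpos[of n] by (simp add: g_def m_def)
  have dg: "(g n has_real_derivative h n x) (at x)" for n x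
    unfolding g_def h_def by (rule DERIV_cdivide) (rule dG)
  have hbound: "\<bar>h n x\<bar> \<le> C" for n x
  proof -
    have "\<bar>H n x\<bar> \<le> (2 * S + S * m n) / \<delta>"
      by (rule corrector_derivative_bounds(1)[of "\<epsilon> n" "c n" "G n" "H n" "m n"])
        (use \<epsilon> c Gper dG eq Gmax m_def in auto)
    also have "\<dots> \<le> C * m n"
    proof -
      have "2 * S * 1 \<le> 2 * S * m n" using S_nonneg m1[of n] by (intro mult_left_mono) auto
      hence "2 * S + S * m n \<le> 3 * S * m n" by simp
      hence "(2 * S + S * m n) / \<delta> \<le> 3 * S * m n / \<delta>" using \<delta> by (intro divide_right_mono) auto
      thus ?thesis by (simp add: C_def)
    qed
    finally show ?thesis using mpos[of n] by (simp add: h_def abs_divide field_simps)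
  qed
  \<comment> \<open>The defect of \<open>g n\<close> in the limit equation: the source is divided by
    a norm tending to infinity, and the regularising term carries the factor
    \<open>\<epsilon> n\<close>.\<close>
  define r where "r n x = (f x - c n) / m n - \<epsilon> n * h n x" for n x
  have geq: "p x * h n x + q x * g n x = r n x" for n x
  proof -
    have "p x * h n x + q x * g n x = ((p x + \<epsilon> n) * H n x + q x * G n x) / m n - \<epsilon> n * h n x"
      by (simp add: g_def h_def add_divide_distrib distrib_right)
    thus ?thesis by (simp add: eq r_def)
  qed
  have rbound: "\<bar>r n x\<bar> \<le> (2 * S + C) * inverse (real (Suc n))" for n x
  proof -
    have "\<bar>f x - c n\<bar> / m n \<le> (2 * S) / real (Suc n)"
      using bf(1)[of x] c[of n] m[of n] S_nonneg by (intro frac_le) auto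
    moreover have "\<epsilon> n * \<bar>h n x\<bar> \<le> 1 / real (Suc n) * C"
      using \<epsilon>[of n] hbound[of n x] by (intro mult_mono) auto
    moreover have "\<bar>r n x\<bar> \<le> \<bar>f x - c n\<bar> / m n + \<epsilon> n * \<bar>h n x\<bar>"
      unfolding r_def using mpos[of n] \<epsilon>(1)[of n] abs_triangle_ineq4[of "(f x - c n) / m n" "\<epsilon> n * h n x"]
      by (simp add: abs_divide abs_mult)
    moreover have "(2 * S + C) * inverse (real (Suc n)) = (2 * S) / real (Suc n) + 1 / real (Suc n) * C"
      by (simp add: divide_inverse algebra_simps del: of_nat_Suc)
    ultimately show ?thesis by linarith
  qed
  have r0: "(\<lambda>n. (2 * S + C) * inverse (real (Suc n))) \<longlonglongrightarrow> 0"
    using tendsto_mult[OF tendsto_const[of "2 * S + C"] LIMSEQ_inverse_real_of_nat] by simp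
  have lip: "\<bar>g n x - g n x'\<bar> \<le> C * \<bar>x - x'\<bar>" for n x x'
    using derivative_bound_imp_lipschitz dg hbound by blast
  define K where "K = {z1..z1+pi}"
  have "compact K" by (simp add: K_def)
  obtain \<gamma> k where \<gamma>: "continuous_on K \<gamma>" "strict_mono (k :: nat \<Rightarrow> nat)"
    "\<And>e. 0 < e \<Longrightarrow> \<exists>N. \<forall>n x. n \<ge> N \<and> x \<in> K \<longrightarrow> norm (g (k n) x - \<gamma> x) < e"
  proof (rule Arzela_Ascoli[OF \<open>compact K\<close>, of g 1])
    show "norm (g n x) \<le> 1" for n x using gbound by simp
    show "\<exists>d>0. \<forall>n x'. x' \<in> K \<and> norm (x - x') < d \<longrightarrow> norm (g n x - g n x') < e"
      if "0 < e" for x e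
    proof (intro exI conjI allI impI)
      show "0 < e / (C + 1)" using that C0 by simp
      fix n x' assume "x' \<in> K \<and> norm (x - x') < e / (C + 1)"
      hence "(C + 1) * \<bar>x - x'\<bar> < e" using C0 by (simp add: field_simps)
      thus "norm (g n x - g n x') < e"
        using lip[of n x x'] C0 by (simp add: algebra_simps)
    qed
  qed blast
  have unif: "uniform_limit K (\<lambda>n. g (k n)) \<gamma> sequentially"
    unfolding uniform_limit_sequentially_iff dist_norm using \<gamma>(3) by blast
  have ptw: "(\<lambda>n. g (k n) x) \<longlonglongrightarrow> \<gamma> x" if "x \<in> K" for x
    using tendsto_uniform_limitI[OF unif that] .
  have rk: "(\<lambda>n. r (k n) x) \<longlonglongrightarrow> 0" for x
  proof (rule Lim_null_comparison)
    show "(\<lambda>n. (2 * S + C) * inverse (real (Suc (k n)))) \<longlonglongrightarrow> 0"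
      using LIMSEQ_subseq_LIMSEQ[OF r0 \<gamma>(2)] by (simp add: o_def)
    show "\<forall>\<^sub>F n in sequentially. norm (r (k n) x) \<le> (2 * S + C) * inverse (real (Suc (k n)))"
      using rbound by (simp del: of_nat_Suc)
  qed
  have z1K: "z1 \<in> K" "z1 + pi \<in> K" by (simp_all add: K_def)
  \<comment> \<open>At \<open>z1\<close> the leading coefficient vanishes and the equation becomes
    algebraic: \<open>g = r / q\<close>, with \<open>r\<close> tending to 0.\<close>
  have \<gamma>z1: "\<gamma> z1 = 0"
  proof -
    have "(\<lambda>n. r (k n) z1 / q z1) \<longlonglongrightarrow> 0"
      using tendsto_divide[OF rk tendsto_const[of "q z1"]] z by simp
    moreover have "r (k n) z1 / q z1 = g (k n) z1" for n
      using geq[of z1 "k n"] z by (simp add: field_simps)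
    ultimately show ?thesis using ptw[OF z1K(1)] LIMSEQ_unique by simp
  qed
  have \<gamma>z1': "\<gamma> (z1 + pi) = 0"
  proof -
    have "g (k n) (z1 + pi) = g (k n) z1" for n
      using Gper by (simp add: g_def pi_periodic_def)
    thus ?thesis using ptw[OF z1K(1)] ptw[OF z1K(2)] \<gamma>z1 LIMSEQ_unique by simp
  qed
  have int\<gamma>: "integral K \<gamma> = 0"
  proof -
    obtain I J where IJ: "\<And>n. (g (k n) has_integral I n) {z1..z1+pi}"
      "(\<gamma> has_integral J) {z1..z1+pi}" "I \<longlonglongrightarrow> J"
      by (rule uniform_limit_integral[OF unif[unfolded K_def]])
        (auto intro!: has_real_derivative_imp_continuous_on[OF dg])
    have "(\<lambda>n. integral K (g (k n))) \<longlonglongrightarrow> integral K \<gamma>"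
      unfolding K_def integral_unique[OF IJ(1)] integral_unique[OF IJ(2)] by (rule IJ(3))
    moreover have "integral K (g n) = 0" for n
    proof -
      have "(G n has_integral F n (z1 + pi) - F n z1) K"
        unfolding K_def
        by (rule fundamental_theorem_of_calculus)
          (auto intro: has_field_derivative_at_within dF
            simp flip: has_real_derivative_iff_has_vector_derivative)
      hence "((\<lambda>x. G n x / m n) has_integral (F n (z1 + pi) - F n z1) / m n) K"
        by (rule has_integral_divide)
      from integral_unique[OF this] Fper[of n] show ?thesis
        by (auto simp: g_def[abs_def] pi_periodic_def)
    qed
    ultimately show ?thesis using LIMSEQ_unique by (simp add: LIMSEQ_const_iff)
  qed
  \<comment> \<open>The limit \<open>\<gamma>\<close> is known only to be continuous, so its
    equation is obtained in integrated form: \<open>g n * exp Q\<close> has derivative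
    \<open>exp Q / p * r n\<close>, which tends to 0 uniformly on a segment where \<open>p\<close>
    is positive, so \<open>\<gamma> * exp Q\<close> has equal values at both ends.\<close>
  have arc: "\<gamma> b = \<gamma> a * exp (- integral {a..b} (\<lambda>x. q x / p x))"
    if ab: "a < b" "z1 \<le> a" "b \<le> z1 + pi" and ppos: "\<And>x. a \<le> x \<Longrightarrow> x \<le> b \<Longrightarrow> p x > 0" for a b
  proof -
    have pc: "continuous_on {a..b} p" "continuous_on {a..b} q"
      by (rule has_real_derivative_imp_continuous_on, rule dp(1) dq(1))+
    have nz: "x \<in> {a..b} \<Longrightarrow> p x \<noteq> 0" for x using ppos[of x] by auto
    define Q where "Q x = integral {a..x} (\<lambda>x. q x / p x)" for x
    have dQ: "(Q has_real_derivative q x / p x) (at x within {a..b})" if "x \<in> {a..b}" for x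
      unfolding Q_def using pc nz that
      by (intro integral_has_real_derivative continuous_intros) auto
    have Qc: "continuous_on {a..b} Q" by (rule DERIV_continuous_on) (rule dQ)
    have "continuous_on {a..b} (\<lambda>x. exp (Q x) / p x)"
      using pc nz Qc by (intro continuous_intros) auto
    hence "bounded ((\<lambda>x. exp (Q x) / p x) ` {a..b})"
      by (intro compact_imp_bounded compact_continuous_image) auto
    then obtain D where D: "\<And>x. x \<in> {a..b} \<Longrightarrow> \<bar>exp (Q x) / p x\<bar> \<le> D"
      unfolding bounded_iff by (metis imageI real_norm_def)
    have D0: "D \<ge> 0" using order_trans[OF abs_ge_zero D[of a]] ab by simp
    have dW: "((\<lambda>x. g n x * exp (Q x)) has_real_derivative exp (Q x) / p x * r n x) (at x within {a..b})"
      if "x \<in> {a..b}" for n x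
    proof -
      have "((\<lambda>x. g n x * exp (Q x)) has_real_derivative h n x * exp (Q x) + g n x * (exp (Q x) * (q x / p x)))
         (at x within {a..b})"
        by (rule derivative_eq_intros has_field_derivative_at_within[OF dg] dQ[OF that] refl | simp)+
      moreover have "h n x * exp (Q x) + g n x * (exp (Q x) * (q x / p x)) = exp (Q x) / p x * r n x"
        unfolding geq[symmetric] using nz[OF that] by (simp add: field_simps)
      ultimately show ?thesis by simp
    qed
    have diff: "\<bar>g n b * exp (Q b) - g n a * exp (Q a)\<bar> \<le> D * ((2 * S + C) * inverse (real (Suc n))) * \<bar>b - a\<bar>" for n
    proof -
      have "norm (exp (Q x) / p x * r n x) \<le> D * ((2 * S + C) * inverse (real (Suc n)))" if "x \<in> {a..b}" for x
        unfolding real_norm_def abs_mult using D[OF that] rbound[of n x] D0 by (intro mult_mono) auto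
      from field_differentiable_bound[OF _ dW this, of b a] ab show ?thesis by simp
    qed
    have aK: "a \<in> K" "b \<in> K" using ab by (auto simp: K_def)
    have "(\<lambda>n. g (k n) b * exp (Q b) - g (k n) a * exp (Q a)) \<longlonglongrightarrow> 0"
    proof (rule Lim_null_comparison)
      show "(\<lambda>n. D * ((2 * S + C) * inverse (real (Suc (k n)))) * \<bar>b - a\<bar>) \<longlonglongrightarrow> 0"
        using LIMSEQ_subseq_LIMSEQ[OF tendsto_mult[OF tendsto_mult[OF tendsto_const[of D] r0]
          tendsto_const[of "\<bar>b - a\<bar>"]] \<gamma>(2)] by (simp add: o_def)
    qed (use diff in \<open>simp del: of_nat_Suc\<close>)
    moreover have "(\<lambda>n. g (k n) b * exp (Q b) - g (k n) a * exp (Q a)) \<longlonglongrightarrow> \<gamma> b * exp (Q b) - \<gamma> a * exp (Q a)"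
      by (intro tendsto_intros ptw aK)
    ultimately have "\<gamma> b * exp (Q b) - \<gamma> a * exp (Q a) = 0" using LIMSEQ_unique by blast
    hence "\<gamma> b * exp (Q b) = \<gamma> a" by (simp add: Q_def)
    thus ?thesis by (simp add: Q_def exp_minus field_simps)
  qed
  have sgn_arc: "sgn (\<gamma> x) = sgn (\<gamma> x')"
    if "(z1 < x \<and> x < z2 \<and> z1 < x' \<and> x' < z2) \<or> (z2 < x \<and> x < z1 + pi \<and> z2 < x' \<and> x' < z1 + pi)" for x x'
  proof -
    have *: "sgn (\<gamma> b) = sgn (\<gamma> a)"
      if "a < b" "(z1 < a \<and> b < z2) \<or> (z2 < a \<and> b < z1 + pi)" for a b
    proof -
      have "\<gamma> b = \<gamma> a * exp (- integral {a..b} (\<lambda>x. q x / p x))"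
        by (rule arc) (use that z arcs in auto)
      thus ?thesis by (simp add: sgn_mult)
    qed
    show ?thesis using *[of x x'] *[of x' x] that by (cases x x' rule: linorder_cases) auto
  qed
  \<comment> \<open>The sign of \<open>q z1\<close> selects the side. If it is positive,
    \<open>arc\<close> makes \<open>|\<gamma>|\<close> nonincreasing to the right of
    \<open>z1\<close>, so a nearby value is at most the limit \<open>|\<gamma> z1| = 0\<close>. If
    it is negative, the same happens to the left of \<open>z1 + pi\<close>. Constancy of the sign
    carries one zero value to the whole arc.\<close>
  have vanish: "(\<forall>x. z1 < x \<and> x < z2 \<longrightarrow> \<gamma> x = 0) \<or> (\<forall>x. z2 < x \<and> x < z1 + pi \<longrightarrow> \<gamma> x = 0)"
  proof (cases "q z1 > 0")
    case True
    have "isCont q z1" by (rule DERIV_isCont[OF dq(1)])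
    then obtain d where d: "d > 0" "\<And>x. dist x z1 < d \<Longrightarrow> dist (q x) (q z1) < q z1"
      using True unfolding continuous_at_eps_delta by blast
    have qpos: "q x > 0" if "z1 \<le> x" "x < z1 + d" for x
      using d(2)[of x] that by (auto simp: dist_real_def)
    define b where "b = min (z1 + d / 2) ((z1 + z2) / 2)"
    have b: "z1 < b" "b < z1 + d" "b < z2" using d(1) z by (auto simp: b_def min_def field_simps)
    have le: "\<bar>\<gamma> b\<bar> \<le> \<bar>\<gamma> a\<bar>" if a: "z1 < a" "a < b" for a
    proof -
      have "\<gamma> b = \<gamma> a * exp (- integral {a..b} (\<lambda>x. q x / p x))"
        by (rule arc) (use a b z arcs in auto)
      moreover have "integral {a..b} (\<lambda>x. q x / p x) \<ge> 0"
      proof (rule integral_nonneg_real)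
        show "0 \<le> q x / p x" if "x \<in> {a..b}" for x
          using qpos[of x] p_nonneg[of x] a b that by (simp add: zero_le_divide_iff)
      qed
      ultimately show ?thesis by (simp add: abs_mult mult_left_le)
    qed
    have "((\<lambda>x. \<bar>\<gamma> x\<bar>) \<longlongrightarrow> \<bar>\<gamma> z1\<bar>) (at z1 within K)"
      using \<gamma>(1) z1K by (intro tendsto_intros) (simp add: continuous_on_def)
    hence "((\<lambda>x. \<bar>\<gamma> x\<bar>) \<longlongrightarrow> \<bar>\<gamma> z1\<bar>) (at z1 within {z1<..<b})"
      by (rule tendsto_within_subset) (use b z in \<open>auto simp: K_def\<close>)
    hence "\<bar>\<gamma> b\<bar> \<le> \<bar>\<gamma> z1\<bar>"
      by (rule tendsto_lowerbound)
        (use b le in \<open>auto simp: eventually_at_filter trivial_limit_within islimpt_greaterThanLessThan1\<close>)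
    hence "\<gamma> b = 0" using \<gamma>z1 by simp
    thus ?thesis using sgn_arc[of b] b by (metis sgn_0_0)
  next
    case False
    hence neg: "q (z1 + pi) < 0" using z per(2) by (simp add: pi_periodic_def)
    have "isCont q (z1 + pi)" by (rule DERIV_isCont[OF dq(1)])
    then obtain d where d: "d > 0" "\<And>x. dist x (z1 + pi) < d \<Longrightarrow> dist (q x) (q (z1 + pi)) < - q (z1 + pi)"
      using neg unfolding continuous_at_eps_delta by (metis neg_0_less_iff_less)
    have qneg: "q x < 0" if "z1 + pi - d < x" "x \<le> z1 + pi" for x
      using d(2)[of x] that by (auto simp: dist_real_def)
    define a where "a = max (z1 + pi - d / 2) ((z1 + pi + z2) / 2)"
    have a: "z2 < a" "z1 + pi - d < a" "a < z1 + pi" using d(1) z by (auto simp: a_def max_def field_simps)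
    have le: "\<bar>\<gamma> a\<bar> \<le> \<bar>\<gamma> b\<bar>" if b: "a < b" "b < z1 + pi" for b
    proof -
      have "\<gamma> b = \<gamma> a * exp (- integral {a..b} (\<lambda>x. q x / p x))"
        by (rule arc) (use a b z arcs in auto)
      moreover have "integral {a..b} (\<lambda>x. - (q x / p x)) \<ge> 0"
      proof (rule integral_nonneg_real)
        show "0 \<le> - (q x / p x)" if "x \<in> {a..b}" for x
          using qneg[of x] p_nonneg[of x] a b that by (simp add: divide_le_0_iff)
      qed
      hence "- integral {a..b} (\<lambda>x. q x / p x) \<ge> 0" by simp
      hence "exp (- integral {a..b} (\<lambda>x. q x / p x)) \<ge> 1" by (simp only: one_le_exp_iff)
      ultimately show ?thesis by (simp add: abs_mult mult_left_le mult_le_cancel_left1)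
    qed
    have "((\<lambda>x. \<bar>\<gamma> x\<bar>) \<longlongrightarrow> \<bar>\<gamma> (z1 + pi)\<bar>) (at (z1 + pi) within K)"
      using \<gamma>(1) z1K by (intro tendsto_intros) (simp add: continuous_on_def)
    hence "((\<lambda>x. \<bar>\<gamma> x\<bar>) \<longlongrightarrow> \<bar>\<gamma> (z1 + pi)\<bar>) (at (z1 + pi) within {a<..<z1+pi})"
      by (rule tendsto_within_subset) (use a z in \<open>auto simp: K_def\<close>)
    hence "\<bar>\<gamma> a\<bar> \<le> \<bar>\<gamma> (z1 + pi)\<bar>"
      by (rule tendsto_lowerbound)
        (use a le in \<open>auto simp: eventually_at_filter trivial_limit_within islimpt_greaterThanLessThan2\<close>)
    hence "\<gamma> a = 0" using \<gamma>z1' by simp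
    thus ?thesis using sgn_arc[of a] a by (metis sgn_0_0)
  qed
  \<comment> \<open>One arc carries \<open>\<gamma> = 0\<close>, so the sign on the other arc,
    sampled at its midpoint \<open>w\<close>, is valid on all of \<open>K\<close> except perhaps at
    \<open>z2\<close>, which is added afterwards by continuity.\<close>
  obtain s where s: "s = 1 \<or> s = (-1::real)" and spos: "\<And>x. x \<in> K - {z2} \<Longrightarrow> s * \<gamma> x \<ge> 0"
  proof -
    define w where "w = (if \<forall>x. z1 < x \<and> x < z2 \<longrightarrow> \<gamma> x = 0 then (z2 + z1 + pi) / 2 else (z1 + z2) / 2)"
    define s :: real where "s = (if \<gamma> w \<ge> 0 then 1 else -1)"
    have sw: "s * \<gamma> w \<ge> 0" by (simp add: s_def)
    have "s * \<gamma> x \<ge> 0" if x: "x \<in> K - {z2}" for x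
    proof -
      consider "x = z1 \<or> x = z1 + pi" | "z1 < x" "x < z2" | "z2 < x" "x < z1 + pi"
        using x by (force simp: K_def)
      hence "\<gamma> x = 0 \<or> sgn (\<gamma> x) = sgn (\<gamma> w)"
      proof cases
        case 1 thus ?thesis using \<gamma>z1 \<gamma>z1' by auto
      next
        case 2
        show ?thesis
        proof (cases "\<forall>x. z1 < x \<and> x < z2 \<longrightarrow> \<gamma> x = 0")
          case False
          hence "w = (z1 + z2) / 2" by (simp add: w_def)
          thus ?thesis using 2 z by (intro disjI2, intro sgn_arc, intro disjI1) auto
        qed (use 2 in auto)
      next
        case 3
        show ?thesis
        proof (cases "\<forall>x. z1 < x \<and> x < z2 \<longrightarrow> \<gamma> x = 0")
          case True
          hence "w = (z2 + z1 + pi) / 2" by (simp add: w_def)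
          thus ?thesis using 3 z by (intro disjI2, intro sgn_arc, intro disjI2) auto
        qed (use 3 vanish in auto)
      qed
      thus ?thesis using sw by (auto simp: s_def sgn_if split: if_splits)
    qed
    thus ?thesis using that[of s] by (auto simp: s_def)
  qed
  have sposK: "s * \<gamma> x \<ge> 0" if "x \<in> K" for x
  proof (cases "x = z2")
    case True
    have "continuous_on (closure {z2<..<z1+pi}) (\<lambda>x. s * \<gamma> x)"
      using z by (intro continuous_intros continuous_on_subset[OF \<gamma>(1)]) (auto simp: K_def)
    moreover have "z2 \<in> closure {z2<..<z1+pi}" using z by simp
    ultimately show ?thesis unfolding True
      by (rule continuous_ge_on_closure) (use z spos in \<open>auto simp: K_def\<close>)
  qed (use spos that in auto)
  \<comment> \<open>A continuous function of one sign with zero integral vanishes. Uniform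
    convergence then contradicts \<open>|g n (y n)| = 1\<close>.\<close>
  have "\<forall>x\<in>{z1..z1+pi}. s * \<gamma> x = 0"
  proof (subst integral_eq_0_iff[symmetric])
    show "continuous_on {z1..z1+pi} (\<lambda>x. s * \<gamma> x)"
      using \<gamma>(1) by (auto intro!: continuous_intros simp: K_def)
    show "integral {z1..z1+pi} (\<lambda>x. s * \<gamma> x) = 0" using int\<gamma> by (simp add: K_def)
  qed (use sposK in \<open>auto simp: K_def\<close>)
  hence \<gamma>0: "\<gamma> x = 0" if "x \<in> K" for x using s that by (auto simp: K_def)
  obtain N where "\<forall>n x. n \<ge> N \<and> x \<in> K \<longrightarrow> norm (g (k n) x - \<gamma> x) < 1" using \<gamma>(3)[of 1] by auto
  moreover have "y (k N) \<in> K" using y[of "k N"] by (auto simp: K_def)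
  ultimately have "\<bar>g (k N) (y (k N))\<bar> < 1" using \<gamma>0 by force
  thus False using gy by simp
qed

end

subsection \<open>The projective flow of a matrix exponential\<close>

definition dpk :: "mat2 \<Rightarrow> real \<Rightarrow> real" where
  "dpk P \<theta> = - (P $ 1 $ 2 + P $ 2 $ 1) * sin (2 * \<theta>) - 2 * P $ 1 $ 1 * cos (2 * \<theta>)"

definition ddpk :: "mat2 \<Rightarrow> real \<Rightarrow> real" where
  "ddpk P \<theta> = - 2 * (P $ 1 $ 2 + P $ 2 $ 1) * cos (2 * \<theta>) + 4 * P $ 1 $ 1 * sin (2 * \<theta>)"

lemma DERIV_pk: "(pk P has_real_derivative dpk P \<theta>) (at \<theta>)"
  unfolding pk_def[abs_def] dpk_def
  using sin_double[of \<theta>] by (auto intro!: derivative_eq_intros simp: algebra_simps)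

lemma DERIV_dpk: "(dpk P has_real_derivative ddpk P \<theta>) (at \<theta>)"
  unfolding dpk_def[abs_def] ddpk_def
  by (auto intro!: derivative_eq_intros simp: algebra_simps)

lemma deriv_pk: "deriv (pk P) = dpk P"
  by (rule ext) (rule DERIV_imp_deriv[OF DERIV_pk])

lemma abs_mat2_entry_le: "\<bar>(P::mat2) $ i $ j\<bar> \<le> norm P"
  by (rule order_trans[OF component_le_norm_cart Finite_Cartesian_Product.norm_nth_le])

lemma abs_mult_le_right:
  fixes a b :: real
  assumes "\<bar>b\<bar> \<le> 1"
  shows "\<bar>a * b\<bar> \<le> \<bar>a\<bar>"
  using assms by (simp add: abs_mult mult_left_le)

lemma abs_pk_le: "\<bar>pk P \<theta>\<bar> \<le> 3 * norm P"
proof -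
  have "\<bar>P $ 2 $ 1 * (cos \<theta>)\<^sup>2\<bar> \<le> norm P" "\<bar>P $ 1 $ 2 * (sin \<theta>)\<^sup>2\<bar> \<le> norm P"
     "\<bar>P $ 1 $ 1 * sin (2 * \<theta>)\<bar> \<le> norm P"
    by (rule order_trans[OF abs_mult_le_right abs_mat2_entry_le];
      simp add: abs_square_le_1 power_le_one_iff)+
  thus ?thesis unfolding pk_def by linarith
qed

lemma abs_dpk_le: "\<bar>dpk P \<theta>\<bar> \<le> 4 * norm P"
proof -
  have "\<bar>P $ 1 $ 2 * sin (2 * \<theta>)\<bar> \<le> norm P" "\<bar>P $ 2 $ 1 * sin (2 * \<theta>)\<bar> \<le> norm P"
     "\<bar>P $ 1 $ 1 * cos (2 * \<theta>)\<bar> \<le> norm P"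
    by (rule order_trans[OF abs_mult_le_right abs_mat2_entry_le]; simp)+
  thus ?thesis unfolding dpk_def by (simp add: algebra_simps)
qed

lemma abs_ddpk_le: "\<bar>ddpk P \<theta>\<bar> \<le> 8 * norm P"
proof -
  have "\<bar>P $ 1 $ 2 * cos (2 * \<theta>)\<bar> \<le> norm P" "\<bar>P $ 2 $ 1 * cos (2 * \<theta>)\<bar> \<le> norm P"
     "\<bar>P $ 1 $ 1 * sin (2 * \<theta>)\<bar> \<le> norm P"
    by (rule order_trans[OF abs_mult_le_right abs_mat2_entry_le]; simp)+
  thus ?thesis unfolding ddpk_def by (simp add: algebra_simps)
qed

section \<open>The matrix exponential as an entrywise power series\<close>

lemma abs_matpow_entry_le:
  assumes "\<And>i j. \<bar>X $ i $ j\<bar> \<le> m"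
  shows "\<bar>matpow X n $ i $ j\<bar> \<le> (2 * m) ^ n"
proof (induction n arbitrary: i j)
  case 0
  thus ?case by (simp add: mat_def)
next
  case (Suc n)
  have "\<bar>matpow X (Suc n) $ i $ j\<bar> \<le> (\<Sum>k\<in>UNIV. \<bar>X $ i $ k * matpow X n $ k $ j\<bar>)"
    by (simp add: matrix_matrix_mult_def sum_abs)
  also have "\<dots> \<le> (\<Sum>k\<in>(UNIV::2 set). m * (2 * m) ^ n)"
    unfolding abs_mult using assms Suc
    by (intro sum_mono mult_mono) (auto intro: order_trans[OF abs_ge_zero])
  finally show ?case by simp
qed

lemma matpow_scaleR: "matpow (t *\<^sub>R X) n = t ^ n *\<^sub>R matpow X n"
proof (induction n)
  case (Suc n)
  have "(s *\<^sub>R A) ** (u *\<^sub>R B) = (s * u) *\<^sub>R (A ** B)" for s u and A B :: mat2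
    by (simp add: vec_eq_iff matrix_matrix_mult_def sum_distrib_left mult_ac)
  with Suc show ?case by simp
qed simp

lemma summable_matpow_entry: "summable (\<lambda>n. matpow X n $ i $ j / fact n * t ^ n)"
proof (rule summable_comparison_test')
  show "summable (\<lambda>n. inverse (fact n) * (2 * norm X * \<bar>t\<bar>) ^ n)" by (rule summable_exp)
  show "norm (matpow X n $ i $ j / fact n * t ^ n) \<le> inverse (fact n) * (2 * norm X * \<bar>t\<bar>) ^ n"
    if "n \<ge> 0" for n
  proof -
    have "\<bar>matpow X n $ i $ j\<bar> * \<bar>t\<bar> ^ n \<le> (2 * norm X) ^ n * \<bar>t\<bar> ^ n"
      by (intro mult_right_mono abs_matpow_entry_le abs_mat2_entry_le) auto
    thus ?thesis by (simp add: abs_mult power_abs power_mult_distrib field_simps)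
  qed
qed

text \<open>In entries, the exponential of \<open>t *\<^sub>R X\<close> becomes a real power series
  in \<open>t\<close> that converges everywhere, so termwise differentiation of real series
  applies.\<close>

lemma mexp_entry: "mexp (t *\<^sub>R X) $ i $ j = (\<Sum>n. matpow X n $ i $ j / fact n * t ^ n)"
proof -
  define E :: mat2 where "E = (\<chi> i j. \<Sum>n. matpow X n $ i $ j / fact n * t ^ n)"
  have "(\<lambda>n. (1 / fact n) *\<^sub>R matpow (t *\<^sub>R X) n) sums E"
    unfolding sums_def
  proof (intro vec_tendstoI)
    fix i j
    have "(\<lambda>n. matpow X n $ i $ j / fact n * t ^ n) sums E $ i $ j"
      using summable_matpow_entry by (simp add: E_def summable_sums)
    thus "(\<lambda>n. (\<Sum>n<n. (1 / fact n) *\<^sub>R matpow (t *\<^sub>R X) n) $ i $ j) \<longlonglongrightarrow> E $ i $ j"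
      by (simp add: sums_def matpow_scaleR mult.commute)
  qed
  hence "mexp (t *\<^sub>R X) = E" unfolding mexp_def by (simp add: sums_iff)
  thus ?thesis by (simp add: E_def)
qed

lemma mexp_0: "mexp (0 *\<^sub>R X) = mat 1"
  by (simp only: vec_eq_iff mexp_entry powser_zero) simp

text \<open>Shifting the coefficients by one cancels a factor of the factorial and leaves the power
  of order \<open>n + 1\<close>, whose outermost factor \<open>X\<close> can be pulled out of the
  series.\<close>

lemma DERIV_mexp:
  "((\<lambda>t. mexp (t *\<^sub>R X) $ i $ j) has_real_derivative (X ** mexp (t *\<^sub>R X)) $ i $ j) (at t)"
proof -
  define c where "c n = matpow X n $ i $ j / fact n" for n
  have "((\<lambda>t. \<Sum>n. c n * t ^ n) has_real_derivative (\<Sum>n. diffs c n * t ^ n)) (at t)"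
    by (rule termdiffs_strong_converges_everywhere) (unfold c_def, rule summable_matpow_entry)
  moreover have "diffs c n * t ^ n = (\<Sum>k\<in>UNIV. X $ i $ k * (matpow X n $ k $ j / fact n * t ^ n))" for n
    by (simp add: diffs_def c_def matrix_matrix_mult_def sum_distrib_left sum_distrib_right
        sum_divide_distrib field_simps del: of_nat_Suc)
  moreover have "(\<Sum>n. \<Sum>k\<in>UNIV. X $ i $ k * (matpow X n $ k $ j / fact n * t ^ n))
      = (X ** mexp (t *\<^sub>R X)) $ i $ j"
  proof -
    have "(\<Sum>n. \<Sum>k\<in>UNIV. X $ i $ k * (matpow X n $ k $ j / fact n * t ^ n))
      = (\<Sum>k\<in>UNIV. \<Sum>n. X $ i $ k * (matpow X n $ k $ j / fact n * t ^ n))"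
      by (intro suminf_sum summable_mult summable_matpow_entry)
    also have "\<dots> = (\<Sum>k\<in>UNIV. X $ i $ k * (\<Sum>n. matpow X n $ k $ j / fact n * t ^ n))"
      by (intro sum.cong refl suminf_mult summable_matpow_entry)
    finally show ?thesis by (simp add: matrix_matrix_mult_def mexp_entry)
  qed
  ultimately show ?thesis by (simp add: mexp_entry c_def)
qed

text \<open>Gronwall in both time directions: \<open>N t * exp (K * t)\<close> is nondecreasing and
  \<open>N t * exp (- K * t)\<close> is nonincreasing, so positivity at 0 persists.\<close>

lemma nonzero_of_derivative_bound:
  fixes N :: "real \<Rightarrow> real"
  assumes d: "\<And>t. (N has_real_derivative N' t) (at t)" and b: "\<And>t. \<bar>N' t\<bar> \<le> K * N t" and "N 0 > 0"
  shows "N t > 0"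
proof (cases "t \<ge> 0")
  case True
  have "N 0 * exp (K * 0) \<le> N t * exp (K * t)"
  proof (rule DERIV_nonneg_imp_nondecreasing[OF True])
    fix x
    have "((\<lambda>x. N x * exp (K * x)) has_real_derivative (N' x + K * N x) * exp (K * x)) (at x)"
      by (rule derivative_eq_intros d refl | simp add: algebra_simps)+
    moreover have "N' x + K * N x \<ge> 0" using b[of x] by linarith
    ultimately show "\<exists>y. ((\<lambda>x. N x * exp (K * x)) has_real_derivative y) (at x) \<and> 0 \<le> y" by force
  qed
  hence "0 < N t * exp (K * t)" using assms(3) by simp
  thus ?thesis by (simp add: zero_less_mult_iff)
next
  case False
  hence t: "t \<le> 0" by simp
  have "N 0 * exp (- K * 0) \<le> N t * exp (- K * t)"
  proof (rule DERIV_nonpos_imp_nonincreasing[OF t])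
    fix x
    have "((\<lambda>x. N x * exp (- K * x)) has_real_derivative (N' x - K * N x) * exp (- K * x)) (at x)"
      by (rule derivative_eq_intros d refl | simp add: algebra_simps)+
    moreover have "N' x - K * N x \<le> 0" using b[of x] by linarith
    ultimately show "\<exists>y. ((\<lambda>x. N x * exp (- K * x)) has_real_derivative y) (at x) \<and> y \<le> 0"
      by (force simp: mult_nonpos_nonneg)
  qed
  hence "0 < N t * exp (- K * t)" using assms(3) by simp
  thus ?thesis by (simp add: zero_less_mult_iff)
qed

lemma evec_component [simp]: "evec \<theta> $ 1 = cos \<theta>" "evec \<theta> $ 2 = sin \<theta>"
  by (simp_all add: evec_def vector_2)

text \<open>Polar coordinates along the orbit of \<open>evec \<theta>\<close>. The angle is not
  extracted from the orbit but defined by integrating the angular speed, which avoids any choice of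
  branch; that it is the right angle is verified by rotating the orbit back and rescaling it, after
  which it stands still. The angular speed turns out to be \<open>pk X\<close> at the angle:
  \<open>pk X\<close> is the vector field of the projective flow.\<close>

lemma mexp_angle_lift:
  assumes "X \<in> sl2"
  obtains \<phi> r where "\<phi> 0 = \<theta>" "\<And>t. (\<phi> has_real_derivative pk X (\<phi> t)) (at t)"
    "r > 0" "mexp X *v evec \<theta> = r *\<^sub>R evec (\<phi> 1)"
proof -
  define a b c where "a = X $ 1 $ 1" and "b = X $ 1 $ 2" and "c = X $ 2 $ 1"
  have X22: "X $ 2 $ 2 = - a" using assms by (simp add: sl2_def a_def)
  define w where "w t = mexp (t *\<^sub>R X) *v evec \<theta>" for t
  define w1 w2 where "w1 t = w t $ 1" and "w2 t = w t $ 2" for t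
  have w0: "w1 0 = cos \<theta>" "w2 0 = sin \<theta>"
    using mexp_0[of X] by (simp_all add: w1_def w2_def w_def)
  have dw1: "(w1 has_real_derivative a * w1 t + b * w2 t) (at t)" for t
  proof -
    have "((\<lambda>t. mexp (t *\<^sub>R X) $ 1 $ 1 * cos \<theta> + mexp (t *\<^sub>R X) $ 1 $ 2 * sin \<theta>) has_real_derivative
      (X ** mexp (t *\<^sub>R X)) $ 1 $ 1 * cos \<theta> + (X ** mexp (t *\<^sub>R X)) $ 1 $ 2 * sin \<theta>) (at t)"
      by (auto intro!: derivative_eq_intros DERIV_mexp)
    thus ?thesis
      by (simp add: w1_def[abs_def] w2_def w_def matrix_vector_mult_def sum_2 matrix_matrix_mult_def
          a_def b_def algebra_simps)
  qed
  have dw2: "(w2 has_real_derivative c * w1 t - a * w2 t) (at t)" for t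
  proof -
    have "((\<lambda>t. mexp (t *\<^sub>R X) $ 2 $ 1 * cos \<theta> + mexp (t *\<^sub>R X) $ 2 $ 2 * sin \<theta>) has_real_derivative
      (X ** mexp (t *\<^sub>R X)) $ 2 $ 1 * cos \<theta> + (X ** mexp (t *\<^sub>R X)) $ 2 $ 2 * sin \<theta>) (at t)"
      by (auto intro!: derivative_eq_intros DERIV_mexp)
    thus ?thesis
      by (simp add: w2_def[abs_def] w1_def w_def matrix_vector_mult_def sum_2 matrix_matrix_mult_def
          X22 c_def algebra_simps)
  qed
  \<comment> \<open>\<open>N\<close> is the squared length of \<open>w\<close>, \<open>g\<close> the
    inner product of \<open>w\<close> and \<open>w'\<close>, and \<open>s\<close> their determinant,
    so that \<open>g / N\<close> is the logarithmic radial speed and \<open>s / N\<close> the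
    angular speed.\<close>
  define N where "N t = (w1 t)\<^sup>2 + (w2 t)\<^sup>2" for t
  define g where "g t = a * ((w1 t)\<^sup>2 - (w2 t)\<^sup>2) + (b + c) * (w1 t * w2 t)" for t
  define s where "s t = c * (w1 t)\<^sup>2 - 2 * a * (w1 t * w2 t) - b * (w2 t)\<^sup>2" for t
  have dN: "(N has_real_derivative 2 * g t) (at t)" for t
    unfolding N_def[abs_def] g_def
    by (rule derivative_eq_intros dw1 dw2 refl | simp add: algebra_simps power2_eq_square)+
  have gb: "\<bar>2 * g t\<bar> \<le> (2 * \<bar>a\<bar> + \<bar>b + c\<bar>) * N t" for t
  proof -
    have "\<bar>(w1 t)\<^sup>2 - (w2 t)\<^sup>2\<bar> \<le> N t" by (simp add: N_def abs_le_iff)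
    hence "\<bar>a * ((w1 t)\<^sup>2 - (w2 t)\<^sup>2)\<bar> \<le> \<bar>a\<bar> * N t" by (simp add: abs_mult mult_left_mono)
    moreover have "\<bar>2 * (w1 t * w2 t)\<bar> \<le> N t"
      using sum_squares_bound[of "w1 t" "w2 t"] sum_squares_bound[of "- w1 t" "w2 t"]
      by (simp add: N_def abs_le_iff)
    hence "\<bar>(b + c) * (2 * (w1 t * w2 t))\<bar> \<le> \<bar>b + c\<bar> * N t"
      unfolding abs_mult[of "b + c"] by (intro mult_left_mono) auto
    ultimately show ?thesis unfolding g_def by (simp add: algebra_simps abs_le_iff)
  qed
  have Npos: "N t > 0" for t
    by (rule nonzero_of_derivative_bound[OF dN gb]) (simp add: N_def w0)
  have Nz: "N t \<noteq> 0" for t using Npos[of t] by simp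
  have cont: "continuous_on UNIV w1" "continuous_on UNIV w2" "continuous_on UNIV N"
    by (rule has_real_derivative_imp_continuous_on, rule dw1 dw2 dN)+
  have "continuous_on UNIV (\<lambda>t. s t / N t)" unfolding s_def
    by (intro continuous_intros cont ballI Nz)
  then obtain \<phi>0 where \<phi>0: "\<And>t. (\<phi>0 has_real_derivative s t / N t) (at t)"
    using continuous_imp_antiderivative by blast
  have "continuous_on UNIV (\<lambda>t. g t / N t)" unfolding g_def
    by (intro continuous_intros cont ballI Nz)
  then obtain R where R: "\<And>t. (R has_real_derivative g t / N t) (at t)"
    using continuous_imp_antiderivative by blast
  define \<alpha> \<omega> where "\<alpha> t = g t / N t" and "\<omega> t = s t / N t" for t
  have dR: "(R has_real_derivative \<alpha> t) (at t)" for t using R by (simp add: \<alpha>_def)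
  define \<phi> where "\<phi> t = \<phi>0 t - \<phi>0 0 + \<theta>" for t
  have d\<phi>: "(\<phi> has_real_derivative \<omega> t) (at t)" for t
    unfolding \<phi>_def[abs_def] by (auto intro!: derivative_eq_intros \<phi>0 simp: \<omega>_def)
  have rot: "a * w1 t + b * w2 t = \<alpha> t * w1 t - \<omega> t * w2 t"
    "c * w1 t - a * w2 t = \<alpha> t * w2 t + \<omega> t * w1 t" for t
  proof -
    have "(a * w1 t + b * w2 t) * N t = g t * w1 t - s t * w2 t"
      "(c * w1 t - a * w2 t) * N t = g t * w2 t + s t * w1 t"
      unfolding N_def g_def s_def by (simp_all add: algebra_simps power2_eq_square)
    thus "a * w1 t + b * w2 t = \<alpha> t * w1 t - \<omega> t * w2 t"
      "c * w1 t - a * w2 t = \<alpha> t * w2 t + \<omega> t * w1 t"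
      using Nz[of t] by (simp_all add: \<alpha>_def \<omega>_def field_simps)
  qed
  \<comment> \<open>Coordinates of \<open>w\<close> in the frame turning with \<open>\<phi>\<close>,
    scaled by \<open>exp (- R)\<close>. They are constant because \<open>w'\<close> is
    \<open>\<alpha>\<close> times \<open>w\<close> plus \<open>\<omega>\<close> times
    \<open>w\<close> turned by a right angle.\<close>
  define A B where "A t = exp (- R t) * (w1 t * cos (\<phi> t) + w2 t * sin (\<phi> t))"
    and "B t = exp (- R t) * (w2 t * cos (\<phi> t) - w1 t * sin (\<phi> t))" for t
  have dw1': "(w1 has_real_derivative \<alpha> t * w1 t - \<omega> t * w2 t) (at t)"
    and dw2': "(w2 has_real_derivative \<alpha> t * w2 t + \<omega> t * w1 t) (at t)" for t
    using dw1 dw2 rot by metis+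
  have "(A has_real_derivative 0) (at t)" "(B has_real_derivative 0) (at t)" for t
    unfolding A_def[abs_def] B_def[abs_def]
    by ((rule derivative_eq_intros dw1' dw2' d\<phi> dR refl | simp)+, simp add: algebra_simps)+
  hence AB: "A t = A 0" "B t = B 0" for t
    using DERIV_isconst_all[of A t 0] DERIV_isconst_all[of B t 0] by blast+
  have \<phi>_0: "\<phi> 0 = \<theta>" by (simp add: \<phi>_def)
  have "A 0 = exp (- R 0)" "B 0 = 0"
    unfolding A_def B_def \<phi>_0 w0 by (simp_all flip: power2_eq_square)
  define r where "r t = exp (R t - R 0)" for t
  have e: "w1 t * cos (\<phi> t) + w2 t * sin (\<phi> t) = r t" "w2 t * cos (\<phi> t) - w1 t * sin (\<phi> t) = 0" for t
  proof -
    have *: "exp (- R t) * (w1 t * cos (\<phi> t) + w2 t * sin (\<phi> t)) = exp (- R 0)"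
      "exp (- R t) * (w2 t * cos (\<phi> t) - w1 t * sin (\<phi> t)) = 0"
      using AB[of t] \<open>A 0 = exp (- R 0)\<close> \<open>B 0 = 0\<close> by (simp_all add: A_def B_def)
    show "w1 t * cos (\<phi> t) + w2 t * sin (\<phi> t) = r t"
      using *(1) by (simp add: r_def exp_diff exp_minus field_simps)
    show "w2 t * cos (\<phi> t) - w1 t * sin (\<phi> t) = 0"
      using *(2) by (simp only: mult_eq_0_iff exp_not_eq_zero simp_thms)
  qed
  have w: "w1 t = r t * cos (\<phi> t)" "w2 t = r t * sin (\<phi> t)" for t
  proof -
    have sc: "sin (\<phi> t) * sin (\<phi> t) = 1 - cos (\<phi> t) * cos (\<phi> t)"
      using sin_cos_squared_add[of "\<phi> t"] by (simp add: power2_eq_square)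
    have "w1 t = (w1 t * cos (\<phi> t) + w2 t * sin (\<phi> t)) * cos (\<phi> t)
        - (w2 t * cos (\<phi> t) - w1 t * sin (\<phi> t)) * sin (\<phi> t)"
      "w2 t = (w1 t * cos (\<phi> t) + w2 t * sin (\<phi> t)) * sin (\<phi> t)
        + (w2 t * cos (\<phi> t) - w1 t * sin (\<phi> t)) * cos (\<phi> t)"
      by (simp_all add: algebra_simps sc)
    thus "w1 t = r t * cos (\<phi> t)" "w2 t = r t * sin (\<phi> t)" unfolding e by simp_all
  qed
  have rpos: "r t > 0" for t by (simp add: r_def)
  have "\<omega> t = pk X (\<phi> t)" for t
  proof -
    have "N t = (r t)\<^sup>2" unfolding N_def w by (simp add: power_mult_distrib flip: distrib_left)
    moreover have "s t = (r t)\<^sup>2 * pk X (\<phi> t)"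
      unfolding s_def w pk_def sin_double
      by (simp add: a_def b_def c_def algebra_simps power2_eq_square)
    ultimately show ?thesis using rpos[of t] by (simp add: \<omega>_def)
  qed
  with d\<phi> have "(\<phi> has_real_derivative pk X (\<phi> t)) (at t)" for t by simp
  moreover have "mexp X *v evec \<theta> = r 1 *\<^sub>R evec (\<phi> 1)"
  proof -
    have "w 1 $ 1 = r 1 * cos (\<phi> 1)" "w 1 $ 2 = r 1 * sin (\<phi> 1)"
      using w[of 1] by (simp_all add: w1_def w2_def)
    thus ?thesis by (simp add: w_def vec_eq_iff forall_2)
  qed
  ultimately show ?thesis using that \<phi>_0 rpos by blast
qed

section \<open>From lifted angles to the map \<open>ST\<close>\<close>

lemma evec_add_int_pi: "evec (y + of_int n * pi) = evec y \<or> evec (y + of_int n * pi) = - evec y"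
proof -
  have "sin (of_int n * pi) = 0" by (simp add: sin_times_pi_eq_0)
  moreover from this have "cos (of_int n * pi) = 1 \<or> cos (of_int n * pi) = -1"
    using sin_zero_abs_cos_one[of "of_int n * pi"] by (auto simp: abs_if split: if_splits)
  ultimately show ?thesis
    by (auto simp: vec_eq_iff forall_2 cos_add sin_add)
qed

lemma evec_eq_imp_eq:
  assumes "evec x = evec y \<or> evec x = - evec y" "0 \<le> x" "x < pi" "0 \<le> y" "y < pi"
  shows "x = y"
proof -
  have "sin (x - y) = 0" using assms(1) by (auto simp: vec_eq_iff forall_2 sin_diff)
  moreover have "sin (y - x) = - sin (x - y)" by (simp add: sin_diff)
  ultimately show ?thesis
    using sin_gt_zero[of "x - y"] sin_gt_zero[of "y - x"] assms by (cases x y rule: linorder_cases) auto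
qed

lemma norm_evec: "norm (evec \<theta>) = 1"
  by (simp add: norm_vec_def L2_set_def sum_2)

lemma ST_eqI:
  assumes "T *v evec \<theta> = r *\<^sub>R evec \<phi>" "r \<noteq> 0" "0 \<le> \<phi>" "\<phi> < pi"
  shows "ST T \<theta> = \<phi>"
proof -
  have u: "(1 / norm (T *v evec \<theta>)) *\<^sub>R (T *v evec \<theta>) = sgn r *\<^sub>R evec \<phi>"
    using assms(2) by (simp add: assms(1) norm_evec sgn_real_def abs_if)
  have sgn: "sgn r = 1 \<or> sgn r = -1" using assms(2) by (simp add: sgn_real_def)
  show ?thesis
    unfolding ST_def u
  proof (rule the_equality)
    show "0 \<le> \<phi> \<and> \<phi> < pi \<and> (evec \<phi> = sgn r *\<^sub>R evec \<phi> \<or> evec \<phi> = - (sgn r *\<^sub>R evec \<phi>))"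
      using assms sgn by auto
    fix x assume x: "0 \<le> x \<and> x < pi \<and> (evec x = sgn r *\<^sub>R evec \<phi> \<or> evec x = - (sgn r *\<^sub>R evec \<phi>))"
    hence "evec x = evec \<phi> \<or> evec x = - evec \<phi>" using sgn by auto
    thus "x = \<phi>" using x assms by (intro evec_eq_imp_eq) auto
  qed
qed

lemma ST_lift:
  assumes "T *v evec \<theta> = r *\<^sub>R evec \<phi>" "r \<noteq> 0"
  obtains n :: int where "\<phi> = ST T \<theta> + of_int n * pi"
proof -
  obtain y and n :: int where y: "0 \<le> y" "y < 0 + pi" "\<phi> = y + of_int n * pi"
    using pi_representative by blast
  have "T *v evec \<theta> = r *\<^sub>R evec y \<or> T *v evec \<theta> = (- r) *\<^sub>R evec y"
    using evec_add_int_pi[of y n] assms(1) y(3) by auto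
  hence "ST T \<theta> = y" using y assms(2) ST_eqI[of T \<theta> r y] ST_eqI[of T \<theta> "- r" y] by auto
  thus ?thesis using that y by blast
qed

text \<open>Taylor expansion in the flow time from 0 to 1: each time derivative of \<open>F\<close>
  along the flow applies the vector field \<open>pk X\<close> once more, and \<open>pk X\<close> is
  linear in \<open>X\<close>, so the third derivative has size \<open>norm X ^ 3\<close>.
  Periodicity of \<open>F\<close> absorbs the sign in \<open>T = - mexp X\<close> and the reduction
  of the angle modulo \<open>pi\<close>.\<close>

lemma ST_mexp_expansion:
  fixes F :: "real \<Rightarrow> real"
  assumes X: "X \<in> sl2" and T: "T = mexp X \<or> T = - mexp X" and F: "pi_periodic F"
    and dF: "\<And>x. (F has_real_derivative F1 x) (at x)" "\<And>x. (F1 has_real_derivative F2 x) (at x)"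
      "\<And>x. (F2 has_real_derivative F3 x) (at x)"
    and B: "\<And>x. \<bar>F1 x\<bar> \<le> B" "\<And>x. \<bar>F2 x\<bar> \<le> B" "\<And>x. \<bar>F3 x\<bar> \<le> B"
  shows "\<bar>F (ST T \<theta>) - (F \<theta> + pk X \<theta> * F1 \<theta> + (pk X \<theta> * dpk X \<theta> * F1 \<theta> + (pk X \<theta>)\<^sup>2 * F2 \<theta>) / 2)\<bar>
    \<le> 50 * norm X ^ 3 * B"
proof -
  obtain \<phi> r where \<phi>: "\<phi> 0 = \<theta>" "\<And>t. (\<phi> has_real_derivative pk X (\<phi> t)) (at t)"
    "r > 0" "mexp X *v evec \<theta> = r *\<^sub>R evec (\<phi> 1)"
    using mexp_angle_lift[OF X] by metis
  have uminus: "(- A) *v v = - (A *v v)" for A :: mat2 and v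
    by (simp add: matrix_vector_mult_def vec_eq_iff sum_negf)
  have "T *v evec \<theta> = r *\<^sub>R evec (\<phi> 1) \<or> T *v evec \<theta> = (- r) *\<^sub>R evec (\<phi> 1)"
    using T \<phi>(4) uminus by auto
  then obtain n :: int where "\<phi> 1 = ST T \<theta> + of_int n * pi"
    using ST_lift \<phi>(3) by (metis less_irrefl neg_equal_0_iff_equal)
  hence FST: "F (ST T \<theta>) = F (\<phi> 1)" using pi_periodic_add_int[OF F] by simp
  define h1 where "h1 x = pk X x * F1 x" for x
  define h2 where "h2 x = pk X x * dpk X x * F1 x + (pk X x)\<^sup>2 * F2 x" for x
  define h3 where "h3 x = pk X x * ((dpk X x * dpk X x + pk X x * ddpk X x) * F1 x
     + 3 * (pk X x * dpk X x * F2 x) + pk X x * pk X x * F3 x)" for x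
  define D where "D = (\<lambda>(m::nat) t. if m = 0 then F (\<phi> t) else if m = 1 then h1 (\<phi> t)
     else if m = 2 then h2 (\<phi> t) else h3 (\<phi> t))"
  have d0: "((\<lambda>t. F (\<phi> t)) has_real_derivative h1 (\<phi> t)) (at t)" for t
    using DERIV_chain2[OF dF(1) \<phi>(2)] by (simp add: h1_def mult.commute)
  have d1: "((\<lambda>t. h1 (\<phi> t)) has_real_derivative h2 (\<phi> t)) (at t)" for t
  proof -
    have "(h1 has_real_derivative dpk X x * F1 x + pk X x * F2 x) (at x)" for x
      unfolding h1_def[abs_def] by (rule derivative_eq_intros DERIV_pk dF refl | simp)+
    from DERIV_chain2[OF this \<phi>(2)] show ?thesis
      by (simp add: h2_def power2_eq_square algebra_simps)
  qed
  have d2: "((\<lambda>t. h2 (\<phi> t)) has_real_derivative h3 (\<phi> t)) (at t)" for t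
  proof -
    have "(h2 has_real_derivative (dpk X x * dpk X x + pk X x * ddpk X x) * F1 x
     + 3 * (pk X x * dpk X x * F2 x) + pk X x * pk X x * F3 x) (at x)" for x
      unfolding h2_def[abs_def] 
      by (rule derivative_eq_intros DERIV_pk DERIV_dpk dF refl | simp add: algebra_simps power2_eq_square)+
    from DERIV_chain2[OF this \<phi>(2)] show ?thesis
      by (simp add: h3_def algebra_simps)
  qed
  have "\<exists>t::real. 0 < t \<and> t < 1 \<and> F (\<phi> 1) = (\<Sum>m<3. D m 0 / fact m * (1 - 0) ^ m) + D 3 t / fact 3 * (1 - 0) ^ 3"
  proof (rule Taylor_up)
    show "\<forall>m t. m < 3 \<and> 0 \<le> t \<and> t \<le> 1 \<longrightarrow> (D m has_real_derivative D (Suc m) t) (at t)"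
    proof (intro allI impI)
      fix m :: nat and t :: real assume "m < 3 \<and> 0 \<le> t \<and> t \<le> 1"
      hence "m = 0 \<or> m = 1 \<or> m = 2" by auto
      thus "(D m has_real_derivative D (Suc m) t) (at t)"
        using d0[of t] d1[of t] d2[of t] by (auto simp: D_def)
    qed
  qed (auto simp: D_def)
  then obtain t where "F (\<phi> 1) = F \<theta> + h1 \<theta> + h2 \<theta> / 2 + h3 (\<phi> t) / 6"
    by (auto simp: D_def \<phi>(1) eval_nat_numeral)
  \<comment> \<open>\<open>255 = 3 * (40 + 3 * 12 + 9)\<close>, from the bounds 3, 4, 8 on
    \<open>pk\<close>, \<open>dpk\<close>, \<open>ddpk\<close>; division by 6 leaves less than
    50.\<close>
  moreover have "\<bar>h3 x\<bar> \<le> 255 * norm X ^ 3 * B" for x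
  proof -
    define N where "N = norm X"
    have N0: "N \<ge> 0" by (simp add: N_def)
    have B0: "B \<ge> 0" using B(1)[of 0] by linarith
    have prod: "\<bar>u * v\<bar> \<le> a * b" if "\<bar>u\<bar> \<le> a" "\<bar>v\<bar> \<le> b" for u v a b :: real
      unfolding abs_mult using that by (intro mult_mono) auto
    note b = abs_pk_le[of X x, folded N_def] abs_dpk_le[of X x, folded N_def] abs_ddpk_le[of X x, folded N_def]
    have "\<bar>dpk X x * dpk X x + pk X x * ddpk X x\<bar> \<le> 4 * N * (4 * N) + 3 * N * (8 * N)"
      using prod[OF b(2) b(2)] prod[OF b(1) b(3)] by linarith
    from prod[OF this B(1)[of x]] 
    have 1: "\<bar>(dpk X x * dpk X x + pk X x * ddpk X x) * F1 x\<bar> \<le> 40 * (N * N * B)"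
      by (simp add: algebra_simps)
    have 2: "\<bar>pk X x * dpk X x * F2 x\<bar> \<le> 12 * (N * N * B)"
      using prod[OF prod[OF b(1) b(2)] B(2)[of x]] by (simp add: algebra_simps)
    have 3: "\<bar>pk X x * pk X x * F3 x\<bar> \<le> 9 * (N * N * B)"
      using prod[OF prod[OF b(1) b(1)] B(3)[of x]] by (simp add: algebra_simps)
    have "\<bar>(dpk X x * dpk X x + pk X x * ddpk X x) * F1 x
     + 3 * (pk X x * dpk X x * F2 x) + pk X x * pk X x * F3 x\<bar> \<le> 85 * (N * N * B)"
      using 1 2 3 by linarith
    from prod[OF b(1) this] show ?thesis
      by (simp add: h3_def N_def power3_eq_cube mult_ac)
  qed
  hence "\<bar>h3 (\<phi> t) / 6\<bar> \<le> 50 * norm X ^ 3 * B"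
  proof -
    have "B \<ge> 0" using B(1)[of 0] by linarith
    hence "0 \<le> norm X ^ 3 * B" by simp
    moreover have "\<bar>h3 (\<phi> t)\<bar> \<le> 255 * (norm X ^ 3 * B)"
      using \<open>\<bar>h3 (\<phi> t)\<bar> \<le> 255 * norm X ^ 3 * B\<close> by (simp add: mult.assoc)
    ultimately have "\<bar>h3 (\<phi> t) / 6\<bar> \<le> 50 * (norm X ^ 3 * B)" by simp
    thus ?thesis by (simp add: mult.assoc)
  qed
  ultimately show ?thesis unfolding FST h1_def h2_def by simp
qed

subsection \<open>Random iterations on the circle\<close>

text \<open>Measurability cannot be read off a definite description. An angle strictly between 0 and
  \<open>pi\<close> is determined by its cotangent \<open>v $ 1 / v $ 2\<close>, which gives a
  formula in measurable terms; the angle 0 is the separate case.\<close>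

lemma ST_explicit:
  assumes "T *v evec \<theta> \<noteq> 0"
  defines "v \<equiv> T *v evec \<theta>"
  shows "ST T \<theta> = (if v $ 2 = 0 then 0 else pi / 2 - arctan (v $ 1 / v $ 2))"
proof (cases "v $ 2 = 0")
  case True
  have "v $ 1 \<noteq> 0" using assms True by (auto simp: vec_eq_iff forall_2)
  have "ST T \<theta> = 0"
    by (rule ST_eqI[of _ _ "v $ 1"]) (use True \<open>v $ 1 \<noteq> 0\<close> in \<open>auto simp: vec_eq_iff forall_2 v_def\<close>)
  thus ?thesis using True by simp
next
  case False
  define t where "t = v $ 1 / v $ 2"
  have s: "sqrt (1 + t\<^sup>2) > 0" by (simp add: add_pos_nonneg)
  have "ST T \<theta> = pi / 2 - arctan t"
  proof (rule ST_eqI)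
    show "T *v evec \<theta> = (v $ 2 * sqrt (1 + t\<^sup>2)) *\<^sub>R evec (pi / 2 - arctan t)"
      unfolding v_def[symmetric] using s False
      by (simp add: vec_eq_iff forall_2 cos_diff sin_diff sin_arctan cos_arctan t_def)
    show "v $ 2 * sqrt (1 + t\<^sup>2) \<noteq> 0" using s False by simp
  qed (use arctan_bounded[of t] in auto)
  thus ?thesis using False by (simp add: t_def)
qed

lemma measurable_mat2_entry [measurable (raw)]:
  fixes A :: "'a \<Rightarrow> mat2"
  assumes "A \<in> borel_measurable M"
  shows "(\<lambda>x. A x $ i $ j) \<in> borel_measurable M"
proof -
  have "continuous_on UNIV (\<lambda>A::mat2. A $ i $ j)" by (intro continuous_intros)
  from measurable_compose[OF assms borel_measurable_continuous_onI[OF this]] show ?thesis .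
qed

lemma measurable_ST:
  fixes A :: "'s \<Rightarrow> mat2"
  assumes [measurable]: "A \<in> borel_measurable M"
    and nz: "\<And>\<sigma> \<theta>. \<sigma> \<in> space M \<Longrightarrow> A \<sigma> *v evec \<theta> \<noteq> 0"
  shows "(\<lambda>x. ST (A (fst x)) (snd x)) \<in> borel_measurable (M \<Otimes>\<^sub>M borel)"
proof -
  define v1 v2 where "v1 \<sigma> \<theta> = A \<sigma> $ 1 $ 1 * cos \<theta> + A \<sigma> $ 1 $ 2 * sin \<theta>"
    and "v2 \<sigma> \<theta> = A \<sigma> $ 2 $ 1 * cos \<theta> + A \<sigma> $ 2 $ 2 * sin \<theta>" for \<sigma> \<theta>
  have [measurable]: "(\<lambda>x. v1 (fst x) (snd x)) \<in> borel_measurable (M \<Otimes>\<^sub>M borel)"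
    "(\<lambda>x. v2 (fst x) (snd x)) \<in> borel_measurable (M \<Otimes>\<^sub>M borel)"
    unfolding v1_def v2_def by measurable
  have "ST (A \<sigma>) \<theta> = (if v2 \<sigma> \<theta> = 0 then 0 else pi / 2 - arctan (v1 \<sigma> \<theta> / v2 \<sigma> \<theta>))"
    if "\<sigma> \<in> space M" for \<sigma> \<theta>
    using ST_explicit[OF nz[OF that], of \<theta>]
    by (simp add: v1_def v2_def matrix_vector_mult_def sum_2)
  hence "(\<lambda>x. ST (A (fst x)) (snd x)) \<in> borel_measurable (M \<Otimes>\<^sub>M borel) \<longleftrightarrow>
     (\<lambda>x. if v2 (fst x) (snd x) = 0 then 0
      else pi / 2 - arctan (v1 (fst x) (snd x) / v2 (fst x) (snd x))) \<in> borel_measurable (M \<Otimes>\<^sub>M borel)"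
    by (intro measurable_cong) (auto simp: space_pair_measure)
  moreover have [measurable]: "(arctan :: real \<Rightarrow> real) \<in> borel_measurable borel"
    by (intro borel_measurable_continuous_onI continuous_intros)
  have "(\<lambda>x. if v2 (fst x) (snd x) = 0 then 0
      else pi / 2 - arctan (v1 (fst x) (snd x) / v2 (fst x) (snd x))) \<in> borel_measurable (M \<Otimes>\<^sub>M borel)"
    by measurable
  ultimately show ?thesis by blast
qed

text \<open>Splitting off the first entry of an i.i.d. sequence. Stated as an equality of measures,
  it applies to Bochner integrals of signed functions and combines with Fubini.\<close>

lemma (in prob_space) stream_space_eq_distr_Stream:
  "stream_space M = distr (M \<Otimes>\<^sub>M stream_space M) (stream_space M) (\<lambda>(x, \<omega>). x ## \<omega>)"
proof -
  interpret str: prob_space "stream_space M" by (rule prob_space_stream_space)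
  show "stream_space M = distr (M \<Otimes>\<^sub>M stream_space M) (stream_space M) (\<lambda>(x, \<omega>). x ## \<omega>)"
  proof (rule measure_eqI)
    fix A assume A[measurable]: "A \<in> sets (stream_space M)"
    have "emeasure (stream_space M) A = (\<integral>\<^sup>+\<omega>. indicator A \<omega> \<partial>stream_space M)" by simp
    also have "\<dots> = (\<integral>\<^sup>+x. (\<integral>\<^sup>+\<omega>. indicator A (x ## \<omega>) \<partial>stream_space M) \<partial>M)"
      by (rule nn_integral_stream_space[of "indicator A"]) measurable
    also have "\<dots> = (\<integral>\<^sup>+z. indicator A (case z of (x, \<omega>) \<Rightarrow> x ## \<omega>) \<partial>(M \<Otimes>\<^sub>M stream_space M))"
      by (subst str.nn_integral_fst[symmetric]) simp_all
    also have "\<dots> = emeasure (distr (M \<Otimes>\<^sub>M stream_space M) (stream_space M) (\<lambda>(x, \<omega>). x ## \<omega>)) A"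
    proof (subst nn_integral_indicator[symmetric])
      show "(\<integral>\<^sup>+z. indicator A (case z of (x, \<omega>) \<Rightarrow> x ## \<omega>) \<partial>(M \<Otimes>\<^sub>M stream_space M)) =
        (\<integral>\<^sup>+\<omega>. indicator A \<omega> \<partial>distr (M \<Otimes>\<^sub>M stream_space M) (stream_space M) (\<lambda>(x, \<omega>). x ## \<omega>))"
        by (rule nn_integral_distr[symmetric]) measurable
    qed simp
    finally show "emeasure (stream_space M) A =
      emeasure (distr (M \<Otimes>\<^sub>M stream_space M) (stream_space M) (\<lambda>(x, \<omega>). x ## \<omega>)) A" .
  qed simp
qed

section \<open>Expectations along the random orbit\<close>

locale random_map = prob_space M for M :: "'s measure" +
  fixes S :: "'s \<Rightarrow> real \<Rightarrow> real"
  assumes measurable_S: "(\<lambda>x. S (fst x) (snd x)) \<in> borel_measurable (M \<Otimes>\<^sub>M borel)"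
begin

lemma measurable_S_compose [measurable (raw)]:
  assumes "g \<in> N \<rightarrow>\<^sub>M M" "h \<in> borel_measurable N"
  shows "(\<lambda>x. S (g x) (h x)) \<in> borel_measurable N"
  using measurable_compose[OF measurable_Pair[OF assms] measurable_S] by simp

lemma measurable_theta_seq [measurable (raw)]:
  assumes [measurable]: "\<theta> \<in> borel_measurable N" "\<omega> \<in> N \<rightarrow>\<^sub>M stream_space M"
  shows "(\<lambda>x. theta_seq S (\<theta> x) (\<omega> x) n) \<in> borel_measurable N"
  by (induction n) simp_all

text \<open>The recursion of \<open>theta_seq\<close> adds the newest map at the outside; this form
  removes the oldest map instead, matching the decomposition of a stream at its head.\<close>

lemma theta_seq_Stream: "theta_seq S \<theta> (x ## \<omega>) (Suc n) = theta_seq S (S x \<theta>) \<omega> n"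
  by (induction n) simp_all

definition theta_mean :: "nat \<Rightarrow> (real \<Rightarrow> real) \<Rightarrow> real \<Rightarrow> real" where
  "theta_mean n F \<theta> = (\<integral>\<omega>. F (theta_seq S \<theta> \<omega> n) \<partial>stream_space M)"

lemma integrable_theta_seq:
  fixes F :: "real \<Rightarrow> real"
  assumes [measurable]: "F \<in> borel_measurable borel" and b: "\<And>x. \<bar>F x\<bar> \<le> B"
  shows "integrable (stream_space M) (\<lambda>\<omega>. F (theta_seq S \<theta> \<omega> n))"
proof -
  interpret str: prob_space "stream_space M" by (rule prob_space_stream_space)
  show ?thesis by (rule str.integrable_const_bound[of _ B]) (use b in auto)
qed

text \<open>The Markov property: given the first map, the process restarts at
  \<open>S x \<theta>\<close>. Boundedness of \<open>F\<close> supplies the integrability for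
  Fubini.\<close>

lemma theta_mean_Suc:
  assumes [measurable]: "F \<in> borel_measurable borel" and b: "\<And>x. \<bar>F x\<bar> \<le> B"
  shows "integrable M (\<lambda>x. theta_mean n F (S x \<theta>))"
    and "theta_mean (Suc n) F \<theta> = (\<integral>x. theta_mean n F (S x \<theta>) \<partial>M)"
proof -
  note eq = stream_space_eq_distr_Stream
  interpret str: prob_space "stream_space M" by (rule prob_space_stream_space)
  interpret pair_prob_space M "stream_space M" ..
  have int: "integrable (M \<Otimes>\<^sub>M stream_space M) (\<lambda>z. F (theta_seq S (S (fst z) \<theta>) (snd z) n))"
    by (rule P.integrable_const_bound[of _ B]) (use b in auto)
  show "integrable M (\<lambda>x. theta_mean n F (S x \<theta>))"
    using integrable_fst'[OF int] by (simp add: theta_mean_def)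
  have "theta_mean (Suc n) F \<theta> = (\<integral>z. F (theta_seq S \<theta> (case z of (x, \<omega>) \<Rightarrow> x ## \<omega>) (Suc n)) \<partial>(M \<Otimes>\<^sub>M stream_space M))"
  proof -
    have "theta_mean (Suc n) F \<theta> = (\<integral>\<omega>. F (theta_seq S \<theta> \<omega> (Suc n))
        \<partial>distr (M \<Otimes>\<^sub>M stream_space M) (stream_space M) (\<lambda>(x, \<omega>). x ## \<omega>))"
      unfolding theta_mean_def by (rule arg_cong[OF eq, of "\<lambda>N. integral\<^sup>L N (\<lambda>\<omega>. F (theta_seq S \<theta> \<omega> (Suc n)))"])
    also have "\<dots> = (\<integral>z. F (theta_seq S \<theta> (case z of (x, \<omega>) \<Rightarrow> x ## \<omega>) (Suc n)) \<partial>(M \<Otimes>\<^sub>M stream_space M))"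
      by (rule integral_distr) measurable
    finally show ?thesis .
  qed
  also have "\<dots> = (\<integral>z. F (theta_seq S (S (fst z) \<theta>) (snd z) n) \<partial>(M \<Otimes>\<^sub>M stream_space M))"
    by (simp add: theta_seq_Stream case_prod_beta del: theta_seq.simps)
  also have "\<dots> = (\<integral>x. theta_mean n F (S x \<theta>) \<partial>M)"
    using integral_fst'[OF int] by (simp add: theta_mean_def)
  finally show "theta_mean (Suc n) F \<theta> = (\<integral>x. theta_mean n F (S x \<theta>) \<partial>M)" .
qed

lemma abs_integral_le_const:
  fixes g :: "'s \<Rightarrow> real"
  assumes "integrable M g" "\<And>x. x \<in> space M \<Longrightarrow> \<bar>g x\<bar> \<le> e"
  shows "\<bar>\<integral>x. g x \<partial>M\<bar> \<le> e"
proof -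
  have "\<bar>\<integral>x. g x \<partial>M\<bar> \<le> (\<integral>x. \<bar>g x\<bar> \<partial>M)" by (rule integral_abs_bound)
  also have "\<dots> \<le> (\<integral>x. e \<partial>M)" using assms by (intro integral_mono) auto
  finally show ?thesis by (simp add: prob_space)
qed

text \<open>The one-step estimate holds with the same \<open>e\<close> at every starting point, so
  averaging over the first map preserves it, and induction carries it to time
  \<open>n\<close>.\<close>

lemma theta_mean_step:
  assumes F[measurable]: "F \<in> borel_measurable borel" "\<And>x. \<bar>F x\<bar> \<le> B"
    and L[measurable]: "L \<in> borel_measurable borel" "\<And>x. \<bar>L x\<bar> \<le> B'"
    and step: "\<And>\<theta>. \<bar>(\<integral>x. F (S x \<theta>) \<partial>M) - F \<theta> - \<kappa> * L \<theta>\<bar> \<le> e"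
  shows "\<bar>theta_mean (Suc n) F \<theta> - theta_mean n F \<theta> - \<kappa> * theta_mean n L \<theta>\<bar> \<le> e"
proof (induction n arbitrary: \<theta>)
  case 0
  interpret str: prob_space "stream_space M" by (rule prob_space_stream_space)
  have "theta_mean 0 G \<theta> = G \<theta>" for G \<theta> by (simp add: theta_mean_def str.prob_space)
  thus ?case using step[of \<theta>] theta_mean_Suc(2)[OF F, of 0 \<theta>] by simp
next
  case (Suc n)
  note int = theta_mean_Suc(1)[OF F, of _ \<theta>] theta_mean_Suc(1)[OF L, of _ \<theta>]
  have "theta_mean (Suc (Suc n)) F \<theta> - theta_mean (Suc n) F \<theta> - \<kappa> * theta_mean (Suc n) L \<theta>
    = (\<integral>x. theta_mean (Suc n) F (S x \<theta>) - theta_mean n F (S x \<theta>) - \<kappa> * theta_mean n L (S x \<theta>) \<partial>M)"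
    unfolding theta_mean_Suc(2)[OF F, of "Suc n" \<theta>] theta_mean_Suc(2)[OF F, of n \<theta>] theta_mean_Suc(2)[OF L, of n \<theta>]
    using int by simp
  also have "\<bar>\<dots>\<bar> \<le> e"
    using int Suc by (intro abs_integral_le_const) auto
  finally show ?case .
qed

text \<open>Telescoping: up to \<open>N * e\<close>, \<open>\<kappa>\<close> times the sum of the
  expectations of \<open>L\<close> is a difference of two values of \<open>theta_mean\<close>, at
  most \<open>2 * B\<close> however large \<open>N\<close> is. Dividing by
  \<open>\<kappa> * N\<close> gives the rate, and \<open>\<delta>\<close> is the price for
  \<open>L\<close> being only close to \<open>f - c\<close>.\<close>

lemma I_N_bound:
  assumes F: "F \<in> borel_measurable borel" "\<And>x. \<bar>F x\<bar> \<le> B"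
    and L: "L \<in> borel_measurable borel" "\<And>x. \<bar>L x\<bar> \<le> B'"
    and f: "f \<in> borel_measurable borel" "\<And>x. \<bar>f x\<bar> \<le> B''"
    and step: "\<And>\<theta>. \<bar>(\<integral>x. F (S x \<theta>) \<partial>M) - F \<theta> - \<kappa> * L \<theta>\<bar> \<le> e"
    and fL: "\<And>x. \<bar>f x - c - L x\<bar> \<le> \<delta>" and \<kappa>: "\<kappa> > 0" and N: "N \<ge> 1"
  shows "\<bar>I_N M S \<theta> N f - c\<bar> \<le> (2 * B / real N + e) / \<kappa> + \<delta>"
proof -
  interpret str: prob_space "stream_space M" by (rule prob_space_stream_space)
  have N0: "real N > 0" using N by simp
  have IN: "I_N M S \<theta> N f = (\<Sum>n<N. theta_mean n f \<theta>) / real N"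
    unfolding I_N_def theta_mean_def by (subst Bochner_Integration.integral_sum) (use integrable_theta_seq[OF f] in auto)
  have bnd: "\<bar>theta_mean n F \<theta>\<bar> \<le> B" for n
  proof -
    have "\<bar>theta_mean n F \<theta>\<bar> \<le> (\<integral>\<omega>. \<bar>F (theta_seq S \<theta> \<omega> n)\<bar> \<partial>stream_space M)"
      unfolding theta_mean_def by (rule integral_abs_bound)
    also have "\<dots> \<le> (\<integral>\<omega>. B \<partial>stream_space M)"
      using F integrable_theta_seq[OF F] by (intro integral_mono) auto
    finally show ?thesis by (simp add: str.prob_space)
  qed
  have dif: "\<bar>theta_mean n f \<theta> - c - theta_mean n L \<theta>\<bar> \<le> \<delta>" for n
  proof -
    let ?h = "\<lambda>\<omega>. f (theta_seq S \<theta> \<omega> n) - c - L (theta_seq S \<theta> \<omega> n)"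
    note int = integrable_theta_seq[OF f, of \<theta> n] integrable_theta_seq[OF L, of \<theta> n]
    have "theta_mean n f \<theta> - c - theta_mean n L \<theta> = (\<integral>\<omega>. ?h \<omega> \<partial>stream_space M)"
      unfolding theta_mean_def using int by (simp add: str.prob_space)
    also have "\<bar>\<dots>\<bar> \<le> (\<integral>\<omega>. \<bar>?h \<omega>\<bar> \<partial>stream_space M)" by (rule integral_abs_bound)
    also have "\<dots> \<le> (\<integral>\<omega>. \<delta> \<partial>stream_space M)"
      using int fL by (intro integral_mono) auto
    finally show ?thesis by (simp add: str.prob_space)
  qed
  have tel: "\<bar>theta_mean N F \<theta> - theta_mean 0 F \<theta> - \<kappa> * (\<Sum>n<N. theta_mean n L \<theta>)\<bar> \<le> real N * e"
  proof -
    have "theta_mean N F \<theta> - theta_mean 0 F \<theta> - \<kappa> * (\<Sum>n<N. theta_mean n L \<theta>)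
        = (\<Sum>n<N. theta_mean (Suc n) F \<theta> - theta_mean n F \<theta> - \<kappa> * theta_mean n L \<theta>)"
      unfolding sum_lessThan_telescope[of "\<lambda>n. theta_mean n F \<theta>", symmetric]
      by (simp add: sum_subtractf sum_distrib_left)
    also have "\<bar>\<dots>\<bar> \<le> (\<Sum>n<N. e)"
      by (rule order_trans[OF sum_abs]) (intro sum_mono theta_mean_step[OF F L step])
    finally show ?thesis by simp
  qed
  hence "\<kappa> * \<bar>\<Sum>n<N. theta_mean n L \<theta>\<bar> \<le> 2 * B + real N * e"
  proof -
    have "\<kappa> * \<bar>\<Sum>n<N. theta_mean n L \<theta>\<bar> = \<bar>\<kappa> * (\<Sum>n<N. theta_mean n L \<theta>)\<bar>" using \<kappa> by (simp add: abs_mult)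
    thus ?thesis using tel bnd[of N] bnd[of 0] by linarith
  qed
  hence "\<bar>\<Sum>n<N. theta_mean n L \<theta>\<bar> / real N \<le> (2 * B / real N + e) / \<kappa>"
    using \<kappa> N0 by (simp add: field_simps)
  hence A: "\<bar>(\<Sum>n<N. theta_mean n L \<theta>) / real N\<bar> \<le> (2 * B / real N + e) / \<kappa>"
    by (simp add: abs_divide)
  have "I_N M S \<theta> N f - c = (\<Sum>n<N. theta_mean n f \<theta> - c - theta_mean n L \<theta>) / real N + (\<Sum>n<N. theta_mean n L \<theta>) / real N"
    unfolding IN sum_subtractf using N0 by (simp add: field_simps)
  moreover have "\<bar>(\<Sum>n<N. theta_mean n f \<theta> - c - theta_mean n L \<theta>) / real N\<bar> \<le> \<delta>"
  proof -
    have "\<bar>\<Sum>n<N. theta_mean n f \<theta> - c - theta_mean n L \<theta>\<bar> \<le> (\<Sum>n<N. \<delta>)"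
      by (rule order_trans[OF sum_abs]) (intro sum_mono dif)
    thus ?thesis using N0 by (simp add: field_simps)
  qed
  ultimately show ?thesis using A by linarith
qed

end

subsection \<open>The one-step expansion\<close>

text \<open>Linearity in the matrix lets expectations pass through \<open>pk\<close>, so that at
  first order only the mean matrices matter.\<close>

lemma bounded_linear_pk: "bounded_linear (\<lambda>P. pk P \<theta>)"
  by (rule bounded_linear_intro[of _ 3])
    (use abs_pk_le in \<open>auto simp: pk_def algebra_simps\<close>)

lemma pk_diff: "pk (P - Q) \<theta> = pk P \<theta> - pk Q \<theta>"
  by (simp add: pk_def algebra_simps)

lemma pk_scaleR: "pk (t *\<^sub>R P) \<theta> = t * pk P \<theta>"
  by (simp add: pk_def algebra_simps)

lemma dpk_diff: "dpk (P - Q) \<theta> = dpk P \<theta> - dpk Q \<theta>"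
  by (simp add: dpk_def algebra_simps)

lemma dpk_scaleR: "dpk (t *\<^sub>R P) \<theta> = t * dpk P \<theta>"
  by (simp add: dpk_def algebra_simps)

lemma measurable_pk [measurable]: "(\<lambda>P. pk P \<theta>) \<in> borel_measurable borel"
  unfolding pk_def by measurable

lemma measurable_dpk [measurable]: "(\<lambda>P. dpk P \<theta>) \<in> borel_measurable borel"
  unfolding dpk_def by measurable

lemma (in prob_space) integrable_of_norm_le:
  fixes g :: "'a \<Rightarrow> 'b::{banach, second_countable_topology}"
  assumes "g \<in> borel_measurable M" "\<And>x. x \<in> space M \<Longrightarrow> norm (g x) \<le> c"
  shows "integrable M g"
  by (rule integrable_const_bound[of _ c]) (use assms in auto)

lemma (in prob_space) norm_integral_le_const:
  fixes g :: "'a \<Rightarrow> 'b::{banach, second_countable_topology}"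
  assumes "g \<in> borel_measurable M" "\<And>x. x \<in> space M \<Longrightarrow> norm (g x) \<le> c"
  shows "norm (\<integral>x. g x \<partial>M) \<le> c"
proof -
  have int: "integrable M g" using integrable_of_norm_le assms by blast
  have "norm (\<integral>x. g x \<partial>M) \<le> (\<integral>x. norm (g x) \<partial>M)" by (rule integral_norm_bound)
  also have "\<dots> \<le> (\<integral>x. c \<partial>M)" using assms int by (intro integral_mono) auto
  finally show ?thesis by (simp add: prob_space)
qed

lemma mult_diff_bound:
  fixes u u' v v' a b d d' :: real
  assumes "\<bar>u\<bar> \<le> a" "\<bar>v'\<bar> \<le> b" "\<bar>v - v'\<bar> \<le> d" "\<bar>u - u'\<bar> \<le> d'"
  shows "\<bar>u * v - u' * v'\<bar> \<le> a * d + d' * b"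
proof -
  have "u * v - u' * v' = u * (v - v') + (u - u') * v'" by (simp add: algebra_simps)
  also have "\<bar>\<dots>\<bar> \<le> \<bar>u\<bar> * \<bar>v - v'\<bar> + \<bar>u - u'\<bar> * \<bar>v'\<bar>"
    by (simp add: abs_mult[symmetric])
  also have "\<dots> \<le> a * d + d' * b" using assms by (intro add_mono mult_mono) auto
  finally show ?thesis .
qed

text \<open>\<open>A\<close> stands for the conjugated matrices, of which measurability, a nonzero
  determinant and the exponential form are retained. \<open>B\<close> majorises the coefficients
  uniformly in \<open>\<sigma>\<close>, with a series summable at \<open>lam0\<close>, so the
  exponent may be integrated term by term for smaller \<open>lam\<close>.\<close>

locale anomalous_family = prob_space M for M :: "'s measure" +
  fixes A :: "real \<Rightarrow> 's \<Rightarrow> mat2" and \<eta> :: "nat \<Rightarrow> real" and P :: "nat \<Rightarrow> 's \<Rightarrow> mat2"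
    and K :: nat and lam0 :: real and B :: "nat \<Rightarrow> real"
  assumes P_sl: "\<And>k \<sigma>. k \<ge> 1 \<Longrightarrow> \<sigma> \<in> space M \<Longrightarrow> P k \<sigma> \<in> sl2"
    and P_meas: "\<And>k. k \<ge> 1 \<Longrightarrow> P k \<in> borel_measurable M"
    and eta_pos: "0 < \<eta> 1"
    and eta_mono: "\<And>k l. 1 \<le> k \<Longrightarrow> k < l \<Longrightarrow> \<eta> k < \<eta> l"
    and lam0: "lam0 > 0"
    and PB: "\<And>k \<sigma>. k \<ge> 1 \<Longrightarrow> \<sigma> \<in> space M \<Longrightarrow> norm (P k \<sigma>) \<le> B k"
    and summB: "summable (\<lambda>k. lam0 powr \<eta> (Suc k) * B (Suc k))"
    and A_meas: "\<And>lam. 0 < lam \<Longrightarrow> lam < lam0 \<Longrightarrow> A lam \<in> borel_measurable M"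
    and A_det: "\<And>lam \<sigma>. 0 < lam \<Longrightarrow> lam < lam0 \<Longrightarrow> \<sigma> \<in> space M \<Longrightarrow> det (A lam \<sigma>) \<noteq> 0"
    and A_exp: "\<And>lam \<sigma>. 0 < lam \<Longrightarrow> lam < lam0 \<Longrightarrow> \<sigma> \<in> space M \<Longrightarrow>
      A lam \<sigma> = mexp (\<Sum>k. (lam powr \<eta> (Suc k)) *\<^sub>R P (Suc k) \<sigma>) \<or>
      A lam \<sigma> = - mexp (\<Sum>k. (lam powr \<eta> (Suc k)) *\<^sub>R P (Suc k) \<sigma>)"
    and K_ge: "K \<ge> 1"
    and eta_K: "\<eta> K = 2 * \<eta> 1"
    and anomaly: "\<And>k. 1 \<le> k \<Longrightarrow> k < K \<Longrightarrow> (\<integral>\<sigma>. P k \<sigma> \<partial>M) = 0"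
begin

definition p :: "real \<Rightarrow> real" where
  "p \<theta> = (\<integral>\<sigma>. (pk (P 1 \<sigma>) \<theta>)\<^sup>2 \<partial>M)"

definition q :: "real \<Rightarrow> real" where
  "q \<theta> = 2 * (\<integral>\<sigma>. pk (P K \<sigma>) \<theta> \<partial>M) + (\<integral>\<sigma>. pk (P 1 \<sigma>) \<theta> * dpk (P 1 \<sigma>) \<theta> \<partial>M)"

text \<open>The error exponent of the theorem. If all means beyond \<open>K\<close> vanish, the
  first member of the minimum counts as infinite.\<close>

definition eta_t :: real where
  "eta_t = (if \<exists>k>K. (\<integral>\<sigma>. P k \<sigma> \<partial>M) \<noteq> 0
     then min (\<eta> (LEAST k. k > K \<and> (\<integral>\<sigma>. P k \<sigma> \<partial>M) \<noteq> 0)) (\<eta> 1 + \<eta> 2)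
     else \<eta> 1 + \<eta> 2)"

lemma K_gt_1: "K > 1"
proof (rule ccontr)
  assume "\<not> K > 1"
  hence "K = 1" using K_ge by simp
  thus False using eta_K eta_pos by simp
qed

text \<open>Index 2 is at most \<open>K\<close>. Consequently \<open>\<eta> 1 + \<eta> 2\<close> is
  at most \<open>3 * \<eta> 1\<close>, and the cubic Taylor remainder fits into the error
  exponent.\<close>

lemma eta_2: "\<eta> 2 \<le> 2 * \<eta> 1" "\<eta> 1 < \<eta> 2"
  using eta_mono[of 2 K] eta_mono[of 1 2] eta_K K_gt_1 by (cases "K = 2"; force)+

lemma eta_t_le: "eta_t \<le> \<eta> 1 + \<eta> 2"
  by (simp add: eta_t_def)

lemma eta_t_le_eta:
  assumes "k > K" "(\<integral>\<sigma>. P k \<sigma> \<partial>M) \<noteq> 0"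
  shows "eta_t \<le> \<eta> k"
proof -
  let ?Q = "\<lambda>k. k > K \<and> (\<integral>\<sigma>. P k \<sigma> \<partial>M) \<noteq> 0"
  have "Least ?Q \<le> k" "?Q (Least ?Q)"
    using assms Least_le[of ?Q k] LeastI[of ?Q k] by auto
  hence "\<eta> (Least ?Q) \<le> \<eta> k"
    using eta_mono[of "Least ?Q" k] K_ge by (cases "Least ?Q = k") auto
  thus ?thesis using assms by (auto simp: eta_t_def)
qed

lemma B_nonneg: "k \<ge> 1 \<Longrightarrow> B k \<ge> 0"
  using PB[of k] not_empty by (metis ex_in_conv norm_ge_zero order_trans)

section \<open>Majorants for the series in the exponent\<close>

definition b :: "nat \<Rightarrow> real" where "b k = lam0 powr \<eta> (Suc k) * B (Suc k)"

lemma summable_b: "summable b"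
  unfolding b_def by (rule summB)

definition s :: real where "s = (\<Sum>k. b k)"

lemma b_nonneg: "b k \<ge> 0"
  by (simp add: b_def B_nonneg)

lemma s_nonneg: "s \<ge> 0"
  unfolding s_def by (intro suminf_nonneg summable_b b_nonneg)

text \<open>As \<open>lam / lam0 < 1\<close>, every exponent at least \<open>e\<close> may be
  lowered to \<open>e\<close>, the remaining weight being the summable \<open>b k\<close>. In this
  way each tail of the series costs one power of \<open>lam\<close> and the constant
  \<open>s\<close>.\<close>

lemma term_bound:
  assumes lam: "0 < lam" "lam < lam0" and e: "e \<le> \<eta> (Suc k)" and Q: "norm Q \<le> B (Suc k)"
  shows "norm ((lam powr \<eta> (Suc k)) *\<^sub>R Q) \<le> (lam / lam0) powr e * b k"
proof -
  have "(lam / lam0) powr \<eta> (Suc k) \<le> (lam / lam0) powr e"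
    using lam e by (intro powr_mono') auto
  hence "(lam / lam0) powr \<eta> (Suc k) * b k \<le> (lam / lam0) powr e * b k"
    by (intro mult_right_mono b_nonneg)
  moreover have "(lam / lam0) powr \<eta> (Suc k) * b k = lam powr \<eta> (Suc k) * B (Suc k)"
    using lam by (simp add: b_def powr_divide)
  moreover have "norm ((lam powr \<eta> (Suc k)) *\<^sub>R Q) \<le> lam powr \<eta> (Suc k) * B (Suc k)"
    using Q by (simp add: mult_left_mono)
  ultimately show ?thesis by linarith
qed

lemma norm_suminf_le:
  fixes f :: "nat \<Rightarrow> mat2"
  assumes "\<And>k. norm (f k) \<le> c * b k"
  shows "summable (\<lambda>k. norm (f k))" "norm (suminf f) \<le> c * s"
proof -
  have sb: "summable (\<lambda>k. c * b k)" by (intro summable_mult summable_b)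
  show 1: "summable (\<lambda>k. norm (f k))"
    by (rule summable_comparison_test'[OF sb]) (use assms in auto)
  have "norm (suminf f) \<le> (\<Sum>k. norm (f k))" by (rule summable_norm[OF 1])
  also have "\<dots> \<le> (\<Sum>k. c * b k)" by (rule suminf_le[OF assms 1 sb])
  also have "\<dots> = c * s" unfolding s_def by (rule suminf_mult[OF summable_b])
  finally show "norm (suminf f) \<le> c * s" .
qed

definition X :: "real \<Rightarrow> 's \<Rightarrow> mat2" where
  "X lam \<sigma> = (\<Sum>k. (lam powr \<eta> (Suc k)) *\<^sub>R P (Suc k) \<sigma>)"

context
  fixes lam :: real
  assumes lam: "0 < lam" "lam < lam0"
begin

lemma eta_1_le: "\<eta> 1 \<le> \<eta> (Suc k)"
  using eta_mono[of 1 "Suc k"] by (cases k) auto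

lemma eta_2_le: "\<eta> 2 \<le> \<eta> (Suc (Suc k))"
  using eta_mono[of 2 "Suc (Suc k)"] by (cases k) (auto simp: numeral_2_eq_2)

lemma X_summable:
  assumes "\<sigma> \<in> space M"
  shows "summable (\<lambda>k. norm ((lam powr \<eta> (Suc k)) *\<^sub>R P (Suc k) \<sigma>))"
  by (rule norm_suminf_le[OF term_bound[OF lam eta_1_le PB]]) (use assms in auto)

lemma norm_X_le: "\<sigma> \<in> space M \<Longrightarrow> norm (X lam \<sigma>) \<le> (lam / lam0) powr \<eta> 1 * s"
  unfolding X_def by (rule norm_suminf_le[OF term_bound[OF lam eta_1_le PB]]) auto

lemma norm_P1_le:
  assumes "\<sigma> \<in> space M"
  shows "norm ((lam powr \<eta> 1) *\<^sub>R P 1 \<sigma>) \<le> (lam / lam0) powr \<eta> 1 * s"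
proof -
  have "norm ((lam powr \<eta> (Suc 0)) *\<^sub>R P (Suc 0) \<sigma>) \<le> (lam / lam0) powr \<eta> 1 * b 0"
    by (rule term_bound[OF lam]) (use assms PB in auto)
  also have "b 0 \<le> s"
    unfolding s_def using sum_le_suminf[OF summable_b, of "{0}"] b_nonneg by simp
  finally show ?thesis by (simp add: mult_left_mono)
qed

lemma norm_X_minus_le:
  assumes "\<sigma> \<in> space M"
  shows "norm (X lam \<sigma> - (lam powr \<eta> 1) *\<^sub>R P 1 \<sigma>) \<le> (lam / lam0) powr \<eta> 2 * s"
proof -
  define f where "f k = (if k = 0 then 0 else (lam powr \<eta> (Suc k)) *\<^sub>R P (Suc k) \<sigma>)" for k
  have fb: "norm (f k) \<le> (lam / lam0) powr \<eta> 2 * b k" for k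
  proof (cases k)
    case 0
    thus ?thesis by (simp add: f_def b_nonneg)
  next
    case (Suc j)
    thus ?thesis using term_bound[OF lam, of "\<eta> 2" k "P (Suc k) \<sigma>"] eta_2_le PB[of "Suc k"] assms by (simp add: f_def)
  qed
  have sm: "summable (\<lambda>k. (lam powr \<eta> (Suc k)) *\<^sub>R P (Suc k) \<sigma>)"
    by (rule summable_norm_cancel[OF X_summable[OF assms]])
  have "X lam \<sigma> - (lam powr \<eta> 1) *\<^sub>R P 1 \<sigma> = (\<Sum>k. (lam powr \<eta> (Suc (Suc k))) *\<^sub>R P (Suc (Suc k)) \<sigma>)"
    unfolding X_def using suminf_split_head[OF sm] by simp
  also have "\<dots> = (\<Sum>k. f (Suc k))" by (simp add: f_def)
  also have "\<dots> = suminf f"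
  proof -
    have "f 0 = 0" by (simp add: f_def)
    thus ?thesis using suminf_split_head[OF summable_norm_cancel[OF norm_suminf_le(1)[OF fb]]] by simp
  qed
  finally show ?thesis using norm_suminf_le(2)[OF fb] by simp
qed

lemma X_meas [measurable]: "X lam \<in> borel_measurable M"
proof -
  have [measurable]: "P (Suc k) \<in> borel_measurable M" for k using P_meas by simp
  show ?thesis unfolding X_def by measurable
qed

text \<open>Pointwise the exponent is only of order \<open>\<eta> 1\<close>. In the mean, the terms
  below \<open>K\<close> vanish by the anomaly, each term beyond \<open>K\<close> either vanishes or
  has exponent at least \<open>eta_t\<close>, and index \<open>K\<close> alone remains.\<close>

lemma integral_X:
  "norm ((\<integral>\<sigma>. X lam \<sigma> \<partial>M) - (lam powr \<eta> K) *\<^sub>R (\<integral>\<sigma>. P K \<sigma> \<partial>M)) \<le> (lam / lam0) powr eta_t * s"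
proof -
  have [measurable]: "P (Suc k) \<in> borel_measurable M" for k using P_meas by simp
  have tb: "norm ((lam powr \<eta> (Suc k)) *\<^sub>R P (Suc k) \<sigma>) \<le> (lam / lam0) powr \<eta> 1 * b k"
    if "\<sigma> \<in> space M" for k \<sigma>
    by (rule term_bound[OF lam eta_1_le]) (use that PB in auto)
  have int: "integrable M (\<lambda>\<sigma>. (lam powr \<eta> (Suc k)) *\<^sub>R P (Suc k) \<sigma>)" for k
    by (rule integrable_of_norm_le[OF _ tb]) measurable
  have nI: "(\<integral>\<sigma>. norm ((lam powr \<eta> (Suc k)) *\<^sub>R P (Suc k) \<sigma>) \<partial>M) \<le> (lam / lam0) powr \<eta> 1 * b k" for k
  proof -
    have "norm (\<integral>\<sigma>. norm ((lam powr \<eta> (Suc k)) *\<^sub>R P (Suc k) \<sigma>) \<partial>M) \<le> (lam / lam0) powr \<eta> 1 * b k"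
      by (rule norm_integral_le_const) (use tb in auto)
    thus ?thesis by simp
  qed
  define E where "E k = (\<integral>\<sigma>. P (Suc k) \<sigma> \<partial>M)" for k
  have EB: "norm (E k) \<le> B (Suc k)" for k
    unfolding E_def by (rule norm_integral_le_const) (use PB in auto)
  have "(\<integral>\<sigma>. X lam \<sigma> \<partial>M) = (\<Sum>k. \<integral>\<sigma>. (lam powr \<eta> (Suc k)) *\<^sub>R P (Suc k) \<sigma> \<partial>M)"
    unfolding X_def
  proof (rule integral_suminf[OF int])
    show "AE \<sigma> in M. summable (\<lambda>k. norm ((lam powr \<eta> (Suc k)) *\<^sub>R P (Suc k) \<sigma>))"
      using X_summable by auto
    show "summable (\<lambda>k. \<integral>\<sigma>. norm ((lam powr \<eta> (Suc k)) *\<^sub>R P (Suc k) \<sigma>) \<partial>M)"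
      by (rule summable_comparison_test'[of "\<lambda>k. (lam / lam0) powr \<eta> 1 * b k"])
        (use nI summB in \<open>auto simp: b_def intro: summable_mult\<close>)
  qed
  also have "\<dots> = (\<Sum>k. (lam powr \<eta> (Suc k)) *\<^sub>R E k)" by (simp add: E_def)
  finally have IX: "(\<integral>\<sigma>. X lam \<sigma> \<partial>M) = (\<Sum>k. (lam powr \<eta> (Suc k)) *\<^sub>R E k)" .
  \<comment> \<open>The series starts with \<open>P 1\<close>, so the term of index \<open>K\<close>
    stands at position \<open>K - 1\<close>.\<close>
  define f where "f k = (if k = K - 1 then 0 else (lam powr \<eta> (Suc k)) *\<^sub>R E k)" for k
  define g where "g k = (if k = K - 1 then (lam powr \<eta> K) *\<^sub>R E k else 0)" for k
  have fb: "norm (f k) \<le> (lam / lam0) powr eta_t * b k" for k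
  proof (cases "k = K - 1 \<or> E k = 0")
    case True
    thus ?thesis by (auto simp: f_def b_nonneg)
  next
    case False
    hence "Suc k > K" using anomaly[of "Suc k"] K_ge
      by (cases "Suc k" K rule: linorder_cases) (auto simp: E_def)
    hence "eta_t \<le> \<eta> (Suc k)" using False by (intro eta_t_le_eta) (auto simp: E_def)
    from term_bound[OF lam this EB] show ?thesis using False by (simp add: f_def)
  qed
  have "g sums ((lam powr \<eta> K) *\<^sub>R E (K - 1))"
    unfolding g_def using sums_single[of "K - 1" "\<lambda>k. (lam powr \<eta> K) *\<^sub>R E k"] by simp
  moreover have "f sums suminf f"
    by (rule summable_sums[OF summable_norm_cancel[OF norm_suminf_le(1)[OF fb]]])
  ultimately have "(\<lambda>k. f k + g k) sums (suminf f + (lam powr \<eta> K) *\<^sub>R E (K - 1))"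
    by (intro sums_add)
  moreover have "f k + g k = (lam powr \<eta> (Suc k)) *\<^sub>R E k" for k
    using K_ge by (simp add: f_def g_def)
  ultimately have "(\<Sum>k. (lam powr \<eta> (Suc k)) *\<^sub>R E k) = suminf f + (lam powr \<eta> K) *\<^sub>R E (K - 1)"
    by (simp add: sums_iff)
  moreover have "E (K - 1) = (\<integral>\<sigma>. P K \<sigma> \<partial>M)" using K_ge by (simp add: E_def)
  ultimately show ?thesis using norm_suminf_le(2)[OF fb] IX by simp
qed

lemma X_sl2: "\<sigma> \<in> space M \<Longrightarrow> X lam \<sigma> \<in> sl2"
proof -
  assume \<sigma>: "\<sigma> \<in> space M"
  have "bounded_linear (\<lambda>A::mat2. A $ 1 $ 1 + A $ 2 $ 2)"
  proof (rule bounded_linear_intro[of _ 2])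
    show "norm (A $ 1 $ 1 + A $ 2 $ 2) \<le> norm A * 2" for A :: mat2
      using abs_mat2_entry_le[of A 1 1] abs_mat2_entry_le[of A 2 2] unfolding real_norm_def by linarith
  qed (auto simp: algebra_simps)
  from bounded_linear.suminf[OF this summable_norm_cancel[OF X_summable[OF \<sigma>]]]
  show ?thesis using P_sl[of "Suc _" \<sigma>] \<sigma>
    by (simp add: X_def sl2_def flip: distrib_left)
qed

lemma A_nonzero: "\<sigma> \<in> space M \<Longrightarrow> A lam \<sigma> *v evec \<theta> \<noteq> 0"
proof
  assume \<sigma>: "\<sigma> \<in> space M" and 0: "A lam \<sigma> *v evec \<theta> = 0"
  have "invertible (A lam \<sigma>)" using A_det[OF lam \<sigma>] by (simp add: invertible_det_nz)
  hence "evec \<theta> = 0" using 0 matrix_left_invertible_ker[of "A lam \<sigma>"] unfolding invertible_def by blast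
  thus False using norm_evec[of \<theta>] by simp
qed

lemma random_map_ST: "random_map M (\<lambda>\<sigma>. ST (A lam \<sigma>))"
  using measurable_ST[OF A_meas[OF lam] A_nonzero] by unfold_locales

text \<open>Expectation of the Taylor expansion. The linear term contributes
  \<open>lam powr \<eta> K\<close> times the mean of \<open>pk (P K \<sigma>)\<close>; the quadratic
  terms are evaluated on \<open>lam powr \<eta> 1\<close> times \<open>P 1\<close>, and the squared
  prefactor is again \<open>lam powr \<eta> K\<close> because
  \<open>\<eta> K = 2 * \<eta> 1\<close>. Pulling out the Taylor factor 1/2 explains the 2 in
  \<open>q\<close>.\<close>

lemma one_step:
  fixes F F1 F2 F3 :: "real \<Rightarrow> real"
  assumes F: "pi_periodic F"
    and dF: "\<And>x. (F has_real_derivative F1 x) (at x)" "\<And>x. (F1 has_real_derivative F2 x) (at x)"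
      "\<And>x. (F2 has_real_derivative F3 x) (at x)"
    and D: "\<And>x. \<bar>F1 x\<bar> \<le> D" "\<And>x. \<bar>F2 x\<bar> \<le> D" "\<And>x. \<bar>F3 x\<bar> \<le> D"
  shows "\<bar>(\<integral>\<sigma>. F (ST (A lam \<sigma>) \<theta>) \<partial>M) - F \<theta> - lam powr \<eta> K / 2 * (p \<theta> * F2 \<theta> + q \<theta> * F1 \<theta>)\<bar>
    \<le> (50 * s ^ 3 + 21 * s\<^sup>2 + 3 * s) * D * (lam / lam0) powr eta_t"
proof -
  interpret R: random_map M "\<lambda>\<sigma>. ST (A lam \<sigma>)" by (rule random_map_ST)
  define y where "y = lam / lam0"
  have y: "0 < y" "y < 1" using lam by (simp_all add: y_def)
  have D0: "D \<ge> 0" using D(1)[of 0] by linarith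
  have yle: "y powr e \<le> y powr eta_t" if "eta_t \<le> e" for e using y that by (intro powr_mono') auto
  define l where "l = lam powr \<eta> 1"
  have l0: "l > 0" using lam by (simp add: l_def)
  have l2: "lam powr \<eta> K = l * l" by (simp add: l_def eta_K flip: powr_add)
  have [measurable]: "P 1 \<in> borel_measurable M" "P K \<in> borel_measurable M" using P_meas K_ge by auto
  define pX where "pX \<sigma> = pk (X lam \<sigma>) \<theta>" for \<sigma>
  define dX where "dX \<sigma> = dpk (X lam \<sigma>) \<theta>" for \<sigma>
  define p1 where "p1 \<sigma> = pk (P 1 \<sigma>) \<theta>" for \<sigma>
  define d1 where "d1 \<sigma> = dpk (P 1 \<sigma>) \<theta>" for \<sigma>
  have [measurable]: "pX \<in> borel_measurable M" "dX \<in> borel_measurable M"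
    "p1 \<in> borel_measurable M" "d1 \<in> borel_measurable M"
    unfolding pX_def dX_def p1_def d1_def by measurable
  define y1 where "y1 = y powr \<eta> 1 * s"
  define y2 where "y2 = y powr \<eta> 2 * s"
  have y12: "y1 \<ge> 0" "y2 \<ge> 0" using s_nonneg by (simp_all add: y1_def y2_def)
  have pXb: "\<bar>pX \<sigma>\<bar> \<le> 3 * y1" if "\<sigma> \<in> space M" for \<sigma>
    using abs_pk_le[of "X lam \<sigma>" \<theta>] norm_X_le[OF that] by (simp add: pX_def y1_def y_def)
  have p1b: "\<bar>l * p1 \<sigma>\<bar> \<le> 3 * y1" "\<bar>l * d1 \<sigma>\<bar> \<le> 4 * y1" if "\<sigma> \<in> space M" for \<sigma>
    using abs_pk_le[of "l *\<^sub>R P 1 \<sigma>" \<theta>] abs_dpk_le[of "l *\<^sub>R P 1 \<sigma>" \<theta>] norm_P1_le[OF that]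
    by (simp_all only: p1_def d1_def y1_def y_def l_def pk_scaleR dpk_scaleR)
  have difb: "\<bar>pX \<sigma> - l * p1 \<sigma>\<bar> \<le> 3 * y2" "\<bar>dX \<sigma> - l * d1 \<sigma>\<bar> \<le> 4 * y2" if "\<sigma> \<in> space M" for \<sigma>
    using abs_pk_le[of "X lam \<sigma> - l *\<^sub>R P 1 \<sigma>" \<theta>] abs_dpk_le[of "X lam \<sigma> - l *\<^sub>R P 1 \<sigma>" \<theta>]
      norm_X_minus_le[OF that]
    by (simp_all only: pX_def dX_def p1_def d1_def y2_def y_def l_def pk_scaleR dpk_scaleR pk_diff dpk_diff)
  \<comment> \<open>\<open>G\<close> keeps the full exponent in the linear term, which becomes small
    only after taking expectations, and just \<open>P 1\<close> in the quadratic terms, where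
    pointwise size suffices.\<close>
  define G where "G \<sigma> = F \<theta> + pX \<sigma> * F1 \<theta> + l * l / 2 * (p1 \<sigma> * d1 \<sigma> * F1 \<theta> + (p1 \<sigma>)\<^sup>2 * F2 \<theta>)" for \<sigma>
  \<comment> \<open>The two orders to be absorbed: the cubic remainder with exponent
    \<open>3 * \<eta> 1\<close>, and the product of the \<open>P 1\<close> term with the rest of the
    series, with exponent \<open>\<eta> 1 + \<eta> 2\<close>.\<close>
  have y123: "y1 ^ 3 \<le> s ^ 3 * y powr eta_t" "y1 * y2 \<le> s\<^sup>2 * y powr eta_t"
  proof -
    have "y1 ^ 3 = s ^ 3 * y powr (3 * \<eta> 1)"
      using y by (simp add: y1_def power_mult_distrib powr_power mult.commute)
    moreover have "eta_t \<le> 3 * \<eta> 1" using eta_t_le eta_2 by simp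
    ultimately show "y1 ^ 3 \<le> s ^ 3 * y powr eta_t"
      using yle s_nonneg by (simp add: mult_left_mono)
    have "y1 * y2 = s\<^sup>2 * y powr (\<eta> 1 + \<eta> 2)"
      by (simp add: y1_def y2_def powr_add power2_eq_square)
    thus "y1 * y2 \<le> s\<^sup>2 * y powr eta_t"
      using yle[OF eta_t_le] by (simp add: mult_left_mono)
  qed
  \<comment> \<open>\<open>21 = 24 / 2 + 18 / 2\<close> collects the replacement errors in the two
    quadratic terms.\<close>
  define c where "c = (50 * s ^ 3 + 21 * s\<^sup>2) * D * y powr eta_t"
  have main: "\<bar>F (ST (A lam \<sigma>) \<theta>) - G \<sigma>\<bar> \<le> c" if \<sigma>: "\<sigma> \<in> space M" for \<sigma>
  proof -
    have "\<bar>F (ST (A lam \<sigma>) \<theta>) - (F \<theta> + pX \<sigma> * F1 \<theta> + (pX \<sigma> * dX \<sigma> * F1 \<theta> + (pX \<sigma>)\<^sup>2 * F2 \<theta>) / 2)\<bar>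
        \<le> 50 * norm (X lam \<sigma>) ^ 3 * D"
      unfolding pX_def dX_def
      by (rule ST_mexp_expansion[OF X_sl2[OF \<sigma>] _ F dF D]) (use A_exp[OF lam \<sigma>] in \<open>simp add: X_def\<close>)
    also have "\<dots> \<le> 50 * (s ^ 3 * y powr eta_t) * D"
    proof -
      have "norm (X lam \<sigma>) ^ 3 \<le> y1 ^ 3"
        using norm_X_le[OF \<sigma>] by (intro power_mono) (auto simp: y1_def y_def)
      hence "norm (X lam \<sigma>) ^ 3 \<le> s ^ 3 * y powr eta_t" using y123 by linarith
      thus ?thesis using D0 by (intro mult_right_mono) auto
    qed
    finally have 1: "\<bar>F (ST (A lam \<sigma>) \<theta>) - (F \<theta> + pX \<sigma> * F1 \<theta> + (pX \<sigma> * dX \<sigma> * F1 \<theta> + (pX \<sigma>)\<^sup>2 * F2 \<theta>) / 2)\<bar>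
        \<le> 50 * (s ^ 3 * y powr eta_t) * D" .
    have "\<bar>pX \<sigma> * dX \<sigma> - (l * p1 \<sigma>) * (l * d1 \<sigma>)\<bar> \<le> 3 * y1 * (4 * y2) + 3 * y2 * (4 * y1)"
      by (rule mult_diff_bound[OF pXb[OF \<sigma>] p1b(2)[OF \<sigma>] difb(2)[OF \<sigma>] difb(1)[OF \<sigma>]])
    hence "\<bar>pX \<sigma> * dX \<sigma> - (l * p1 \<sigma>) * (l * d1 \<sigma>)\<bar> \<le> 24 * (s\<^sup>2 * y powr eta_t)"
      using y123(2) by (simp add: mult.commute)
    hence 2: "\<bar>(pX \<sigma> * dX \<sigma> - (l * p1 \<sigma>) * (l * d1 \<sigma>)) * F1 \<theta>\<bar> \<le> 24 * (s\<^sup>2 * y powr eta_t) * D"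
      unfolding abs_mult using D by (intro mult_mono) auto
    have "\<bar>pX \<sigma> * pX \<sigma> - (l * p1 \<sigma>) * (l * p1 \<sigma>)\<bar> \<le> 3 * y1 * (3 * y2) + 3 * y2 * (3 * y1)"
      by (rule mult_diff_bound[OF pXb[OF \<sigma>] p1b(1)[OF \<sigma>] difb(1)[OF \<sigma>] difb(1)[OF \<sigma>]])
    hence "\<bar>pX \<sigma> * pX \<sigma> - (l * p1 \<sigma>) * (l * p1 \<sigma>)\<bar> \<le> 18 * (s\<^sup>2 * y powr eta_t)"
      using y123(2) by (simp add: mult.commute)
    hence 3: "\<bar>(pX \<sigma> * pX \<sigma> - (l * p1 \<sigma>) * (l * p1 \<sigma>)) * F2 \<theta>\<bar> \<le> 18 * (s\<^sup>2 * y powr eta_t) * D"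
      unfolding abs_mult using D by (intro mult_mono) auto
    have "F (ST (A lam \<sigma>) \<theta>) - G \<sigma> =
       (F (ST (A lam \<sigma>) \<theta>) - (F \<theta> + pX \<sigma> * F1 \<theta> + (pX \<sigma> * dX \<sigma> * F1 \<theta> + (pX \<sigma>)\<^sup>2 * F2 \<theta>) / 2))
       + ((pX \<sigma> * dX \<sigma> - (l * p1 \<sigma>) * (l * d1 \<sigma>)) * F1 \<theta>) / 2
       + ((pX \<sigma> * pX \<sigma> - (l * p1 \<sigma>) * (l * p1 \<sigma>)) * F2 \<theta>) / 2"
      by (simp add: G_def field_simps power2_eq_square)
    moreover have "c = 50 * (s ^ 3 * y powr eta_t) * D + 24 * (s\<^sup>2 * y powr eta_t) * D / 2 + 18 * (s\<^sup>2 * y powr eta_t) * D / 2"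
      by (simp add: c_def algebra_simps)
    ultimately show ?thesis using 1 2 3 by linarith
  qed
  have Fc: "continuous_on UNIV F" by (rule has_real_derivative_imp_continuous_on[OF dF(1)])
  obtain BF where BF: "\<And>x. \<bar>F x\<bar> \<le> BF" using pi_periodic_bounded[OF F Fc] by blast
  have [measurable]: "F \<in> borel_measurable borel" by (rule borel_measurable_continuous_onI[OF Fc])
  have intF: "integrable M (\<lambda>\<sigma>. F (ST (A lam \<sigma>) \<theta>))"
    by (rule integrable_of_norm_le[of _ BF]) (use BF in auto)
  have P1b: "\<bar>p1 \<sigma>\<bar> \<le> 3 * B 1" "\<bar>d1 \<sigma>\<bar> \<le> 4 * B 1" if "\<sigma> \<in> space M" for \<sigma>
    using abs_pk_le[of "P 1 \<sigma>" \<theta>] abs_dpk_le[of "P 1 \<sigma>" \<theta>] PB[of 1 \<sigma>] that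
    by (simp_all add: p1_def d1_def)
  have prodb: "\<bar>u * v\<bar> \<le> a * a'" if "\<bar>u\<bar> \<le> a" "\<bar>v\<bar> \<le> a'" for u v a a' :: real
    unfolding abs_mult using that by (intro mult_mono) auto
  have intX: "integrable M (X lam)"
    by (rule integrable_of_norm_le[OF X_meas norm_X_le])
  have intPK: "integrable M (P K)"
    by (rule integrable_of_norm_le[of _ "B K"]) (use PB K_ge in auto)
  have int1: "integrable M pX" "integrable M (\<lambda>\<sigma>. p1 \<sigma> * d1 \<sigma>)" "integrable M (\<lambda>\<sigma>. (p1 \<sigma>)\<^sup>2)"
  proof -
    show "integrable M pX" by (rule integrable_of_norm_le[of _ "3 * y1"]) (use pXb in auto)
    show "integrable M (\<lambda>\<sigma>. p1 \<sigma> * d1 \<sigma>)"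
      by (rule integrable_of_norm_le[of _ "3 * B 1 * (4 * B 1)"])
        (use prodb P1b in \<open>auto simp only: real_norm_def intro!: borel_measurable_times\<close>, measurable)
    show "integrable M (\<lambda>\<sigma>. (p1 \<sigma>)\<^sup>2)"
      unfolding power2_eq_square
      by (rule integrable_of_norm_le[of _ "3 * B 1 * (3 * B 1)"])
        (use prodb P1b in \<open>auto simp only: real_norm_def intro!: borel_measurable_times\<close>, measurable)
  qed
  have intG: "integrable M G" unfolding G_def using int1 by auto
  have "\<bar>(\<integral>\<sigma>. F (ST (A lam \<sigma>) \<theta>) \<partial>M) - (\<integral>\<sigma>. G \<sigma> \<partial>M)\<bar> \<le> c"
  proof -
    have "(\<integral>\<sigma>. F (ST (A lam \<sigma>) \<theta>) \<partial>M) - (\<integral>\<sigma>. G \<sigma> \<partial>M) = (\<integral>\<sigma>. F (ST (A lam \<sigma>) \<theta>) - G \<sigma> \<partial>M)"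
      using intF intG by simp
    also have "\<bar>\<dots>\<bar> \<le> c" using intF intG main by (intro R.abs_integral_le_const) auto
    finally show ?thesis .
  qed
  moreover have EG: "(\<integral>\<sigma>. G \<sigma> \<partial>M) = F \<theta> + (\<integral>\<sigma>. pX \<sigma> \<partial>M) * F1 \<theta>
     + l * l / 2 * ((\<integral>\<sigma>. p1 \<sigma> * d1 \<sigma> \<partial>M) * F1 \<theta> + p \<theta> * F2 \<theta>)"
    unfolding G_def p_def using int1 by (simp add: prob_space p1_def)
  moreover have "\<bar>((\<integral>\<sigma>. pX \<sigma> \<partial>M) - l * l * (\<integral>\<sigma>. pk (P K \<sigma>) \<theta> \<partial>M)) * F1 \<theta>\<bar> \<le> 3 * (y powr eta_t * s) * D"
  proof -
    have "(\<integral>\<sigma>. pX \<sigma> \<partial>M) = pk (\<integral>\<sigma>. X lam \<sigma> \<partial>M) \<theta>" "(\<integral>\<sigma>. pk (P K \<sigma>) \<theta> \<partial>M) = pk (\<integral>\<sigma>. P K \<sigma> \<partial>M) \<theta>"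
      unfolding pX_def using integral_bounded_linear[OF bounded_linear_pk] intX intPK by auto
    hence "(\<integral>\<sigma>. pX \<sigma> \<partial>M) - l * l * (\<integral>\<sigma>. pk (P K \<sigma>) \<theta> \<partial>M)
       = pk ((\<integral>\<sigma>. X lam \<sigma> \<partial>M) - (lam powr \<eta> K) *\<^sub>R (\<integral>\<sigma>. P K \<sigma> \<partial>M)) \<theta>"
      by (simp add: pk_diff pk_scaleR l2)
    also have "\<bar>\<dots>\<bar> \<le> 3 * (y powr eta_t * s)"
      using abs_pk_le integral_X unfolding y_def by (meson mult_left_mono order_trans zero_le_numeral)
    finally show ?thesis using D by (intro prodb)
  qed
  moreover have "(\<integral>\<sigma>. G \<sigma> \<partial>M) - F \<theta> - lam powr \<eta> K / 2 * (p \<theta> * F2 \<theta> + q \<theta> * F1 \<theta>)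
     = ((\<integral>\<sigma>. pX \<sigma> \<partial>M) - l * l * (\<integral>\<sigma>. pk (P K \<sigma>) \<theta> \<partial>M)) * F1 \<theta>"
    unfolding EG l2 q_def p1_def d1_def by (simp add: field_simps)
  moreover have "(50 * s ^ 3 + 21 * s\<^sup>2 + 3 * s) * D * (lam / lam0) powr eta_t = c + 3 * (y powr eta_t * s) * D"
    by (simp add: c_def y_def algebra_simps)
  ultimately show ?thesis by linarith
qed

end

end

subsection \<open>Correctors and ergodic averages\<close>

lemma C2_circI:
  assumes "pi_periodic f" "\<And>x. (f has_real_derivative f1 x) (at x)"
    "\<And>x. (f1 has_real_derivative f2 x) (at x)" "continuous_on UNIV f2"
  shows "C2_circ f"
  unfolding C2_circ_def using assms by blast

lemma C2_circ_const: "C2_circ (\<lambda>_. c)"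
  unfolding C2_circ_def pi_periodic_def
  by (intro conjI exI[of _ "\<lambda>_. 0"]) auto

lemma C2_circ_add:
  assumes "C2_circ f" "C2_circ g"
  shows "C2_circ (\<lambda>x. f x + g x)"
proof -
  from assms obtain f1 f2 g1 g2 where
    "\<And>x. (f has_real_derivative f1 x) (at x)" "\<And>x. (f1 has_real_derivative f2 x) (at x)" "continuous_on UNIV f2"
    "\<And>x. (g has_real_derivative g1 x) (at x)" "\<And>x. (g1 has_real_derivative g2 x) (at x)" "continuous_on UNIV g2"
    "pi_periodic f" "pi_periodic g"
    unfolding C2_circ_def by blast
  thus ?thesis unfolding C2_circ_def
    by (intro conjI exI[of _ "\<lambda>x. f1 x + g1 x"] exI[of _ "\<lambda>x. f2 x + g2 x"])
      (auto simp: pi_periodic_def intro!: continuous_intros derivative_eq_intros)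
qed

lemma C2_circ_mult:
  assumes "C2_circ f" "C2_circ g"
  shows "C2_circ (\<lambda>x. f x * g x)"
proof -
  from assms obtain f1 f2 g1 g2 where
    f: "\<And>x. (f has_real_derivative f1 x) (at x)" "\<And>x. (f1 has_real_derivative f2 x) (at x)" "continuous_on UNIV f2" and
    g: "\<And>x. (g has_real_derivative g1 x) (at x)" "\<And>x. (g1 has_real_derivative g2 x) (at x)" "continuous_on UNIV g2" and
    per: "pi_periodic f" "pi_periodic g"
    unfolding C2_circ_def by blast
  note c = has_real_derivative_imp_continuous_on[OF f(1)] has_real_derivative_imp_continuous_on[OF f(2)]
    has_real_derivative_imp_continuous_on[OF g(1)] has_real_derivative_imp_continuous_on[OF g(2)]
  have "((\<lambda>x. f x * g x) has_real_derivative f1 x * g x + f x * g1 x) (at x)" for x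
    by (rule derivative_eq_intros f g refl | simp)+
  moreover have "((\<lambda>x. f1 x * g x + f x * g1 x) has_real_derivative f2 x * g x + 2 * (f1 x * g1 x) + f x * g2 x) (at x)" for x
    by (rule derivative_eq_intros f g refl | simp)+
  moreover have "continuous_on UNIV (\<lambda>x. f2 x * g x + 2 * (f1 x * g1 x) + f x * g2 x)"
    by (intro continuous_intros c f(3) g(3))
  moreover have "pi_periodic (\<lambda>x. f x * g x)" using per by (simp add: pi_periodic_def)
  ultimately show ?thesis by (rule C2_circI[rotated])
qed

lemma C2_circ_trig: "C2_circ (\<lambda>x. cos (2 * x))" "C2_circ (\<lambda>x. sin (2 * x))"
proof -
  have per: "cos (2 * (x + pi)) = cos (2 * x)" "sin (2 * (x + pi)) = sin (2 * x)" for x :: real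
    using cos_periodic[of "2 * x"] sin_periodic[of "2 * x"] by (simp_all add: distrib_left)
  show "C2_circ (\<lambda>x. cos (2 * x))"
    by (rule C2_circI[of _ "\<lambda>x. - 2 * sin (2 * x)" "\<lambda>x. - 4 * cos (2 * x)"])
      (auto simp: pi_periodic_def per intro!: derivative_eq_intros continuous_intros)
  show "C2_circ (\<lambda>x. sin (2 * x))"
    by (rule C2_circI[of _ "\<lambda>x. 2 * cos (2 * x)" "\<lambda>x. - 4 * sin (2 * x)"])
      (auto simp: pi_periodic_def per intro!: derivative_eq_intros continuous_intros)
qed

lemma C2_circ_cos_sin_squared: "C2_circ (\<lambda>x. (cos x)\<^sup>2)" "C2_circ (\<lambda>x. (sin x)\<^sup>2)"
proof -
  have c: "(cos x)\<^sup>2 = 1 / 2 + 1 / 2 * cos (2 * x)" for x :: real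
    unfolding cos_double_cos by (simp add: field_simps)
  have s: "(sin x)\<^sup>2 = 1 / 2 + - 1 / 2 * cos (2 * x)" for x :: real
    unfolding cos_double_sin by (simp add: field_simps)
  show "C2_circ (\<lambda>x. (cos x)\<^sup>2)" "C2_circ (\<lambda>x. (sin x)\<^sup>2)"
    unfolding c s by (intro C2_circ_add C2_circ_mult C2_circ_const C2_circ_trig)+
qed

lemma C2_circ_pk: "C2_circ (pk P)"
proof -
  have eq: "pk P = (\<lambda>\<theta>. P $ 2 $ 1 * (cos \<theta>)\<^sup>2 + (- P $ 1 $ 2) * (sin \<theta>)\<^sup>2 + (- P $ 1 $ 1) * sin (2 * \<theta>))"
    by (simp add: pk_def fun_eq_iff)
  show ?thesis unfolding eq
    by (intro C2_circ_add C2_circ_mult C2_circ_const C2_circ_trig C2_circ_cos_sin_squared)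
qed

lemma C2_circ_bounds:
  assumes "C2_circ f"
  obtains f1 f2 B where "pi_periodic f" "\<And>x. (f has_real_derivative f1 x) (at x)"
    "\<And>x. (f1 has_real_derivative f2 x) (at x)" "\<And>x. \<bar>f x\<bar> \<le> B" "\<And>x. \<bar>f1 x\<bar> \<le> B" "\<And>x. \<bar>f2 x\<bar> \<le> B"
proof -
  from assms obtain f1 f2 where f: "pi_periodic f" "\<And>x. (f has_real_derivative f1 x) (at x)"
    "\<And>x. (f1 has_real_derivative f2 x) (at x)" "continuous_on UNIV f2"
    unfolding C2_circ_def by blast
  have per: "pi_periodic f1" "pi_periodic f2" using pi_periodic_deriv f by blast+
  obtain B0 where B0: "\<And>x. \<bar>f x\<bar> \<le> B0"
    using pi_periodic_bounded[OF f(1) has_real_derivative_imp_continuous_on[OF f(2)]] by blast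
  obtain B1 where B1: "\<And>x. \<bar>f1 x\<bar> \<le> B1"
    using pi_periodic_bounded[OF per(1) has_real_derivative_imp_continuous_on[OF f(3)]] by blast
  obtain B2 where B2: "\<And>x. \<bar>f2 x\<bar> \<le> B2" using pi_periodic_bounded[OF per(2) f(4)] by blast
  show ?thesis
    using that[OF f(1-3), of "max B0 (max B1 B2)"] B0 B1 B2 by (meson le_max_iff_disj)
qed

lemma C2_circ_imp_C1_circ: "C2_circ f \<Longrightarrow> C1_circ f"
  unfolding C1_circ_def C2_circ_def using has_real_derivative_imp_continuous_on by metis

text \<open>\<open>pk P \<theta>\<close> vanishes exactly when \<open>evec \<theta>\<close> is an
  eigenvector, and a traceless matrix with three eigendirections is 0. In formulas,
  \<open>pk P\<close> is affine in the cosine and sine of the double angle, and its differences at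
  the zeros give two linear equations for \<open>\<beta>\<close> and \<open>a\<close> with
  determinant \<open>sin (y - z)\<close>.\<close>

lemma sl2_pk_three_zeros:
  assumes "P \<in> sl2" "pk P x = 0" "pk P y = 0" "pk P z = 0"
    and "sin (x - y) \<noteq> 0" "sin (x - z) \<noteq> 0" "sin (y - z) \<noteq> 0"
  shows "P = 0"
proof -
  define \<alpha> \<beta> a where "\<alpha> = (P $ 2 $ 1 - P $ 1 $ 2) / 2" and "\<beta> = (P $ 2 $ 1 + P $ 1 $ 2) / 2" and "a = P $ 1 $ 1"
  have pk: "pk P t = \<alpha> + \<beta> * cos (2 * t) - a * sin (2 * t)" for t
  proof -
    have e: "(cos t)\<^sup>2 = (1 + cos (2 * t)) / 2" "(sin t)\<^sup>2 = (1 - cos (2 * t)) / 2"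
      using cos_double_cos[of t] cos_double_sin[of t] by simp_all
    show ?thesis unfolding pk_def e by (simp add: \<alpha>_def \<beta>_def a_def field_simps)
  qed
  have diff: "pk P s - pk P t = - 2 * sin (s - t) * (\<beta> * sin (s + t) + a * cos (s + t))" for s t
  proof -
    have st: "(s + t) + (s - t) = 2 * s" "(s + t) - (s - t) = 2 * t" by simp_all
    have "cos (u + v) - cos (u - v) = - 2 * sin u * sin v" "sin (u + v) - sin (u - v) = 2 * sin v * cos u" for u v :: real
      by (simp_all add: cos_add cos_diff sin_add sin_diff)
    from this[of "s + t" "s - t", unfolded st]
    have c: "cos (2 * s) - cos (2 * t) = - 2 * sin (s + t) * sin (s - t)"
      and d: "sin (2 * s) - sin (2 * t) = 2 * sin (s - t) * cos (s + t)" .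
    have "pk P s - pk P t = \<beta> * (cos (2 * s) - cos (2 * t)) - a * (sin (2 * s) - sin (2 * t))"
      by (simp add: pk algebra_simps)
    thus ?thesis unfolding c d by (simp add: algebra_simps)
  qed
  have 1: "\<beta> * sin (x + y) + a * cos (x + y) = 0" using diff[of x y] assms by simp
  have 2: "\<beta> * sin (x + z) + a * cos (x + z) = 0" using diff[of x z] assms by simp
  have s: "sin (y - z) = sin (x + y) * cos (x + z) - cos (x + y) * sin (x + z)"
    using sin_diff[of "x + y" "x + z"] by simp
  have "\<beta> * sin (y - z) = (\<beta> * sin (x + y) + a * cos (x + y)) * cos (x + z) - (\<beta> * sin (x + z) + a * cos (x + z)) * cos (x + y)"
    "a * sin (y - z) = (\<beta> * sin (x + z) + a * cos (x + z)) * sin (x + y) - (\<beta> * sin (x + y) + a * cos (x + y)) * sin (x + z)"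
    unfolding s by (simp_all add: algebra_simps)
  hence "\<beta> * sin (y - z) = 0" "a * sin (y - z) = 0" unfolding 1 2 by simp_all
  hence "\<beta> = 0" "a = 0" using assms by simp_all
  moreover from this have "\<alpha> = 0" using pk[of x] assms by simp
  ultimately have "P $ 1 $ 1 = 0" "P $ 1 $ 2 = 0" "P $ 2 $ 1 = 0" "P $ 2 $ 2 = 0"
    using assms(1) by (simp_all add: \<alpha>_def \<beta>_def a_def sl2_def)
  thus ?thesis by (simp add: vec_eq_iff forall_2)
qed

text \<open>Duality: \<open>p * \<rho> * G - C * F\<close> is periodic with derivative
  \<open>\<rho> * (p * H + q * G)\<close>, so \<open>\<rho>\<close> annihilates the range of the
  operator. The constant \<open>C\<close> of the groundstate equation does no harm because
  \<open>F\<close>, and not merely \<open>G\<close>, is periodic. As \<open>\<rho>\<close> is a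
  probability density, a uniform defect \<open>\<epsilon>\<close> moves \<open>c\<close> by at most
  \<open>\<epsilon>\<close>. Only the product \<open>p * \<rho>\<close> gets differentiated, since
  \<open>\<rho>\<close> itself is merely continuous.\<close>

lemma groundstate_average:
  assumes gs: "groundstate p q \<rho>" and nonneg: "\<And>x. \<rho> x \<ge> 0" and cont: "continuous_on UNIV \<rho>"
    and p: "pi_periodic p"
    and F: "pi_periodic F" "\<And>x. (F has_real_derivative G x) (at x)" "\<And>x. (G has_real_derivative H x) (at x)"
    and fc: "continuous_on UNIV f" and eq: "\<And>x. \<bar>p x * H x + q x * G x - (f x - c)\<bar> \<le> \<epsilon>"
  shows "\<bar>c - integral {0..pi} (\<lambda>x. f x * \<rho> x)\<bar> \<le> \<epsilon>"
proof -
  obtain C where C: "\<And>x. ((\<lambda>t. p t * \<rho> t) has_real_derivative q x * \<rho> x + C) (at x)"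
    and \<rho>: "pi_periodic \<rho>" "\<rho> integrable_on {0..pi}" "integral {0..pi} \<rho> = 1"
    using gs unfolding groundstate_def by blast
  have Gper: "pi_periodic G" using pi_periodic_deriv F by blast
  define W where "W x = \<rho> x * (p x * H x + q x * G x)" for x
  have dV: "((\<lambda>x. p x * \<rho> x * G x - C * F x) has_real_derivative W x) (at x)" for x
    by (rule derivative_eq_intros C F refl | simp add: W_def algebra_simps)+
  have "(W has_integral (p pi * \<rho> pi * G pi - C * F pi) - (p 0 * \<rho> 0 * G 0 - C * F 0)) {0..pi}"
    by (rule fundamental_theorem_of_calculus)
      (auto intro: has_field_derivative_at_within dV simp flip: has_real_derivative_iff_has_vector_derivative)
  moreover have "p pi = p 0" "\<rho> pi = \<rho> 0" "G pi = G 0" "F pi = F 0"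
    using p \<rho>(1) Gper F(1) unfolding pi_periodic_def by (metis add_0)+
  ultimately have W: "(W has_integral 0) {0..pi}" by simp
  have f\<rho>: "(\<lambda>x. f x * \<rho> x) integrable_on {0..pi}"
    by (intro integrable_continuous_real continuous_intros continuous_on_subset[OF fc] continuous_on_subset[OF cont]) auto
  have "((\<lambda>x. W x - (f x * \<rho> x - c * \<rho> x)) has_integral 0 - (integral {0..pi} (\<lambda>x. f x * \<rho> x) - c * 1)) {0..pi}"
    using \<rho> by (intro has_integral_diff W integrable_integral[OF f\<rho>] has_integral_mult_right)
      (use integrable_integral[OF \<rho>(2)] in simp)
  hence int: "((\<lambda>x. W x - (f x * \<rho> x - c * \<rho> x)) has_integral c - integral {0..pi} (\<lambda>x. f x * \<rho> x)) {0..pi}" by simp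
  have "norm (integral {0..pi} (\<lambda>x. W x - (f x * \<rho> x - c * \<rho> x))) \<le> integral {0..pi} (\<lambda>x. \<epsilon> * \<rho> x)"
  proof (rule integral_norm_bound_integral)
    show "(\<lambda>x. \<epsilon> * \<rho> x) integrable_on {0..pi}" using \<rho>(2) by (simp add: integrable_on_mult_right)
    show "norm (W x - (f x * \<rho> x - c * \<rho> x)) \<le> \<epsilon> * \<rho> x" for x
    proof -
      have "W x - (f x * \<rho> x - c * \<rho> x) = (p x * H x + q x * G x - (f x - c)) * \<rho> x"
        by (simp add: W_def algebra_simps)
      thus ?thesis using eq[of x] nonneg[of x] by (simp add: abs_mult mult_right_mono)
    qed
  qed (use int in blast)
  thus ?thesis using int \<rho> by (simp add: integral_unique)
qed

text \<open>The order of quantifiers is the point: \<open>D\<close> is chosen before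
  \<open>\<epsilon>\<close>, while \<open>F\<close> and the constant \<open>c\<close> may depend on
  \<open>\<epsilon>\<close>.\<close>

definition correctable :: "(real \<Rightarrow> real) \<Rightarrow> (real \<Rightarrow> real) \<Rightarrow> (real \<Rightarrow> real) \<Rightarrow> bool" where
  "correctable p q f \<longleftrightarrow> (\<exists>D. \<forall>\<epsilon>>0. \<exists>F F1 F2 F3 c. pi_periodic F \<and>
    (\<forall>x. (F has_real_derivative F1 x) (at x)) \<and> (\<forall>x. (F1 has_real_derivative F2 x) (at x)) \<and>
    (\<forall>x. (F2 has_real_derivative F3 x) (at x)) \<and>
    (\<forall>x. \<bar>F x\<bar> \<le> D \<and> \<bar>F1 x\<bar> \<le> D \<and> \<bar>F2 x\<bar> \<le> D \<and> \<bar>F3 x\<bar> \<le> D) \<and>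
    (\<forall>x. \<bar>p x * F2 x + q x * F1 x - (f x - c)\<bar> \<le> \<epsilon>))"

text \<open>Bounds on the derivatives suffice: after subtracting \<open>F 0\<close>, the function is
  bounded by its slope times one period, and \<open>pi < 4\<close>.\<close>

lemma correctableI:
  assumes "\<And>\<epsilon>. \<epsilon> > 0 \<Longrightarrow> \<exists>F F1 F2 F3 c. pi_periodic F \<and>
    (\<forall>x. (F has_real_derivative F1 x) (at x)) \<and> (\<forall>x. (F1 has_real_derivative F2 x) (at x)) \<and>
    (\<forall>x. (F2 has_real_derivative F3 x) (at x)) \<and>
    (\<forall>x. \<bar>F1 x\<bar> \<le> D \<and> \<bar>F2 x\<bar> \<le> D \<and> \<bar>F3 x\<bar> \<le> D) \<and>
    (\<forall>x. \<bar>p x * F2 x + q x * F1 x - (f x - c)\<bar> \<le> \<epsilon>)"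
  shows "correctable p q f"
  unfolding correctable_def
proof (intro exI[of _ "4 * D"] allI impI)
  fix \<epsilon> :: real assume "\<epsilon> > 0"
  then obtain F F1 F2 F3 c where F: "pi_periodic F" "\<And>x. (F has_real_derivative F1 x) (at x)"
    "\<And>x. (F1 has_real_derivative F2 x) (at x)" "\<And>x. (F2 has_real_derivative F3 x) (at x)"
    and b: "\<And>x. \<bar>F1 x\<bar> \<le> D" "\<And>x. \<bar>F2 x\<bar> \<le> D" "\<And>x. \<bar>F3 x\<bar> \<le> D"
    and eq: "\<And>x. \<bar>p x * F2 x + q x * F1 x - (f x - c)\<bar> \<le> \<epsilon>"
    using assms by metis
  have D: "D \<ge> 0" using b(1)[of 0] by linarith
  have "\<bar>F x - F 0\<bar> \<le> 4 * D" for x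
  proof -
    obtain y where y: "0 \<le> y" "y < 0 + pi" "F x = F y" using pi_periodic_range[OF F(1)] by blast
    have "\<bar>F y - F 0\<bar> \<le> D * \<bar>y - 0\<bar>" by (rule derivative_bound_imp_lipschitz[OF F(2) b(1)])
    also have "\<dots> \<le> D * 4" using y D pi_less_4 by (intro mult_left_mono) auto
    finally show ?thesis using y by simp
  qed
  moreover have "pi_periodic (\<lambda>x. F x - F 0)" using F(1) by (simp add: pi_periodic_def)
  moreover have "((\<lambda>x. F x - F 0) has_real_derivative F1 x) (at x)" for x
    using F(2)[of x] by (auto intro!: derivative_eq_intros)
  moreover have "\<bar>F1 x\<bar> \<le> 4 * D" "\<bar>F2 x\<bar> \<le> 4 * D" "\<bar>F3 x\<bar> \<le> 4 * D" for x
    using b(1)[of x] b(2)[of x] b(3)[of x] D by linarith+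
  ultimately show "\<exists>F F1 F2 F3 c. pi_periodic F \<and>
    (\<forall>x. (F has_real_derivative F1 x) (at x)) \<and> (\<forall>x. (F1 has_real_derivative F2 x) (at x)) \<and>
    (\<forall>x. (F2 has_real_derivative F3 x) (at x)) \<and>
    (\<forall>x. \<bar>F x\<bar> \<le> 4 * D \<and> \<bar>F1 x\<bar> \<le> 4 * D \<and> \<bar>F2 x\<bar> \<le> 4 * D \<and> \<bar>F3 x\<bar> \<le> 4 * D) \<and>
    (\<forall>x. \<bar>p x * F2 x + q x * F1 x - (f x - c)\<bar> \<le> \<epsilon>)"
    using F(3,4) eq by (intro exI[of _ "\<lambda>x. F x - F 0"] exI[of _ F1] exI[of _ F2] exI[of _ F3] exI[of _ c]) blast
qed

text \<open>For positive \<open>p\<close> the corrector is exact, and one \<open>F\<close> serves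
  every \<open>\<epsilon>\<close>. Its third derivative comes from the quotient formula for
  \<open>H\<close> and involves a single derivative of \<open>f\<close>; continuity and periodicity
  bound it.\<close>

lemma correctable_elliptic:
  assumes p: "C2_circ p" "\<And>x. p x > 0" and q: "C2_circ q" and f: "C1_circ f"
  shows "correctable p q f"
proof -
  obtain p1 p2 where p': "pi_periodic p" "\<And>x. (p has_real_derivative p1 x) (at x)"
    "\<And>x. (p1 has_real_derivative p2 x) (at x)"
    using C2_circ_bounds[OF p(1)] by metis
  obtain q1 q2 where q': "pi_periodic q" "\<And>x. (q has_real_derivative q1 x) (at x)"
    "\<And>x. (q1 has_real_derivative q2 x) (at x)"
    using C2_circ_bounds[OF q] by metis
  obtain f1 where f': "pi_periodic f" "\<And>x. (f has_real_derivative f1 x) (at x)" "continuous_on UNIV f1"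
    using f unfolding C1_circ_def by blast
  note cont = has_real_derivative_imp_continuous_on[OF p'(2)] has_real_derivative_imp_continuous_on[OF q'(2)]
    has_real_derivative_imp_continuous_on[OF f'(2)] has_real_derivative_imp_continuous_on[OF p'(3)]
    has_real_derivative_imp_continuous_on[OF q'(3)]
  obtain F G H c where F: "pi_periodic F" "\<And>x. (F has_real_derivative G x) (at x)"
    "\<And>x. (G has_real_derivative H x) (at x)" and eq: "\<And>x. p x * H x + q x * G x = f x - c"
    using exists_periodic_corrector[OF p'(1) q'(1) f'(1) cont(1-3) p(2)] by metis
  have nz: "p x \<noteq> 0" for x using p(2)[of x] by simp
  have Heq: "H = (\<lambda>x. (f x - c - q x * G x) / p x)"
    using eq nz by (auto simp: fun_eq_iff field_simps)
  define J where "J x = ((f1 x - (q1 x * G x + q x * H x)) * p x - (f x - c - q x * G x) * p1 x) / (p x * p x)" for x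
  have dH: "(H has_real_derivative J x) (at x)" for x
    unfolding Heq J_def by (rule derivative_eq_intros p' q' f' F refl nz | simp add: Heq)+
  note cG = has_real_derivative_imp_continuous_on[OF F(2)] has_real_derivative_imp_continuous_on[OF F(3)]
    has_real_derivative_imp_continuous_on[OF dH]
  have cJ: "continuous_on UNIV J"
    unfolding J_def using nz by (intro continuous_intros cont cG f'(3)) auto
  have per: "pi_periodic G" "pi_periodic H" "pi_periodic J" using pi_periodic_deriv F dH by blast+
  obtain B1 where "\<And>x. \<bar>G x\<bar> \<le> B1" using pi_periodic_bounded[OF per(1) cG(2)] by blast
  moreover obtain B2 where "\<And>x. \<bar>H x\<bar> \<le> B2" using pi_periodic_bounded[OF per(2) cG(3)] by blast
  moreover obtain B3 where "\<And>x. \<bar>J x\<bar> \<le> B3" using pi_periodic_bounded[OF per(3) cJ] by blast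
  ultimately have "\<bar>G x\<bar> \<le> max B1 (max B2 B3) \<and> \<bar>H x\<bar> \<le> max B1 (max B2 B3) \<and> \<bar>J x\<bar> \<le> max B1 (max B2 B3)" for x
    by (meson le_max_iff_disj)
  moreover have "\<bar>p x * H x + q x * G x - (f x - c)\<bar> \<le> \<epsilon>" if "\<epsilon> > 0" for \<epsilon> x
    using eq[of x] that by simp
  ultimately show ?thesis using F dH by (intro correctableI) blast
qed

lemma correctable_degenerate:
  assumes p: "C2_circ p" "\<And>x. p x \<ge> 0" and q: "C2_circ q" and f: "C2_circ f"
    and pq: "\<And>x. p x = 0 \<Longrightarrow> q x \<noteq> 0"
    and z: "z1 < z2" "z2 < z1 + pi" "p z1 = 0"
    and arcs: "\<And>x. z1 < x \<Longrightarrow> x < z2 \<Longrightarrow> p x > 0" "\<And>x. z2 < x \<Longrightarrow> x < z1 + pi \<Longrightarrow> p x > 0"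
  shows "correctable p q f"
proof -
  obtain p1 p2 Bp where p': "pi_periodic p" "\<And>x. (p has_real_derivative p1 x) (at x)"
    "\<And>x. (p1 has_real_derivative p2 x) (at x)" "\<And>x. \<bar>p x\<bar> \<le> Bp" "\<And>x. \<bar>p1 x\<bar> \<le> Bp" "\<And>x. \<bar>p2 x\<bar> \<le> Bp"
    using C2_circ_bounds[OF p(1)] by metis
  obtain q1 q2 Bq where q': "pi_periodic q" "\<And>x. (q has_real_derivative q1 x) (at x)"
    "\<And>x. (q1 has_real_derivative q2 x) (at x)" "\<And>x. \<bar>q x\<bar> \<le> Bq" "\<And>x. \<bar>q1 x\<bar> \<le> Bq" "\<And>x. \<bar>q2 x\<bar> \<le> Bq"
    using C2_circ_bounds[OF q] by metis
  obtain f1 f2 Bf where f': "pi_periodic f" "\<And>x. (f has_real_derivative f1 x) (at x)"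
    "\<And>x. (f1 has_real_derivative f2 x) (at x)" "\<And>x. \<bar>f x\<bar> \<le> Bf" "\<And>x. \<bar>f1 x\<bar> \<le> Bf" "\<And>x. \<bar>f2 x\<bar> \<le> Bf"
    using C2_circ_bounds[OF f] by metis
  note cont = has_real_derivative_imp_continuous_on[OF p'(2)] has_real_derivative_imp_continuous_on[OF q'(2)]
    has_real_derivative_imp_continuous_on[OF f'(2)] has_real_derivative_imp_continuous_on[OF p'(3)]
  define S where "S = max Bp (max Bq Bf)"
  have p1_0: "p1 x = 0" if "p x = 0" for x
    by (rule DERIV_local_min[OF p'(2), of 1]) (use p(2) that in auto)
  \<comment> \<open>Minus the larger of \<open>p\<close> and the least of the three coefficients. It
    is continuous and periodic, so it attains its maximum, which is negative because all three
    coefficients equal \<open>q\<close> at a zero of \<open>p\<close>. \<open>\<delta>\<close> is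
    the absolute value of that maximum.\<close>
  define w where "w x = - max (p x) (min \<bar>q x\<bar> (min \<bar>p1 x + q x\<bar> \<bar>2 * p1 x + q x\<bar>))" for x
  have "pi_periodic p1" using pi_periodic_deriv p' by blast
  hence "pi_periodic w" using p'(1) q'(1) by (simp add: w_def pi_periodic_def)
  moreover have "continuous_on UNIV w" unfolding w_def by (intro continuous_intros cont)
  ultimately obtain x0 where x0: "\<And>x. w x \<le> w x0" using pi_periodic_attains_max by blast
  define \<delta> where "\<delta> = - w x0"
  have "\<delta> > 0"
  proof (cases "p x0 = 0")
    case True
    thus ?thesis using p1_0[OF True] pq[OF True] by (simp add: \<delta>_def w_def less_max_iff_disj)
  next
    case False
    hence "p x0 > 0" using p(2)[of x0] by simp
    thus ?thesis by (simp add: \<delta>_def w_def less_max_iff_disj)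
  qed
  have \<delta>: "p x \<ge> \<delta> \<or> \<bar>q x\<bar> \<ge> \<delta> \<and> \<bar>p1 x + q x\<bar> \<ge> \<delta> \<and> \<bar>2 * p1 x + q x\<bar> \<ge> \<delta>" for x
  proof -
    have "- w x = max (p x) (min \<bar>q x\<bar> (min \<bar>p1 x + q x\<bar> \<bar>2 * p1 x + q x\<bar>))"
      by (simp only: w_def minus_minus)
    moreover have "\<delta> \<le> - w x" using x0[of x] by (simp add: \<delta>_def)
    ultimately show ?thesis by (simp only: le_max_iff_disj min.bounded_iff)
  qed
  interpret degenerate_elliptic p p1 p2 q q1 q2 f f1 f2 S \<delta>
  proof unfold_locales
    show "\<bar>p1 x\<bar> \<le> S" "\<bar>p2 x\<bar> \<le> S" "\<bar>q x\<bar> \<le> S" "\<bar>q1 x\<bar> \<le> S" "\<bar>q2 x\<bar> \<le> S"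
      "\<bar>f x\<bar> \<le> S" "\<bar>f1 x\<bar> \<le> S" "\<bar>f2 x\<bar> \<le> S" for x
      using p'(5,6)[of x] q'(4-6)[of x] f'(4-6)[of x] by (auto simp: S_def le_max_iff_disj)
  qed (use p' q' f' p \<delta> \<open>\<delta> > 0\<close> in auto)
  obtain m \<epsilon>0 where \<epsilon>0: "\<epsilon>0 > 0" and m: "\<And>\<epsilon> F G H c x. 0 < \<epsilon> \<Longrightarrow> \<epsilon> < \<epsilon>0 \<Longrightarrow> \<bar>c\<bar> \<le> S \<Longrightarrow> pi_periodic F \<Longrightarrow>
      (\<And>x. (F has_real_derivative G x) (at x)) \<Longrightarrow> (\<And>x. (G has_real_derivative H x) (at x)) \<Longrightarrow>
      (\<And>x. (p x + \<epsilon>) * H x + q x * G x = f x - c) \<Longrightarrow> \<bar>G x\<bar> \<le> m"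
    using corrector_bounded[OF z pq[OF z(3)] arcs] by metis
  define C where "C = (2 * S + S * m) / \<delta>"
  define C2 where "C2 = (S + S * m + 3 * (S * C)) / \<delta>"
  show ?thesis
  proof (rule correctableI[of "max m (max C C2)"])
    fix \<epsilon> :: real assume \<epsilon>: "\<epsilon> > 0"
    \<comment> \<open>Small enough for the uniform bound to apply, and such that the defect
      \<open>e * H\<close> left by using \<open>p + e\<close> in place of \<open>p\<close> is at
      most \<open>\<epsilon>\<close>. The constants \<open>m\<close>, \<open>C\<close> and
      \<open>C2\<close> were fixed before \<open>\<epsilon>\<close>.\<close>
    define e where "e = min (\<epsilon>0 / 2) (\<epsilon> / (\<bar>C\<bar> + 1))"
    have e: "0 < e" "e < \<epsilon>0" "e * \<bar>C\<bar> \<le> \<epsilon>"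
    proof -
      show "0 < e" "e < \<epsilon>0" using \<epsilon> \<epsilon>0 by (auto simp: e_def)
      have "e * (\<bar>C\<bar> + 1) \<le> \<epsilon> / (\<bar>C\<bar> + 1) * (\<bar>C\<bar> + 1)"
        by (intro mult_right_mono) (auto simp: e_def)
      also have "\<dots> = \<epsilon>" by simp
      finally show "e * \<bar>C\<bar> \<le> \<epsilon>" using \<open>0 < e\<close> by (simp add: distrib_left)
    qed
    have "pi_periodic (\<lambda>x. p x + e)" using p'(1) by (simp add: pi_periodic_def)
    moreover have "continuous_on UNIV (\<lambda>x. p x + e)" by (intro continuous_intros cont)
    moreover have "p x + e > 0" for x using p(2)[of x] e by simp
    ultimately obtain F G H c where F: "pi_periodic F" "\<And>x. (F has_real_derivative G x) (at x)"
      "\<And>x. (G has_real_derivative H x) (at x)" and eq: "\<And>x. (p x + e) * H x + q x * G x = f x - c"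
      and c: "c \<in> range f"
      using exists_periodic_corrector[of "\<lambda>x. p x + e" q f] q'(1) f'(1) cont by metis
    have c: "\<bar>c\<bar> \<le> S" using c bf(1) by auto
    have Gm: "\<bar>G x\<bar> \<le> m" for x using m[OF e(1,2) c F eq] .
    have Gper: "pi_periodic G" using pi_periodic_deriv F by blast
    have HC: "\<bar>H x\<bar> \<le> C" for x
      unfolding C_def by (rule corrector_derivative_bounds(1)[OF e(1) c Gper F(3) eq Gm])
    obtain J where J: "\<And>x. (H has_real_derivative J x) (at x)" "\<And>x. \<bar>J x\<bar> \<le> C2"
      using corrector_derivative_bounds(2)[OF e(1) c Gper F(3) eq Gm] unfolding C2_def C_def by blast
    have "\<bar>p x * H x + q x * G x - (f x - c)\<bar> \<le> \<epsilon>" for x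
    proof -
      have "p x * H x + q x * G x - (f x - c) = - (e * H x)" using eq[of x] by (simp add: algebra_simps)
      moreover have "e * \<bar>H x\<bar> \<le> e * \<bar>C\<bar>" using HC[of x] e by (intro mult_left_mono) auto
      hence "e * \<bar>H x\<bar> \<le> \<epsilon>" using e(3) by linarith
      ultimately show ?thesis using e(1) by (simp add: abs_mult)
    qed
    moreover have "\<bar>G x\<bar> \<le> max m (max C C2) \<and> \<bar>H x\<bar> \<le> max m (max C C2) \<and> \<bar>J x\<bar> \<le> max m (max C C2)" for x
      using Gm[of x] HC[of x] J(2)[of x] by (simp add: le_max_iff_disj)
    ultimately show "\<exists>F F1 F2 F3 c. pi_periodic F \<and>
      (\<forall>x. (F has_real_derivative F1 x) (at x)) \<and> (\<forall>x. (F1 has_real_derivative F2 x) (at x)) \<and>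
      (\<forall>x. (F2 has_real_derivative F3 x) (at x)) \<and>
      (\<forall>x. \<bar>F1 x\<bar> \<le> max m (max C C2) \<and> \<bar>F2 x\<bar> \<le> max m (max C C2) \<and> \<bar>F3 x\<bar> \<le> max m (max C C2)) \<and>
      (\<forall>x. \<bar>p x * F2 x + q x * F1 x - (f x - c)\<bar> \<le> \<epsilon>)"
      using F J(1) by blast
  qed
qed

context anomalous_family
begin

section \<open>Regularity of the coefficients \<open>p\<close> and \<open>q\<close>, and the zeros
  of \<open>p\<close>\<close>

lemma integrable_entry_mult:
  assumes "k \<ge> 1"
  shows "integrable M (\<lambda>\<sigma>. P k \<sigma> $ i $ j * P k \<sigma> $ i' $ j')"
proof (rule integrable_of_norm_le[of _ "B k * B k"])
  have [measurable]: "P k \<in> borel_measurable M" using P_meas assms .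
  show "(\<lambda>\<sigma>. P k \<sigma> $ i $ j * P k \<sigma> $ i' $ j') \<in> borel_measurable M" by measurable
  fix \<sigma> assume \<sigma>: "\<sigma> \<in> space M"
  have "\<bar>P k \<sigma> $ i $ j\<bar> \<le> B k" "\<bar>P k \<sigma> $ i' $ j'\<bar> \<le> B k"
    using order_trans[OF abs_mat2_entry_le PB[OF assms \<sigma>]] by blast+
  thus "norm (P k \<sigma> $ i $ j * P k \<sigma> $ i' $ j') \<le> B k * B k"
    unfolding real_norm_def abs_mult by (intro mult_mono) (auto intro: order_trans[OF abs_ge_zero])
qed

text \<open>Expanding the square exhibits \<open>p\<close> as a trigonometric polynomial whose
  coefficients are second moments of the entries of \<open>P 1\<close>, which avoids differentiation
  under the integral. The same device handles \<open>q\<close>.\<close>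

lemma C2_circ_p: "C2_circ p"
proof -
  let ?E = "\<lambda>i j i' j'. (\<integral>\<sigma>. P 1 \<sigma> $ i $ j * P 1 \<sigma> $ i' $ j' \<partial>M)"
  have eq: "p = (\<lambda>\<theta>. ?E 2 1 2 1 * ((cos \<theta>)\<^sup>2 * (cos \<theta>)\<^sup>2) + ?E 1 2 1 2 * ((sin \<theta>)\<^sup>2 * (sin \<theta>)\<^sup>2)
     + ?E 1 1 1 1 * (sin (2 * \<theta>) * sin (2 * \<theta>)) + (- 2 * ?E 2 1 1 2) * ((cos \<theta>)\<^sup>2 * (sin \<theta>)\<^sup>2)
     + (- 2 * ?E 2 1 1 1) * ((cos \<theta>)\<^sup>2 * sin (2 * \<theta>)) + 2 * ?E 1 2 1 1 * ((sin \<theta>)\<^sup>2 * sin (2 * \<theta>)))"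
  proof
    fix \<theta>
    have e: "(pk X \<theta>)\<^sup>2 = (X $ 2 $ 1 * X $ 2 $ 1) * ((cos \<theta>)\<^sup>2 * (cos \<theta>)\<^sup>2) + (X $ 1 $ 2 * X $ 1 $ 2) * ((sin \<theta>)\<^sup>2 * (sin \<theta>)\<^sup>2)
     + (X $ 1 $ 1 * X $ 1 $ 1) * (sin (2 * \<theta>) * sin (2 * \<theta>)) + (X $ 2 $ 1 * X $ 1 $ 2) * (- 2 * ((cos \<theta>)\<^sup>2 * (sin \<theta>)\<^sup>2))
     + (X $ 2 $ 1 * X $ 1 $ 1) * (- 2 * ((cos \<theta>)\<^sup>2 * sin (2 * \<theta>))) + (X $ 1 $ 2 * X $ 1 $ 1) * (2 * ((sin \<theta>)\<^sup>2 * sin (2 * \<theta>)))" for X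
      unfolding pk_def by algebra
    show "p \<theta> = ?E 2 1 2 1 * ((cos \<theta>)\<^sup>2 * (cos \<theta>)\<^sup>2) + ?E 1 2 1 2 * ((sin \<theta>)\<^sup>2 * (sin \<theta>)\<^sup>2)
     + ?E 1 1 1 1 * (sin (2 * \<theta>) * sin (2 * \<theta>)) + (- 2 * ?E 2 1 1 2) * ((cos \<theta>)\<^sup>2 * (sin \<theta>)\<^sup>2)
     + (- 2 * ?E 2 1 1 1) * ((cos \<theta>)\<^sup>2 * sin (2 * \<theta>)) + 2 * ?E 1 2 1 1 * ((sin \<theta>)\<^sup>2 * sin (2 * \<theta>))"
      unfolding p_def e by (simp add: integrable_entry_mult)
  qed
  show ?thesis unfolding eq
    by (intro C2_circ_add C2_circ_mult C2_circ_const C2_circ_trig C2_circ_cos_sin_squared)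
qed

lemma C2_circ_q: "C2_circ q"
proof -
  let ?E = "\<lambda>i j i' j'. (\<integral>\<sigma>. P 1 \<sigma> $ i $ j * P 1 \<sigma> $ i' $ j' \<partial>M)"
  have intPK: "integrable M (P K)"
    by (rule integrable_of_norm_le[of _ "B K"]) (use PB K_ge P_meas in auto)
  have K: "(\<integral>\<sigma>. pk (P K \<sigma>) \<theta> \<partial>M) = pk (\<integral>\<sigma>. P K \<sigma> \<partial>M) \<theta>" for \<theta>
    using integral_bounded_linear[OF bounded_linear_pk intPK] .
  have eq: "q = (\<lambda>\<theta>. 2 * pk (\<integral>\<sigma>. P K \<sigma> \<partial>M) \<theta> + (
      (?E 2 1 1 2) * (((sin \<theta>)\<^sup>2 + (- 1) * (cos \<theta>)\<^sup>2) * sin (2 * \<theta>)) + ?E 2 1 2 1 * (- 1 * ((cos \<theta>)\<^sup>2 * sin (2 * \<theta>)))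
      + ?E 2 1 1 1 * (sin (2 * \<theta>) * sin (2 * \<theta>) + (- 2) * ((cos \<theta>)\<^sup>2 * cos (2 * \<theta>)))
      + ?E 1 2 1 2 * ((sin \<theta>)\<^sup>2 * sin (2 * \<theta>))
      + ?E 1 2 1 1 * (2 * ((sin \<theta>)\<^sup>2 * cos (2 * \<theta>)) + sin (2 * \<theta>) * sin (2 * \<theta>))
      + ?E 1 1 1 1 * (2 * (sin (2 * \<theta>) * cos (2 * \<theta>)))))"
  proof
    fix \<theta>
    have e: "pk X \<theta> * dpk X \<theta> = (X $ 2 $ 1 * X $ 1 $ 2) * (((sin \<theta>)\<^sup>2 + (- 1) * (cos \<theta>)\<^sup>2) * sin (2 * \<theta>)) + (X $ 2 $ 1 * X $ 2 $ 1) * (- 1 * ((cos \<theta>)\<^sup>2 * sin (2 * \<theta>)))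
      + (X $ 2 $ 1 * X $ 1 $ 1) * (sin (2 * \<theta>) * sin (2 * \<theta>) + (- 2) * ((cos \<theta>)\<^sup>2 * cos (2 * \<theta>)))
      + (X $ 1 $ 2 * X $ 1 $ 2) * ((sin \<theta>)\<^sup>2 * sin (2 * \<theta>))
      + (X $ 1 $ 2 * X $ 1 $ 1) * (2 * ((sin \<theta>)\<^sup>2 * cos (2 * \<theta>)) + sin (2 * \<theta>) * sin (2 * \<theta>))
      + (X $ 1 $ 1 * X $ 1 $ 1) * (2 * (sin (2 * \<theta>) * cos (2 * \<theta>)))" for X
      unfolding pk_def dpk_def by algebra
    have "(\<integral>\<sigma>. pk (P 1 \<sigma>) \<theta> * dpk (P 1 \<sigma>) \<theta> \<partial>M) =
      (?E 2 1 1 2) * (((sin \<theta>)\<^sup>2 + (- 1) * (cos \<theta>)\<^sup>2) * sin (2 * \<theta>)) + ?E 2 1 2 1 * (- 1 * ((cos \<theta>)\<^sup>2 * sin (2 * \<theta>)))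
      + ?E 2 1 1 1 * (sin (2 * \<theta>) * sin (2 * \<theta>) + (- 2) * ((cos \<theta>)\<^sup>2 * cos (2 * \<theta>)))
      + ?E 1 2 1 2 * ((sin \<theta>)\<^sup>2 * sin (2 * \<theta>))
      + ?E 1 2 1 1 * (2 * ((sin \<theta>)\<^sup>2 * cos (2 * \<theta>)) + sin (2 * \<theta>) * sin (2 * \<theta>))
      + ?E 1 1 1 1 * (2 * (sin (2 * \<theta>) * cos (2 * \<theta>)))"
      unfolding e by (simp add: integrable_entry_mult)
    thus "q \<theta> = 2 * pk (\<integral>\<sigma>. P K \<sigma> \<partial>M) \<theta> + (
      (?E 2 1 1 2) * (((sin \<theta>)\<^sup>2 + (- 1) * (cos \<theta>)\<^sup>2) * sin (2 * \<theta>)) + ?E 2 1 2 1 * (- 1 * ((cos \<theta>)\<^sup>2 * sin (2 * \<theta>)))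
      + ?E 2 1 1 1 * (sin (2 * \<theta>) * sin (2 * \<theta>) + (- 2) * ((cos \<theta>)\<^sup>2 * cos (2 * \<theta>)))
      + ?E 1 2 1 2 * ((sin \<theta>)\<^sup>2 * sin (2 * \<theta>))
      + ?E 1 2 1 1 * (2 * ((sin \<theta>)\<^sup>2 * cos (2 * \<theta>)) + sin (2 * \<theta>) * sin (2 * \<theta>))
      + ?E 1 1 1 1 * (2 * (sin (2 * \<theta>) * cos (2 * \<theta>))))"
      unfolding q_def K by simp
  qed
  show ?thesis unfolding eq
    by (intro C2_circ_add C2_circ_mult C2_circ_const C2_circ_trig C2_circ_cos_sin_squared C2_circ_pk)
qed

lemma p_nonneg: "p \<theta> \<ge> 0"
  unfolding p_def by simp

lemma integrable_pk_P1_squared: "integrable M (\<lambda>\<sigma>. (pk (P 1 \<sigma>) \<theta>)\<^sup>2)"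
proof (rule integrable_of_norm_le[of _ "(3 * B 1)\<^sup>2"])
  have [measurable]: "P 1 \<in> borel_measurable M" using P_meas by simp
  show "(\<lambda>\<sigma>. (pk (P 1 \<sigma>) \<theta>)\<^sup>2) \<in> borel_measurable M" by measurable
  fix \<sigma> assume "\<sigma> \<in> space M"
  hence "\<bar>pk (P 1 \<sigma>) \<theta>\<bar> \<le> 3 * B 1" using abs_pk_le[of "P 1 \<sigma>" \<theta>] PB[of 1 \<sigma>] by simp
  hence "\<bar>pk (P 1 \<sigma>) \<theta>\<bar>\<^sup>2 \<le> (3 * B 1)\<^sup>2" by (intro power_mono) auto
  thus "norm ((pk (P 1 \<sigma>) \<theta>)\<^sup>2) \<le> (3 * B 1)\<^sup>2" by simp
qed

lemma p_eq_0_imp_AE: "p \<theta> = 0 \<Longrightarrow> AE \<sigma> in M. pk (P 1 \<sigma>) \<theta> = 0"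
  unfolding p_def using integral_nonneg_eq_0_iff_AE[OF integrable_pk_P1_squared] by simp

text \<open>A zero of \<open>p\<close> makes \<open>pk (P 1 \<sigma>)\<close> vanish there for
  almost every \<open>\<sigma>\<close>. Three zeros distinct modulo \<open>pi\<close> would force
  \<open>P 1 = 0\<close> almost surely, against \<open>nondeg\<close>. If \<open>z1\<close> is the
  only zero, the midpoint of the period serves as \<open>z2\<close>.\<close>

lemma p_arcs:
  assumes nondeg: "measure M {\<sigma> \<in> space M. P 1 \<sigma> = 0} < 1" and z1: "p z1 = 0"
  obtains z2 where "z1 < z2" "z2 < z1 + pi" "\<And>x. z1 < x \<Longrightarrow> x < z2 \<Longrightarrow> p x > 0"
    "\<And>x. z2 < x \<Longrightarrow> x < z1 + pi \<Longrightarrow> p x > 0"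
proof -
  have uniq: "x = y" if x: "z1 < x" "x < z1 + pi" "p x = 0" and y: "z1 < y" "y < z1 + pi" "p y = 0" for x y
  proof (rule ccontr)
    assume "x \<noteq> y"
    have nz: "sin t \<noteq> 0" if "t \<noteq> 0" "- pi < t" "t < pi" for t
      using sin_gt_zero[of t] sin_gt_zero[of "- t"] that by (cases t "0::real" rule: linorder_cases) auto
    have s: "sin (z1 - x) \<noteq> 0" "sin (z1 - y) \<noteq> 0" "sin (x - y) \<noteq> 0"
      by (rule nz; use x y \<open>x \<noteq> y\<close> in simp)+
    have "AE \<sigma> in M. P 1 \<sigma> = 0"
      using p_eq_0_imp_AE[OF z1] p_eq_0_imp_AE[OF x(3)] p_eq_0_imp_AE[OF y(3)] AE_space
    proof eventually_elim
      case (elim \<sigma>)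
      show ?case
        by (rule sl2_pk_three_zeros[of _ z1 x y]) (use elim P_sl s in auto)
    qed
    hence "measure M {\<sigma> \<in> space M. P 1 \<sigma> = 0} = 1"
      using P_meas[of 1] by (subst prob_eq_1) (auto intro: measurable_sets_Collect)
    thus False using nondeg by simp
  qed
  have pos: "p x > 0" if "p x \<noteq> 0" for x using p_nonneg[of x] that by simp
  show ?thesis
  proof (cases "\<exists>x. z1 < x \<and> x < z1 + pi \<and> p x = 0")
    case True
    then obtain z2 where z2: "z1 < z2" "z2 < z1 + pi" "p z2 = 0" by blast
    show ?thesis
    proof (rule that[OF z2(1,2)])
      show "p x > 0" if "z1 < x" "x < z2" for x
        using uniq[of x z2] z2 that by (intro pos) auto
      show "p x > 0" if "z2 < x" "x < z1 + pi" for x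
        using uniq[of x z2] z2 that by (intro pos) auto
    qed
  next
    case False
    show ?thesis by (rule that[of "z1 + pi / 2"]) (use False in \<open>auto intro!: pos\<close>)
  qed
qed

lemma correctable_C2:
  assumes nondeg: "measure M {\<sigma> \<in> space M. P 1 \<sigma> = 0} < 1"
    and pq: "\<And>x. p x = 0 \<Longrightarrow> q x \<noteq> 0" and f: "C2_circ f"
  shows "correctable p q f"
proof (cases "\<exists>x. p x = 0")
  case True
  then obtain z1 where z1: "p z1 = 0" by blast
  obtain z2 where z2: "z1 < z2" "z2 < z1 + pi" "\<And>x. z1 < x \<Longrightarrow> x < z2 \<Longrightarrow> p x > 0"
    "\<And>x. z2 < x \<Longrightarrow> x < z1 + pi \<Longrightarrow> p x > 0"
    using p_arcs[OF nondeg z1] by metis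
  show ?thesis
    by (rule correctable_degenerate[OF C2_circ_p p_nonneg C2_circ_q f pq z2(1,2) z1 z2(3,4)])
next
  case False
  hence "p x > 0" for x using p_nonneg[of x] by (metis less_eq_real_def)
  thus ?thesis by (intro correctable_elliptic C2_circ_p C2_circ_q C2_circ_imp_C1_circ f)
qed

text \<open>The error has three sources: the boundary term of the telescoping sum, the one-step
  error, and the defect of the corrector. Only the last depends on \<open>\<epsilon>\<close>, and it
  is removed by letting \<open>\<epsilon>\<close> tend to 0 with \<open>lam\<close> and
  \<open>N\<close> fixed.\<close>

lemma ergodic_average:
  assumes f: "C1_circ f" and corr: "correctable p q f"
    and gs: "groundstate p q \<rho>" and nonneg: "\<And>x. \<rho> x \<ge> 0" and cont: "continuous_on UNIV \<rho>"
  shows "\<exists>C. \<forall>lam N. 0 < lam \<and> lam < lam0 \<and> N \<ge> 1 \<longrightarrow>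
    \<bar>I_N M (\<lambda>\<sigma>. ST (A lam \<sigma>)) \<theta> N f - integral {0..pi} (\<lambda>\<theta>. f \<theta> * \<rho> \<theta>)\<bar>
      \<le> C * (lam powr (eta_t - \<eta> K) + 1 / (lam powr \<eta> K * real N))"
proof -
  obtain D where D: "\<And>\<epsilon>. \<epsilon> > 0 \<Longrightarrow> \<exists>F F1 F2 F3 c. pi_periodic F \<and>
    (\<forall>x. (F has_real_derivative F1 x) (at x)) \<and> (\<forall>x. (F1 has_real_derivative F2 x) (at x)) \<and>
    (\<forall>x. (F2 has_real_derivative F3 x) (at x)) \<and>
    (\<forall>x. \<bar>F x\<bar> \<le> D \<and> \<bar>F1 x\<bar> \<le> D \<and> \<bar>F2 x\<bar> \<le> D \<and> \<bar>F3 x\<bar> \<le> D) \<and>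
    (\<forall>x. \<bar>p x * F2 x + q x * F1 x - (f x - c)\<bar> \<le> \<epsilon>)"
    using corr unfolding correctable_def by blast
  have D0: "D \<ge> 0" using D[of 1] by (force intro: order_trans[OF abs_ge_zero])
  obtain f1 where f': "pi_periodic f" "\<And>x. (f has_real_derivative f1 x) (at x)"
    using f unfolding C1_circ_def by blast
  have fc: "continuous_on UNIV f" by (rule has_real_derivative_imp_continuous_on[OF f'(2)])
  obtain Bf where Bf: "\<And>x. \<bar>f x\<bar> \<le> Bf" using pi_periodic_bounded[OF f'(1) fc] by blast
  obtain p1 where p': "pi_periodic p" "\<And>x. (p has_real_derivative p1 x) (at x)"
    using C2_circ_p unfolding C2_circ_def by blast
  obtain q1 where q': "pi_periodic q" "\<And>x. (q has_real_derivative q1 x) (at x)"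
    using C2_circ_q unfolding C2_circ_def by blast
  define c1 where "c1 = 50 * s ^ 3 + 21 * s\<^sup>2 + 3 * s"
  have c1: "c1 \<ge> 0" using s_nonneg by (simp add: c1_def)
  \<comment> \<open>Division by \<open>\<kappa> = lam powr \<eta> K / 2\<close> doubles
    \<open>2 * D\<close> and \<open>c1 * D\<close>; the power of \<open>lam0\<close> undoes the
    scaling \<open>lam / lam0\<close>.\<close>
  define C where "C = 4 * D + 2 * c1 * D * lam0 powr (- eta_t)"
  show ?thesis
  proof (intro exI[of _ C] allI impI)
    fix lam :: real and N :: nat assume as: "0 < lam \<and> lam < lam0 \<and> N \<ge> 1"
    hence lam: "0 < lam" "lam < lam0" and N: "N \<ge> 1" by auto
    interpret R: random_map M "\<lambda>\<sigma>. ST (A lam \<sigma>)" by (rule random_map_ST[OF lam])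
    define I where "I = I_N M (\<lambda>\<sigma>. ST (A lam \<sigma>)) \<theta> N f"
    define \<kappa> where "\<kappa> = lam powr \<eta> K / 2"
    have \<kappa>: "\<kappa> > 0" using lam by (simp add: \<kappa>_def)
    define e where "e = c1 * D * (lam / lam0) powr eta_t"
    have "\<bar>I - integral {0..pi} (\<lambda>\<theta>. f \<theta> * \<rho> \<theta>)\<bar> \<le> (2 * D / real N + e) / \<kappa>"
    proof (rule field_le_epsilon)
      fix \<epsilon> :: real assume \<epsilon>: "\<epsilon> > 0"
      then obtain F F1 F2 F3 c where F: "pi_periodic F" "\<And>x. (F has_real_derivative F1 x) (at x)"
        "\<And>x. (F1 has_real_derivative F2 x) (at x)" "\<And>x. (F2 has_real_derivative F3 x) (at x)"
        and b: "\<And>x. \<bar>F x\<bar> \<le> D" "\<And>x. \<bar>F1 x\<bar> \<le> D" "\<And>x. \<bar>F2 x\<bar> \<le> D" "\<And>x. \<bar>F3 x\<bar> \<le> D"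
        and eq: "\<And>x. \<bar>p x * F2 x + q x * F1 x - (f x - c)\<bar> \<le> \<epsilon> / 2"
        using D[of "\<epsilon> / 2"] by (metis half_gt_zero)
      define L where "L x = p x * F2 x + q x * F1 x" for x
      have Lc: "continuous_on UNIV L"
        unfolding L_def by (intro continuous_intros has_real_derivative_imp_continuous_on[OF p'(2)]
          has_real_derivative_imp_continuous_on[OF q'(2)] has_real_derivative_imp_continuous_on[OF F(3)]
          has_real_derivative_imp_continuous_on[OF F(4)])
      have "pi_periodic F1" "pi_periodic F2" using pi_periodic_deriv F by blast+
      hence "pi_periodic L" using p'(1) q'(1) by (simp add: L_def pi_periodic_def)
      then obtain BL where BL: "\<And>x. \<bar>L x\<bar> \<le> BL" using pi_periodic_bounded Lc by blast
      have "\<bar>I - c\<bar> \<le> (2 * D / real N + e) / \<kappa> + \<epsilon> / 2"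
        unfolding I_def
      proof (rule R.I_N_bound[where F = F and L = L])
        show "F \<in> borel_measurable borel" "L \<in> borel_measurable borel" "f \<in> borel_measurable borel"
          using Lc fc has_real_derivative_imp_continuous_on[OF F(2)]
          by (auto intro: borel_measurable_continuous_onI)
        show "\<bar>(\<integral>\<sigma>. F (ST (A lam \<sigma>) \<theta>) \<partial>M) - F \<theta> - \<kappa> * L \<theta>\<bar> \<le> e" for \<theta>
          using one_step[OF lam F b(2-4), of \<theta>] by (simp add: L_def \<kappa>_def e_def c1_def)
        show "\<bar>f x - c - L x\<bar> \<le> \<epsilon> / 2" for x
          using eq[of x] by (simp add: L_def abs_minus_commute)
      qed (use b BL Bf \<kappa> N in auto)
      moreover have "\<bar>c - integral {0..pi} (\<lambda>\<theta>. f \<theta> * \<rho> \<theta>)\<bar> \<le> \<epsilon> / 2"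
        by (rule groundstate_average[OF gs nonneg cont p'(1) F(1-3) fc eq])
      ultimately show "\<bar>I - integral {0..pi} (\<lambda>\<theta>. f \<theta> * \<rho> \<theta>)\<bar> \<le> (2 * D / real N + e) / \<kappa> + \<epsilon>"
        by linarith
    qed
    also have "(2 * D / real N + e) / \<kappa> = 4 * D * (1 / (lam powr \<eta> K * real N))
        + 2 * c1 * D * lam0 powr (- eta_t) * lam powr (eta_t - \<eta> K)"
      using lam N by (simp add: \<kappa>_def e_def powr_divide powr_diff powr_minus field_simps)
    also have "\<dots> \<le> C * (1 / (lam powr \<eta> K * real N)) + C * lam powr (eta_t - \<eta> K)"
      using D0 c1 by (intro add_mono mult_right_mono) (auto simp: C_def)
    finally show "\<bar>I_N M (\<lambda>\<sigma>. ST (A lam \<sigma>)) \<theta> N f - integral {0..pi} (\<lambda>\<theta>. f \<theta> * \<rho> \<theta>)\<bar>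
      \<le> C * (lam powr (eta_t - \<eta> K) + 1 / (lam powr \<eta> K * real N))"
      by (simp add: I_def distrib_left)
  qed
qed

end

section \<open>Conjugation and the final statement\<close>

lemma measurable_conjugation:
  fixes T :: "'s \<Rightarrow> mat2"
  assumes "T \<in> borel_measurable M"
  shows "(\<lambda>\<sigma>. Q ** T \<sigma> ** R) \<in> borel_measurable M"
proof -
  have "linear (\<lambda>A::mat2. Q ** A ** R)"
    by (intro linearI) (simp_all add: vec_eq_iff matrix_matrix_mult_def sum_2 algebra_simps)
  hence "continuous_on UNIV (\<lambda>A::mat2. Q ** A ** R)" by (rule linear_continuous_on[OF linear_conv_bounded_linear[THEN iffD1]])
  from measurable_compose[OF assms borel_measurable_continuous_onI[OF this]] show ?thesis .
qed

theorem theorem3: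
  fixes M :: "'s measure"
    and T :: "real \<Rightarrow> 's \<Rightarrow> mat2"
    and Mc :: mat2
    and \<eta> :: "nat \<Rightarrow> real"
    and P :: "nat \<Rightarrow> 's \<Rightarrow> mat2"
    and K :: nat
    and \<rho> :: "real \<Rightarrow> real"
    and \<theta>0 :: real
  assumes prob: "prob_space M"
    and Mc_SL: "Mc \<in> SL2"
    and P_sl: "\<And>k \<sigma>. k \<ge> 1 \<Longrightarrow> \<sigma> \<in> space M \<Longrightarrow> P k \<sigma> \<in> sl2"
    and P_meas: "\<And>k. k \<ge> 1 \<Longrightarrow> P k \<in> borel_measurable M"
    and eta_pos: "0 < \<eta> 1"
    and eta_mono: "\<And>k l. 1 \<le> k \<Longrightarrow> k < l \<Longrightarrow> \<eta> k < \<eta> l"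
    and expansion: "\<exists>lam0>0. \<exists>B::nat \<Rightarrow> real. \<exists>CT.
        (\<forall>k\<ge>1. \<forall>\<sigma>\<in>space M. norm (P k \<sigma>) \<le> B k) \<and>
        summable (\<lambda>k. lam0 powr \<eta> (Suc k) * B (Suc k)) \<and>
        (\<forall>lam. 0 < lam \<and> lam < lam0 \<longrightarrow>
           T lam \<in> borel_measurable M \<and>
           (\<forall>\<sigma>\<in>space M. T lam \<sigma> \<in> SL2 \<and> norm (T lam \<sigma>) \<le> CT \<and>
              (let X = (\<Sum>k. (lam powr \<eta> (Suc k)) *\<^sub>R P (Suc k) \<sigma>) in
                 Mc ** T lam \<sigma> ** matrix_inv Mc = mexp X \<or>
                 Mc ** T lam \<sigma> ** matrix_inv Mc = - mexp X)))"
    and K_ge: "K \<ge> 1"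
    and eta_K: "\<eta> K = 2 * \<eta> 1"
    and eta_K1: "\<eta> (K + 1) \<le> \<eta> 1 + \<eta> 2"
    and nondeg: "\<And>k. 1 \<le> k \<Longrightarrow> k < K \<Longrightarrow> measure M {\<sigma> \<in> space M. P k \<sigma> = 0} < 1"
    and anomaly: "\<And>k. 1 \<le> k \<Longrightarrow> k < K \<Longrightarrow> (\<integral>\<sigma>. P k \<sigma> \<partial>M) = 0"
    and zeros: "\<And>\<theta>. (\<integral>\<sigma>. (pk (P 1 \<sigma>) \<theta>)\<^sup>2 \<partial>M) = 0 \<Longrightarrow>
        2 * (\<integral>\<sigma>. pk (P K \<sigma>) \<theta> \<partial>M)
          + (\<integral>\<sigma>. pk (P 1 \<sigma>) \<theta> * deriv (pk (P 1 \<sigma>)) \<theta> \<partial>M) \<noteq> 0"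
    and rho_gs: "groundstate
        (\<lambda>\<theta>. \<integral>\<sigma>. (pk (P 1 \<sigma>) \<theta>)\<^sup>2 \<partial>M)
        (\<lambda>\<theta>. 2 * (\<integral>\<sigma>. pk (P K \<sigma>) \<theta> \<partial>M)
               + (\<integral>\<sigma>. pk (P 1 \<sigma>) \<theta> * deriv (pk (P 1 \<sigma>)) \<theta> \<partial>M)) \<rho>"
    and rho_nonneg: "\<And>\<theta>. \<rho> \<theta> \<ge> 0"
    and rho_cont: "continuous_on UNIV \<rho>"
  shows "let S = (\<lambda>lam \<sigma>. ST (Mc ** T lam \<sigma> ** matrix_inv Mc));
             eta_t = (if \<exists>k>K. (\<integral>\<sigma>. P k \<sigma> \<partial>M) \<noteq> 0
                      then min (\<eta> (LEAST k. k > K \<and> (\<integral>\<sigma>. P k \<sigma> \<partial>M) \<noteq> 0)) (\<eta> 1 + \<eta> 2)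
                      else \<eta> 1 + \<eta> 2);
             p = (\<lambda>\<theta>. \<integral>\<sigma>. (pk (P 1 \<sigma>) \<theta>)\<^sup>2 \<partial>M);
             good = (\<lambda>f. \<exists>C lam1. 0 < lam1 \<and> (\<forall>lam N. 0 < lam \<and> lam < lam1 \<and> N \<ge> 1 \<longrightarrow>
                 \<bar>I_N M (S lam) \<theta>0 N f - integral {0..pi} (\<lambda>\<theta>. f \<theta> * \<rho> \<theta>)\<bar>
                   \<le> C * (lam powr (eta_t - \<eta> K) + 1 / (lam powr \<eta> K * real N))))
         in (\<forall>f. C2_circ f \<longrightarrow> good f) \<and>
            ((\<forall>\<theta>. p \<theta> \<noteq> 0) \<longrightarrow> (\<forall>f. C1_circ f \<longrightarrow> good f))"
proof -
  obtain lam0 B CT where lam0: "lam0 > 0"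
    and PB: "\<And>k \<sigma>. k \<ge> 1 \<Longrightarrow> \<sigma> \<in> space M \<Longrightarrow> norm (P k \<sigma>) \<le> B k"
    and summB: "summable (\<lambda>k. lam0 powr \<eta> (Suc k) * B (Suc k))"
    and T: "\<And>lam. 0 < lam \<Longrightarrow> lam < lam0 \<Longrightarrow> T lam \<in> borel_measurable M"
      "\<And>lam \<sigma>. 0 < lam \<Longrightarrow> lam < lam0 \<Longrightarrow> \<sigma> \<in> space M \<Longrightarrow> T lam \<sigma> \<in> SL2"
      "\<And>lam \<sigma>. 0 < lam \<Longrightarrow> lam < lam0 \<Longrightarrow> \<sigma> \<in> space M \<Longrightarrow>
        Mc ** T lam \<sigma> ** matrix_inv Mc = mexp (\<Sum>k. (lam powr \<eta> (Suc k)) *\<^sub>R P (Suc k) \<sigma>) \<or>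
        Mc ** T lam \<sigma> ** matrix_inv Mc = - mexp (\<Sum>k. (lam powr \<eta> (Suc k)) *\<^sub>R P (Suc k) \<sigma>)"
    using expansion unfolding Let_def by blast
  interpret prob_space M by (rule prob)
  have "invertible Mc" using Mc_SL by (simp add: SL2_def invertible_det_nz)
  hence "Mc ** matrix_inv Mc = mat 1"
    unfolding invertible_def matrix_inv_def by (rule someI2_ex) blast
  hence "det Mc * det (matrix_inv Mc) = 1" by (metis det_I det_mul)
  hence detM: "det Mc \<noteq> 0" "det (matrix_inv Mc) \<noteq> 0" by auto
  interpret anomalous_family M "\<lambda>lam \<sigma>. Mc ** T lam \<sigma> ** matrix_inv Mc" \<eta> P K lam0 B
  proof unfold_locales
    show "det (Mc ** T lam \<sigma> ** matrix_inv Mc) \<noteq> 0" if "0 < lam" "lam < lam0" "\<sigma> \<in> space M" for lam \<sigma>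
      using T(2)[OF that] detM by (simp add: det_mul SL2_def)
    show "(\<lambda>\<sigma>. Mc ** T lam \<sigma> ** matrix_inv Mc) \<in> borel_measurable M" if "0 < lam" "lam < lam0" for lam
      by (rule measurable_conjugation[OF T(1)[OF that]])
  qed (use P_sl P_meas eta_pos eta_mono lam0 PB summB T K_ge eta_K anomaly in auto)
  \<comment> \<open>Replacing \<open>deriv (pk P)\<close> by \<open>dpk P\<close> makes the
    hypotheses literally statements about the \<open>p\<close> and \<open>q\<close> of the
    locale.\<close>
  note gs = rho_gs[unfolded deriv_pk, folded p_def q_def]
  note z = zeros[unfolded deriv_pk, folded p_def q_def]
  \<comment> \<open>The radius \<open>lam0\<close> of the expansion itself serves as
    \<open>lam1\<close>.\<close>
  have good: "\<exists>C lam1. 0 < lam1 \<and> (\<forall>lam N. 0 < lam \<and> lam < lam1 \<and> N \<ge> 1 \<longrightarrow>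
      \<bar>I_N M (\<lambda>\<sigma>. ST (Mc ** T lam \<sigma> ** matrix_inv Mc)) \<theta>0 N f - integral {0..pi} (\<lambda>\<theta>. f \<theta> * \<rho> \<theta>)\<bar>
        \<le> C * (lam powr (eta_t - \<eta> K) + 1 / (lam powr \<eta> K * real N)))"
    if "C1_circ f" "correctable p q f" for f
    using ergodic_average[OF that gs rho_nonneg rho_cont] lam0 by blast
  \<comment> \<open>\<open>K > 1\<close> because \<open>\<eta> K = 2 * \<eta> 1\<close>, so the
    nondegeneracy condition covers index 1.\<close>
  have nd: "measure M {\<sigma> \<in> space M. P 1 \<sigma> = 0} < 1" using nondeg[of 1] K_gt_1 by simp
  show ?thesis
    unfolding Let_def eta_t_def[symmetric] p_def[symmetric]
  proof (intro conjI allI impI)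
    fix f assume "C2_circ f"
    thus "\<exists>C lam1. 0 < lam1 \<and> (\<forall>lam N. 0 < lam \<and> lam < lam1 \<and> N \<ge> 1 \<longrightarrow>
      \<bar>I_N M (\<lambda>\<sigma>. ST (Mc ** T lam \<sigma> ** matrix_inv Mc)) \<theta>0 N f - integral {0..pi} (\<lambda>\<theta>. f \<theta> * \<rho> \<theta>)\<bar>
        \<le> C * (lam powr (eta_t - \<eta> K) + 1 / (lam powr \<eta> K * real N)))"
      by (intro good C2_circ_imp_C1_circ correctable_C2 nd z)
  next
    fix f assume "\<forall>\<theta>. p \<theta> \<noteq> 0" "C1_circ f"
    moreover from this have "p x > 0" for x using p_nonneg[of x] by (metis less_eq_real_def)
    ultimately show "\<exists>C lam1. 0 < lam1 \<and> (\<forall>lam N. 0 < lam \<and> lam < lam1 \<and> N \<ge> 1 \<longrightarrow>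
      \<bar>I_N M (\<lambda>\<sigma>. ST (Mc ** T lam \<sigma> ** matrix_inv Mc)) \<theta>0 N f - integral {0..pi} (\<lambda>\<theta>. f \<theta> * \<rho> \<theta>)\<bar>
        \<le> C * (lam powr (eta_t - \<eta> K) + 1 / (lam powr \<eta> K * real N)))"
      by (intro good correctable_elliptic C2_circ_p C2_circ_q)
  qed
qed

end
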